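(* Let $R$ be a commutative unital ring in which $2$ is invertible, let $n,d\ge1$ be integers, and let $g(x)=\sum_{0\le t\le d/2}a_{d-2t}x^{d-2t}\in R[x]$ with $a_d=1$. Then, as an $R$-module, $$\mathrm{SupTr}(\mathfrak{H}_n^g)_{\bar 0}=R\text{-}\mathrm{Span}\bigl\{\mathbf{w}_\beta^{cl}+[\mathfrak{H}_n^g,\mathfrak{H}_n^g]^-_{\bar 0}\;\bigm|\;\beta\in\widehat{\mathscr{P}^c_n}\bigr\}.$$
   Context: **Cyclotomic Sergeev algebra.** The affine Sergeev algebra $\mathfrak{H}_n$ is the $R$-superalgebra generated by even generators $s_1,\ldots,s_{n-1},x_1,\ldots,x_n$ and odd generators $c_1,\ldots,c_n$ subject to: $s_i^2=1$, $s_is_j=s_js_i$ for $|i-j|>1$, $s_is_{i+1}s_i=s_{i+1}s_is_{i+1}$; $x_ix_j=x_jx_i$; $c_i^2=1$, $c_ic_j=-c_jc_i$ for $i\ne j$; $s_ix_i=x_{i+1}s_i-(1+c_ic_{i+1})$; $s_ix_j=x_js_i$ for $j\ne i,i+1$; $s_ic_i=c_{i+1}s_i$, $s_ic_{i+1}=c_is_i$, $s_ic_j=c_js_i$ for $j\neq i,i+1$; $x_ic_i=-c_ix_i$, $x_ic_j=c_jx_i$ for $i\ne j$. Then $\mathfrak{H}_n^g:=\mathfrak{H}_n/I_g$, with $I_g$ the two-sided ideal generated by $g(x_1)$; its level is $d$. Write $s_0:=x_1\in\mathfrak{H}_n^g$. **Supercocenter.** For a superalgebra $A$ with parity $|\cdot|$,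 $[A,A]^-$ is the $R$-span of all supercommutators $xy-(-1)^{|x||y|}yx$ with $x,y$ homogeneous; $\mathrm{SupTr}(A)=A/[A,A]^-$, which is $\mathbb Z_2$-graded with $\mathrm{SupTr}(A)_{\bar0}=A_{\bar 0}/[A,A]^-_{\bar 0}$. **Colored semi-bipartitions.** An opposite partition is a composition $\lambda=(\lambda_1\le\cdots\le\lambda_k)$ (positive parts); a color datum for it is a function $c:\{1,\dots,k\}\to\{1,\dots,d-1\}$ with $c(i)\ge c(i+1)$ whenever $\lambda_i=\lambda_{i+1}$. $\mathscr{P}^c_n$ is the set of pairs $\beta=(\lambda,\mu)$ where, for some $0\le s\le n$, $\lambda$ is an opposite partition of $s$ with a color datum $c$ and $\mu$ is a partition of $n-s$. For $\beta=(\lambda,\mu)$ with $\lambda=(\lambda_1,\dots,\lambda_k)$, $\mu=(\mu_1,\dots,\mu_l)$ (so $\ell(\lambda)=k$, $\ell(\mu)=l$), let $\overline\beta=(\overline\beta_1,\dots,\overline\beta_{k+l})=(\lambda_1,\dots,\lambda_k,\mu_1,\dots,\mu_l)$, $\epsilon=(\epsilon_1,\dots,\epsilon_{k+l})=(c(1),\dots,c(k),0,\dots,0)$ ($l$ zeros), $r_1=0$ and $r_i=\overline\beta_1+\cdots+\overline\beta_{i-1}$ for $2\le i\le k+l+1$. Define $\widehat{\mathscr{P}^c_n}$ as the set of $\beta\in\mathscr{P}^c_n$ such that: $\overline\beta_i\neq\overline\beta_j$ whenever $i\ne j$ and $\epsilon_i=\epsilon_j$ is even; and $\#\{1\le i\le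 \ell(\lambda)+\ell(\mu):\epsilon_i\text{ even}\}$ is even. **The elements $\mathbf{w}_\beta^{cl}$.** For $0\le k\le n-1$, $l\ge1$, put $s'_{k,l}=s_ks_{k-1}\cdots s_1s_0^ls_1\cdots s_{k-1}s_k$. Set $w_{\overline\beta,\epsilon,i}=s'_{r_i,\epsilon_i}s_{r_i+1}s_{r_i+2}\cdots s_{r_{i+1}-1}$ if $\epsilon_i\neq0$, and $w_{\overline\beta,\epsilon,i}=s_{r_i+1}s_{r_i+2}\cdots s_{r_{i+1}-1}$ if $\epsilon_i=0$, regarded as products of generators in $\mathfrak{H}_n^g$ (with $s_0=x_1$). For $\beta\in\widehat{\mathscr{P}^c_n}$, $$\mathbf{w}_\beta^{cl}=\Bigl(\prod_{i=1}^{\ell(\lambda)+\ell(\mu)}w_{\overline\beta,\epsilon,i}\Bigr)\Bigl(\prod_{i=1}^{\ell(\lambda)+\ell(\mu)}c_{r_{i+1}}^{(1+(-1)^{\epsilon_i})/2}\Bigr)\in(\mathfrak{H}_n^g)_{\bar 0},$$ products taken in increasing order of $i$. *)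

theory Defs
  imports
    "HOL-Algebra.Algebraic_Closure_Type"
    "HOL-Library.Poly_Mapping"
    "HOL-Library.Z2"
begin

text \<open>
  The parity is a value of type \<^typ>\<open>bit\<close>; the field \<open>hpart\<close> gives the two homogeneous
  components. The ground ring is the type \<open>'r\<close>.
\<close>

record ('r, 'a) superalgebra = "('r, 'a) module" +
  hpart :: "bit \<Rightarrow> 'a set"

definition rspan :: "('r::comm_ring_1, 'a, 'm) module_scheme \<Rightarrow> 'a set \<Rightarrow> 'a set" where
  "rspan M S = (\<lambda>N. submodule N (ring_of_type_algebra :: 'r ring) M) hull S"

definition coset_smult :: "('r, 'a, 'm) module_scheme \<Rightarrow> 'a set \<Rightarrow> 'r \<Rightarrow> 'a set \<Rightarrow> 'a set" where
  "coset_smult M N r B = (\<Union>b\<in>B. N +>\<^bsub>M\<^esub> (r \<odot>\<^bsub>M\<^esub> b))"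

text \<open>
  In a quotient module the ring multiplication and unit, which are fields of the library's
  record \<open>module\<close> but play no role in its locale, are left undefined.
\<close>

definition module_quot :: "('r, 'a, 'm) module_scheme \<Rightarrow> 'a set \<Rightarrow> ('r, 'a set) module" where
  "module_quot M N =
    \<lparr>carrier = a_rcosets\<^bsub>M\<^esub> N, monoid.mult = undefined, one = undefined,
      zero = N, add = set_add M, module.smult = coset_smult M N\<rparr>"

definition superalgebra_quot ::
    "('r, 'a) superalgebra \<Rightarrow> 'a set \<Rightarrow> ('r, 'a set) superalgebra" where
  "superalgebra_quot A I =
    \<lparr>carrier = carrier (A Quot I), monoid.mult = monoid.mult (A Quot I), one = monoid.one (A Quot I),
      zero = ring.zero (A Quot I), add = ring.add (A Quot I), module.smult = coset_smult A I,
      hpart = (\<lambda>p. (\<lambda>x. I +>\<^bsub>A\<^esub> x) ` hpart A p)\<rparr>"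

definition supercommutators :: "('r, 'a) superalgebra \<Rightarrow> 'a set" where
  "supercommutators A =
    {x \<otimes>\<^bsub>A\<^esub> y \<ominus>\<^bsub>A\<^esub> (if p = 1 \<and> q = 1 then \<ominus>\<^bsub>A\<^esub> \<one>\<^bsub>A\<^esub> else \<one>\<^bsub>A\<^esub>) \<otimes>\<^bsub>A\<^esub> (y \<otimes>\<^bsub>A\<^esub> x) | x y p q.
      x \<in> hpart A p \<and> y \<in> hpart A q}"

definition supercomm_span :: "('r::comm_ring_1, 'a) superalgebra \<Rightarrow> 'a set" where
  "supercomm_span A = rspan A (supercommutators A)"

definition supercomm_span_even :: "('r::comm_ring_1, 'a) superalgebra \<Rightarrow> 'a set" where
  "supercomm_span_even A = supercomm_span A \<inter> hpart A 0"

definition SupTr_even :: "('r::comm_ring_1, 'a) superalgebra \<Rightarrow> ('r, 'a set) module" where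
  "SupTr_even A = module_quot (A\<lparr>carrier := hpart A 0\<rparr>) (supercomm_span_even A)"

text \<open>
  Words form a monoid, written additively so that finitely supported functions on words
  with the convolution product of \<open>Poly_Mapping\<close> are the free associative algebra.
\<close>

datatype 'a fword = FWord (letters: "'a list")

instantiation fword :: (type) monoid_add
begin

definition zero_fword :: "'a fword" where
  "zero_fword = FWord []"

definition plus_fword :: "'a fword \<Rightarrow> 'a fword \<Rightarrow> 'a fword" where
  "plus_fword u v = FWord (letters u @ letters v)"

instance
  by standard (simp_all add: zero_fword_def plus_fword_def)

end

datatype gen = SGen nat | XGen nat | CGen nat

fun gen_parity :: "gen \<Rightarrow> bit" where
  "gen_parity (CGen i) = 1"
| "gen_parity _ = 0"

definition word_parity :: "gen fword \<Rightarrow> bit" where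
  "word_parity w = sum_list (map gen_parity (letters w))"

definition gens :: "nat \<Rightarrow> gen set" where
  "gens n = SGen ` {1..<n} \<union> XGen ` {1..n} \<union> CGen ` {1..n}"

type_synonym 'r free = "gen fword \<Rightarrow>\<^sub>0 'r"

definition gen_elem :: "gen \<Rightarrow> 'r::comm_ring_1 free" where
  "gen_elem a = Poly_Mapping.single (FWord [a]) 1"

definition free_carrier :: "nat \<Rightarrow> 'r::comm_ring_1 free set" where
  "free_carrier n = {f. \<forall>w\<in>Poly_Mapping.keys f. set (letters w) \<subseteq> gens n}"

definition free_superalgebra :: "nat \<Rightarrow> ('r::comm_ring_1, 'r free) superalgebra" where
  "free_superalgebra n =
    \<lparr>carrier = free_carrier n, monoid.mult = (*), one = 1, zero = 0, add = (+),
      module.smult = (\<lambda>r f. Poly_Mapping.map ((*) r) f),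
      hpart = (\<lambda>p. {f \<in> free_carrier n. \<forall>w\<in>Poly_Mapping.keys f. word_parity w = p})\<rparr>"

abbreviation fr_s :: "nat \<Rightarrow> 'r::comm_ring_1 free" where "fr_s i \<equiv> gen_elem (SGen i)"
abbreviation fr_x :: "nat \<Rightarrow> 'r::comm_ring_1 free" where "fr_x i \<equiv> gen_elem (XGen i)"
abbreviation fr_c :: "nat \<Rightarrow> 'r::comm_ring_1 free" where "fr_c i \<equiv> gen_elem (CGen i)"

text \<open>A relation \<open>u = v\<close> is represented by the element \<open>u - v\<close>.\<close>

inductive_set sergeev_rels :: "nat \<Rightarrow> 'r::comm_ring_1 free set" for n :: nat where
  ss: "i \<in> {1..<n} \<Longrightarrow> fr_s i * fr_s i - 1 \<in> sergeev_rels n"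
| ss_comm: "\<lbrakk>i \<in> {1..<n}; j \<in> {1..<n}; \<bar>int i - int j\<bar> > 1\<rbrakk> \<Longrightarrow>
    fr_s i * fr_s j - fr_s j * fr_s i \<in> sergeev_rels n"
| braid: "\<lbrakk>i \<in> {1..<n}; i + 1 \<in> {1..<n}\<rbrakk> \<Longrightarrow>
    fr_s i * fr_s (i + 1) * fr_s i - fr_s (i + 1) * fr_s i * fr_s (i + 1) \<in> sergeev_rels n"
| xx: "\<lbrakk>i \<in> {1..n}; j \<in> {1..n}\<rbrakk> \<Longrightarrow> fr_x i * fr_x j - fr_x j * fr_x i \<in> sergeev_rels n"
| cc: "i \<in> {1..n} \<Longrightarrow> fr_c i * fr_c i - 1 \<in> sergeev_rels n"
| cc_anticomm: "\<lbrakk>i \<in> {1..n}; j \<in> {1..n}; i \<noteq> j\<rbrakk> \<Longrightarrow>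
    fr_c i * fr_c j - (- (fr_c j * fr_c i)) \<in> sergeev_rels n"
| sx: "i \<in> {1..<n} \<Longrightarrow>
    fr_s i * fr_x i - (fr_x (i + 1) * fr_s i - (1 + fr_c i * fr_c (i + 1))) \<in> sergeev_rels n"
| sx_comm: "\<lbrakk>i \<in> {1..<n}; j \<in> {1..n}; j \<noteq> i; j \<noteq> i + 1\<rbrakk> \<Longrightarrow>
    fr_s i * fr_x j - fr_x j * fr_s i \<in> sergeev_rels n"
| sc: "i \<in> {1..<n} \<Longrightarrow> fr_s i * fr_c i - fr_c (i + 1) * fr_s i \<in> sergeev_rels n"
| sc_Suc: "i \<in> {1..<n} \<Longrightarrow> fr_s i * fr_c (i + 1) - fr_c i * fr_s i \<in> sergeev_rels n"
| sc_comm: "\<lbrakk>i \<in> {1..<n}; j \<in> {1..n}; j \<noteq> i; j \<noteq> i + 1\<rbrakk> \<Longrightarrow>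
    fr_s i * fr_c j - fr_c j * fr_s i \<in> sergeev_rels n"
| xc_anticomm: "i \<in> {1..n} \<Longrightarrow> fr_x i * fr_c i - (- (fr_c i * fr_x i)) \<in> sergeev_rels n"
| xc_comm: "\<lbrakk>i \<in> {1..n}; j \<in> {1..n}; i \<noteq> j\<rbrakk> \<Longrightarrow>
    fr_x i * fr_c j - fr_c j * fr_x i \<in> sergeev_rels n"

definition sergeev_ideal :: "nat \<Rightarrow> 'r::comm_ring_1 free set" where
  "sergeev_ideal n = genideal (free_superalgebra n) (sergeev_rels n)"

definition affine_sergeev :: "nat \<Rightarrow> ('r::comm_ring_1, 'r free set) superalgebra" where
  "affine_sergeev n = superalgebra_quot (free_superalgebra n) (sergeev_ideal n)"

definition affine_gen :: "nat \<Rightarrow> gen \<Rightarrow> 'r::comm_ring_1 free set" where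
  "affine_gen n a = sergeev_ideal n +>\<^bsub>free_superalgebra n\<^esub> gen_elem a"

definition poly_at_x1 :: "nat \<Rightarrow> 'r::comm_ring_1 poly \<Rightarrow> 'r free set" where
  "poly_at_x1 n g =
    (\<Oplus>\<^bsub>affine_sergeev n\<^esub>k\<in>{..Polynomial.degree g}.
      Polynomial.coeff g k \<odot>\<^bsub>affine_sergeev n\<^esub> (affine_gen n (XGen 1) [^]\<^bsub>affine_sergeev n\<^esub> k))"

definition cyclotomic_ideal :: "nat \<Rightarrow> 'r::comm_ring_1 poly \<Rightarrow> 'r free set set" where
  "cyclotomic_ideal n g = genideal (affine_sergeev n) {poly_at_x1 n g}"

definition cyclotomic_sergeev ::
    "nat \<Rightarrow> 'r::comm_ring_1 poly \<Rightarrow> ('r, 'r free set set) superalgebra" where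
  "cyclotomic_sergeev n g = superalgebra_quot (affine_sergeev n) (cyclotomic_ideal n g)"

definition cyclotomic_gen :: "nat \<Rightarrow> 'r::comm_ring_1 poly \<Rightarrow> gen \<Rightarrow> 'r free set set" where
  "cyclotomic_gen n g a = cyclotomic_ideal n g +>\<^bsub>affine_sergeev n\<^esub> affine_gen n a"

definition gen_prod :: "nat \<Rightarrow> 'r::comm_ring_1 poly \<Rightarrow> gen list \<Rightarrow> 'r free set set" where
  "gen_prod n g as =
    foldr (monoid.mult (cyclotomic_sergeev n g)) (map (cyclotomic_gen n g) as)
      (monoid.one (cyclotomic_sergeev n g))"

text \<open>
  A colored semi-bipartition is a triple \<open>((\<lambda>, col), \<mu>)\<close> of lists. List positions count
  from 0, so \<open>\<lambda> ! i\<close> is the part with index \<open>i + 1\<close>, of color \<open>col ! i\<close>.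
\<close>

type_synonym semibip = "(nat list \<times> nat list) \<times> nat list"

definition opposite_partition :: "nat \<Rightarrow> nat list \<Rightarrow> bool" where
  "opposite_partition m lam \<longleftrightarrow> sorted lam \<and> 0 \<notin> set lam \<and> sum_list lam = m"

definition partition_of :: "nat \<Rightarrow> nat list \<Rightarrow> bool" where
  "partition_of m mu \<longleftrightarrow> sorted_wrt (\<ge>) mu \<and> 0 \<notin> set mu \<and> sum_list mu = m"

definition color_datum :: "nat \<Rightarrow> nat list \<Rightarrow> nat list \<Rightarrow> bool" where
  "color_datum d lam col \<longleftrightarrow>
    length col = length lam \<and> set col \<subseteq> {1..d - 1} \<and>
    (\<forall>i. i + 1 < length lam \<longrightarrow> lam ! i = lam ! (i + 1) \<longrightarrow> col ! i \<ge> col ! (i + 1))"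

definition semibips :: "nat \<Rightarrow> nat \<Rightarrow> semibip set" where
  "semibips n d = {((lam, col), mu). \<exists>m\<le>n.
    opposite_partition m lam \<and> color_datum d lam col \<and> partition_of (n - m) mu}"

definition parts :: "semibip \<Rightarrow> nat list" where
  "parts \<beta> = fst (fst \<beta>) @ snd \<beta>"

definition colors :: "semibip \<Rightarrow> nat list" where
  "colors \<beta> = snd (fst \<beta>) @ replicate (length (snd \<beta>)) 0"

text \<open>\<open>offset \<beta> i\<close> is the sum of the first \<open>i\<close> parts, i.e. \<open>r\<^bsub>i+1\<^esub>\<close> for 1-based \<open>r\<close>.\<close>

definition offset :: "semibip \<Rightarrow> nat \<Rightarrow> nat" where
  "offset \<beta> i = sum_list (take i (parts \<beta>))"

definition semibips_hat :: "nat \<Rightarrow> nat \<Rightarrow> semibip set" where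
  "semibips_hat n d = {\<beta> \<in> semibips n d.
    (\<forall>i < length (parts \<beta>). \<forall>j < length (parts \<beta>).
      i \<noteq> j \<and> colors \<beta> ! i = colors \<beta> ! j \<and> even (colors \<beta> ! i) \<longrightarrow>
      parts \<beta> ! i \<noteq> parts \<beta> ! j) \<and>
    even (card {i. i < length (parts \<beta>) \<and> even (colors \<beta> ! i)})}"

text \<open>The convention \<open>s\<^sub>0 = x\<^sub>1\<close>.\<close>

definition s0_gen :: "nat \<Rightarrow> gen" where
  "s0_gen i = (if i = 0 then XGen 1 else SGen i)"

definition sprime_word :: "nat \<Rightarrow> nat \<Rightarrow> gen list" where
  "sprime_word k l =
    map s0_gen (rev [1..<k + 1]) @ replicate l (s0_gen 0) @ map s0_gen [1..<k + 1]"

definition w_word :: "semibip \<Rightarrow> nat \<Rightarrow> gen list" where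
  "w_word \<beta> i =
    (if colors \<beta> ! i \<noteq> 0 then sprime_word (offset \<beta> i) (colors \<beta> ! i) else []) @
    map s0_gen [offset \<beta> i + 1..<offset \<beta> (i + 1)]"

text \<open>The exponent \<open>(1 + (-1)\<^sup>\<epsilon>) / 2\<close> is 1 for even \<open>\<epsilon>\<close> and 0 for odd \<open>\<epsilon>\<close>.\<close>

definition clifford_word :: "semibip \<Rightarrow> nat \<Rightarrow> gen list" where
  "clifford_word \<beta> i = (if even (colors \<beta> ! i) then [CGen (offset \<beta> (i + 1))] else [])"

definition w_cl :: "nat \<Rightarrow> 'r::comm_ring_1 poly \<Rightarrow> semibip \<Rightarrow> 'r free set set" where
  "w_cl n g \<beta> =
    gen_prod n g
      (concat (map (w_word \<beta>) [0..<length (parts \<beta>)]) @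
       concat (map (clifford_word \<beta>) [0..<length (parts \<beta>)]))"

end

theory Submission
  imports Defs "HOL-Combinatorics.Transposition"
begin

text \<open>
  Filter the algebra by the number of factors \<open>x\<^sub>i\<close>. Modulo lower terms every defining relation
  identifies two words up to sign, and \<open>x\<^sub>1\<^sup>d\<close> is a combination of lower powers; so, by induction on the
  degree, the claim becomes a statement about words with signs under these relations and the
  rotation \<open>u v = \<plusminus> v u\<close> allowed in the supercocenter. Peeling off one strand at a time and rotating
  turns every even word into a product of blocks
  \<open>x\<^bsub>r+1\<^esub>\<^sup>m s\<^bsub>r+1\<^esub> \<dots> s\<^bsub>r+k-1\<^esub> c\<^bsub>r+k\<^esub>\<^sup>e\<close> on consecutive strands, and conjugation by block
  permutations reorders the blocks. Conjugating a block by the product of the \<open>c\<^sub>i\<close> on its strands multiplies the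
  word by \<open>(-1)\<^bsup>m+e+1\<^esup>\<close>, and exchanging two equal blocks with \<open>e = 1\<close> multiplies it by \<open>-1\<close>. As \<open>2\<close> is
  invertible, only words with \<open>e = 1\<close> exactly for even \<open>m\<close> and with distinct even blocks survive;
  these are the words of the semi-bipartitions.
\<close>

section \<open>Signed words modulo the leading terms of the relations\<close>

text \<open>The degree counts only the \<open>x\<close> because a single relation,
  \<open>s_i x_i = x_(i+1) s_i - (1 + c_i c_(i+1))\<close>, is inhomogeneous: its two extra terms
  lose one \<open>x\<close> but keep the parity. Dropping them leaves relations between single
  words, so the reduction to blocks is pure combinatorics of lists of letters; the dropped terms are
  accounted for afterwards, when every even word of smaller degree is already known to lie in the
  span. Signs are a nuisance that can mostly be avoided. A member of the span may be negated freely,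
  so most reductions only assert that some sign exists. The exact sign is computed only where a word
  returns to itself and is found to equal its own negative: conjugation by Clifford generators
  leaves the strands and the underlying permutation of a block alone, and exchanging equal blocks
  restores the list of blocks, so in both cases nothing but the sign is left.\<close>

fun is_C :: "gen \<Rightarrow> bool" where "is_C (CGen i) = True" | "is_C _ = False"
fun is_X :: "gen \<Rightarrow> bool" where "is_X (XGen i) = True" | "is_X _ = False"
fun strands :: "gen \<Rightarrow> nat set" where
  "strands (SGen i) = {i, Suc i}" | "strands (XGen i) = {i}" | "strands (CGen i) = {i}"

definition odd_word :: "gen list \<Rightarrow> bool" where "odd_word u = odd (length (filter is_C u))"
definition x_degree :: "gen list \<Rightarrow> nat" where "x_degree u = length (filter is_X u)"

lemma odd_word_simps [simp]: "odd_word [] = False" "odd_word (a # u) = (is_C a \<noteq> odd_word u)" "odd_word (u @ v) = (odd_word u \<noteq> odd_word v)"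
    "odd_word (rev u) = odd_word u"
  by (auto simp: odd_word_def rev_filter[symmetric])

lemma x_degree_simps [simp]: "x_degree [] = 0" "x_degree (a # u) = of_bool (is_X a) + x_degree u" "x_degree (u @ v) = x_degree u + x_degree v"
  by (auto simp: x_degree_def)

lemma gens_simps [simp]: "SGen i \<in> gens n \<longleftrightarrow> 1 \<le> i \<and> i < n" "XGen i \<in> gens n \<longleftrightarrow> 1 \<le> i \<and> i \<le> n"
    "CGen i \<in> gens n \<longleftrightarrow> 1 \<le> i \<and> i \<le> n"
  by (auto simp: gens_def)

lemma gens_mono: "m \<le> n \<Longrightarrow> gens m \<subseteq> gens n"
  by (auto simp: gens_def)

lemma strands_gens: "a \<in> gens n \<Longrightarrow> strands a \<subseteq> {1..n}"
  by (cases a) auto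

abbreviation sw :: "nat \<Rightarrow> nat \<Rightarrow> nat" where "sw i \<equiv> transpose i (Suc i)"

text \<open>
  The flag is true for the sign \<open>-1\<close>. Rule \<open>word_rel_sx\<close> omits the term \<open>1 + c\<^sub>i c\<^bsub>i+1\<^esub>\<close> of the relation
  and therefore holds only modulo words with fewer \<open>x\<close>.
\<close>

inductive word_rel :: "nat \<Rightarrow> bool \<Rightarrow> gen list \<Rightarrow> gen list \<Rightarrow> bool" for n where
  word_rel_refl: "word_rel n False u u"
| word_rel_sym: "word_rel n b u v \<Longrightarrow> word_rel n b v u"
| word_rel_trans: "word_rel n b u v \<Longrightarrow> word_rel n b' v w \<Longrightarrow> word_rel n (b \<noteq> b') u w"
| word_rel_cong: "word_rel n b u v \<Longrightarrow> word_rel n b (p @ u @ q) (p @ v @ q)"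
| word_rel_ss: "SGen i \<in> gens n \<Longrightarrow> word_rel n False [SGen i, SGen i] []"
| word_rel_far: "SGen i \<in> gens n \<Longrightarrow> SGen j \<in> gens n \<Longrightarrow> Suc i < j \<Longrightarrow> word_rel n False [SGen i, SGen j] [SGen j, SGen i]"
| word_rel_braid: "SGen i \<in> gens n \<Longrightarrow> SGen (Suc i) \<in> gens n \<Longrightarrow>
    word_rel n False [SGen i, SGen (Suc i), SGen i] [SGen (Suc i), SGen i, SGen (Suc i)]"
| word_rel_sx: "SGen i \<in> gens n \<Longrightarrow> XGen j \<in> gens n \<Longrightarrow> word_rel n False [SGen i, XGen j] [XGen (sw i j), SGen i]"
| word_rel_sc: "SGen i \<in> gens n \<Longrightarrow> CGen j \<in> gens n \<Longrightarrow> word_rel n False [SGen i, CGen j] [CGen (sw i j), SGen i]"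
| word_rel_xx: "XGen i \<in> gens n \<Longrightarrow> XGen j \<in> gens n \<Longrightarrow> word_rel n False [XGen i, XGen j] [XGen j, XGen i]"
| word_rel_cc: "CGen i \<in> gens n \<Longrightarrow> word_rel n False [CGen i, CGen i] []"
| word_rel_cc_swap: "CGen i \<in> gens n \<Longrightarrow> CGen j \<in> gens n \<Longrightarrow> i \<noteq> j \<Longrightarrow> word_rel n True [CGen i, CGen j] [CGen j, CGen i]"
| word_rel_xc: "XGen i \<in> gens n \<Longrightarrow> CGen j \<in> gens n \<Longrightarrow> word_rel n (i = j) [XGen i, CGen j] [CGen j, XGen i]"

text \<open>Without the dropped terms every rule is homogeneous, so parity, degree and membership in
  \<open>gens n\<close> are constant along a derivation. This keeps the later induction within one
  degree and within even words.\<close>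

lemma word_rel_par: "word_rel n b u v \<Longrightarrow> odd_word u = odd_word v"
  by (induction rule: word_rel.induct) auto

lemma word_rel_deg: "word_rel n b u v \<Longrightarrow> x_degree u = x_degree v"
  by (induction rule: word_rel.induct) auto

lemma word_rel_gens: "word_rel n b u v \<Longrightarrow> set u \<subseteq> gens n \<longleftrightarrow> set v \<subseteq> gens n"
  by (induction rule: word_rel.induct) (auto simp: transpose_def)

lemma word_rel_sx': "SGen i \<in> gens n \<Longrightarrow> XGen j \<in> gens n \<Longrightarrow> word_rel n False [XGen j, SGen i] [SGen i, XGen (sw i j)]"
  using word_rel_sym[OF word_rel_sx[of i n "sw i j"]] by (auto simp: transpose_def split: if_splits)

lemma word_rel_sc': "SGen i \<in> gens n \<Longrightarrow> CGen j \<in> gens n \<Longrightarrow> word_rel n False [CGen j, SGen i] [SGen i, CGen (sw i j)]"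
  using word_rel_sym[OF word_rel_sc[of i n "sw i j"]] by (auto simp: transpose_def split: if_splits)

text \<open>Reversal is an anti-automorphism of the leading relations: each rule reversed is again
  derivable, possibly read from right to left. Statements on descending runs follow in this way from
  those on ascending ones.\<close>

lemma word_rel_rev: "word_rel n b u v \<Longrightarrow> word_rel n b (rev u) (rev v)"
proof (induction rule: word_rel.induct)
  case (word_rel_cong b u v p q)
  then show ?case using word_rel.word_rel_cong[of n b "rev u" "rev v" "rev q" "rev p"] by simp
next
  case (word_rel_trans b u v b' w)
  then show ?case using word_rel.word_rel_trans by blast
next
  case (word_rel_far i j)
  then show ?case using word_rel.word_rel_sym[OF word_rel.word_rel_far] by simp
next
  case (word_rel_sx i j)
  then show ?case using word_rel_sx' by simp
next
  case (word_rel_sc i j)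
  then show ?case using word_rel_sc' by simp
next
  case (word_rel_xc i j)
  then show ?case using word_rel.word_rel_sym[OF word_rel.word_rel_xc[of i n j]] by simp
qed (auto intro: word_rel.intros)

lemma word_rel_trans0 [trans]: "word_rel n False u v \<Longrightarrow> word_rel n False v w \<Longrightarrow> word_rel n False u w"
  using word_rel_trans[of n False u v False w] by simp
lemma word_rel_trans1: "word_rel n b u v \<Longrightarrow> word_rel n b' v w \<Longrightarrow> c = (b \<noteq> b') \<Longrightarrow> word_rel n c u w"
  using word_rel_trans by simp
lemma word_rel_congL: "word_rel n b u v \<Longrightarrow> word_rel n b (p @ u) (p @ v)"
  using word_rel_cong[of n b u v p "[]"] by simp
lemma word_rel_congR: "word_rel n b u v \<Longrightarrow> word_rel n b (u @ q) (v @ q)"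
  using word_rel_cong[of n b u v "[]" q] by simp

lemma word_rel_append: "word_rel n b u v \<Longrightarrow> word_rel n b' u' v' \<Longrightarrow> c = (b \<noteq> b') \<Longrightarrow> word_rel n c (u @ u') (v @ v')"
  using word_rel_trans1[OF word_rel_congR[of n b u v u'] word_rel_congL[of n b' u' v' v]] by simp

text \<open>\<open>t\<close> crosses the letters one at a time, so the signs accumulate to the
  number of letters with \<open>P\<close>. For a product \<open>t\<close> of generators
  \<open>s_i\<close> the map \<open>f\<close> is conjugation by \<open>t\<close>; for a product of
  generators \<open>c_i\<close> it is the identity and only the sign remains.\<close>

lemma word_rel_pass:
  assumes "\<And>x. x \<in> set u \<Longrightarrow> word_rel n (P x) (t @ [x]) (f x # t)"
  shows "word_rel n (odd (length (filter P u))) (t @ u) (map f u @ t)"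
  using assms
proof (induction u)
  case Nil
  then show ?case by (simp add: word_rel_refl)
next
  case (Cons x u)
  have 1: "word_rel n (P x) ((t @ [x]) @ u) ((f x # t) @ u)" using Cons.prems by (intro word_rel_congR) simp
  have 2: "word_rel n (odd (length (filter P u))) ([f x] @ t @ u) ([f x] @ map f u @ t)"
    using Cons by (intro word_rel_congL) simp
  show ?case using word_rel_trans1[OF _ _ HOL.refl, of n "P x" "t @ x # u"] 1 2 by fastforce
qed

lemma word_rel_pass0:
  assumes "\<And>x. x \<in> set u \<Longrightarrow> word_rel n False (t @ [x]) (f x # t)"
  shows "word_rel n False (t @ u) (map f u @ t)"
  using word_rel_pass[of u n "\<lambda>_. False" t f] assms by simp

lemma word_rel_letters: 
  assumes "x \<in> gens n" "y \<in> gens n" "strands x \<inter> strands y = {}"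
  shows "word_rel n (is_C x \<and> is_C y) [x, y] [y, x]"
proof -
  show ?thesis
  proof (cases x)
    case (SGen i)
    show ?thesis
    proof (cases y)
      case y: (SGen j)
      then have "Suc i < j \<or> Suc j < i" using assms SGen by auto
      then show ?thesis using assms SGen y word_rel_far word_rel_sym[OF word_rel_far] by auto
    next
      case y: (XGen j) then show ?thesis using word_rel_sx[of i n j] assms SGen by (simp add: transpose_def)
    next
      case y: (CGen j) then show ?thesis using word_rel_sc[of i n j] assms SGen by (simp add: transpose_def)
    qed
  next
    case (XGen i)
    show ?thesis
    proof (cases y)
      case y: (SGen j) then show ?thesis using word_rel_sx'[of j n i] assms XGen by (simp add: transpose_def)
    next
      case y: (XGen j) then show ?thesis using word_rel_xx[of i n j] assms XGen by simp
    next
      case y: (CGen j) then show ?thesis using word_rel_xc[of i n j] assms XGen by simp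
    qed
  next
    case (CGen i)
    show ?thesis
    proof (cases y)
      case y: (SGen j) then show ?thesis using word_rel_sc'[of j n i] assms CGen by (simp add: transpose_def)
    next
      case y: (XGen j) then show ?thesis using word_rel_sym[OF word_rel_xc[of j n i]] assms CGen by simp
    next
      case y: (CGen j) then show ?thesis using word_rel_cc_swap[of i n j] assms CGen by simp
    qed
  qed
qed

text \<open>The sign rule of superalgebras for factors on disjoint strands: crossing
  \<open>v\<close> costs a letter \<open>x\<close> the sign \<open>(-1)^(|x||v|)\<close>, and these
  signs multiply over the letters of \<open>u\<close>.\<close>

lemma word_rel_commute:
  assumes "set u \<subseteq> gens n" "set v \<subseteq> gens n"
    and "\<And>x y. x \<in> set u \<Longrightarrow> y \<in> set v \<Longrightarrow> strands x \<inter> strands y = {}"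
  shows "word_rel n (odd_word u \<and> odd_word v) (u @ v) (v @ u)"
proof -
  have *: "word_rel n (is_C x \<and> odd_word v) (v @ [x]) ([x] @ v)" if "x \<in> set u" for x
  proof -
    have "word_rel n (odd (length (filter (\<lambda>y. is_C x \<and> is_C y) v))) ([x] @ v) (map (\<lambda>y. y) v @ [x])"
      using assms that by (intro word_rel_pass) (simp, meson subsetD word_rel_letters)
    then show ?thesis by (cases "is_C x") (auto simp: odd_word_def intro: word_rel_sym)
  qed
  have "word_rel n (odd (length (filter (\<lambda>x. is_C x \<and> odd_word v) u))) (v @ u) (map (\<lambda>x. x) u @ v)"
    using * by (intro word_rel_pass) auto
  then show ?thesis by (cases "odd_word v") (auto simp: odd_word_def intro: word_rel_sym)
qed

lemma word_rel_commute0: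
  assumes "set u \<subseteq> gens n" "set v \<subseteq> gens n" "\<not> (odd_word u \<and> odd_word v)"
    and "\<And>x y. x \<in> set u \<Longrightarrow> y \<in> set v \<Longrightarrow> strands x \<inter> strands y = {}"
  shows "word_rel n False (u @ v) (v @ u)"
  using word_rel_commute[OF assms(1,2,4)] assms(3) by simp

section \<open>Ascending runs as cycles a -> a+1 -> ... -> b -> a on the strands\<close>

definition s_run :: "nat \<Rightarrow> nat \<Rightarrow> gen list" where "s_run a b = map SGen [a..<b]"

lemma odd_word_S [simp]: "odd_word (map SGen l) = False" by (induction l) auto
lemma odd_word_up [simp]: "odd_word (s_run a b) = False" by (simp add: s_run_def)
lemma x_degree_up [simp]: "x_degree (s_run a b) = 0" by (simp add: s_run_def x_degree_def)

lemma s_run_split: "a \<le> b \<Longrightarrow> b \<le> c \<Longrightarrow> s_run a c = s_run a b @ s_run b c"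
  by (metis s_run_def map_append upt_add_eq_append le_Suc_ex)
lemma s_run_self [simp]: "b \<le> a \<Longrightarrow> s_run a b = []" by (simp add: s_run_def)
lemma s_run_head: "a < b \<Longrightarrow> s_run a b = SGen a # s_run (Suc a) b" by (simp add: s_run_def upt_conv_Cons)
lemma s_run_last: "a \<le> b \<Longrightarrow> s_run a (Suc b) = s_run a b @ [SGen b]" by (simp add: s_run_def)
lemma set_up: "set (s_run a b) = SGen ` {a..<b}" by (simp add: s_run_def)

lemma s_run_gens: "1 \<le> a \<Longrightarrow> b \<le> n \<Longrightarrow> set (s_run a b) \<subseteq> gens n"
  by (auto simp: set_up)

text \<open>For \<open>a = b\<close> the run is empty although \<open>{a..b}\<close> still contains
  \<open>a\<close>; the alternative \<open>b \<le> a\<close> admits letters on that strand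
  too.\<close>

lemma word_rel_up_far:
  assumes "1 \<le> a" "b \<le> n" "x \<in> gens n" "strands x \<inter> {a..b} = {} \<or> b \<le> a"
  shows "word_rel n False (s_run a b @ [x]) (x # s_run a b)"
proof -
  have "word_rel n False (s_run a b @ [x]) ([x] @ s_run a b)"
    using assms by (intro word_rel_commute0 s_run_gens) (simp_all add: set_up, fastforce+)
  then show ?thesis by simp
qed

text \<open>The letters after \<open>s_(i+1)\<close> avoid the strands of \<open>s_i\<close>, and
  those before \<open>s_i\<close> avoid the strands of \<open>s_(i+1)\<close>. Between them a single
  braid relation does the work.\<close>

lemma word_rel_up_S:
  assumes "1 \<le> a" "a \<le> i" "Suc i < b" "b \<le> n"
  shows "word_rel n False (s_run a b @ [SGen i]) (SGen (Suc i) # s_run a b)"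
proof -
  have e: "s_run a b = s_run a i @ [SGen i, SGen (Suc i)] @ s_run (Suc (Suc i)) b"
    using assms s_run_split[of a i b] s_run_head[of i b] s_run_head[of "Suc i" b] by simp
  have "word_rel n False ((s_run a i @ [SGen i, SGen (Suc i)]) @ (s_run (Suc (Suc i)) b @ [SGen i]))
    ((s_run a i @ [SGen i, SGen (Suc i)]) @ (SGen i # s_run (Suc (Suc i)) b))"
    using assms by (intro word_rel_congL word_rel_up_far) auto
  also have "word_rel n False \<dots> (s_run a i @ [SGen (Suc i), SGen i, SGen (Suc i)] @ s_run (Suc (Suc i)) b)"
    using word_rel_cong[OF word_rel_braid[of i n], of "s_run a i"] assms by simp
  also have "word_rel n False ((s_run a i @ [SGen (Suc i)]) @ [SGen i, SGen (Suc i)] @ s_run (Suc (Suc i)) b)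
    ((SGen (Suc i) # s_run a i) @ [SGen i, SGen (Suc i)] @ s_run (Suc (Suc i)) b)"
    using assms by (intro word_rel_congR word_rel_up_far) auto
  then have "word_rel n False (s_run a i @ [SGen (Suc i), SGen i, SGen (Suc i)] @ s_run (Suc (Suc i)) b)
    (SGen (Suc i) # s_run a i @ [SGen i, SGen (Suc i)] @ s_run (Suc (Suc i)) b)" by simp
  finally show ?thesis by (simp add: e)
qed

lemma word_rel_up_XC:
  assumes "1 \<le> a" "a \<le> j" "j < b" "b \<le> n" "G = XGen \<or> G = CGen"
  shows "word_rel n False (s_run a b @ [G j]) (G (Suc j) # s_run a b)"
proof -
  have e: "s_run a b = s_run a j @ [SGen j] @ s_run (Suc j) b"
    using assms s_run_split[of a j b] s_run_head[of j b] by simp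
  have "word_rel n False ((s_run a j @ [SGen j]) @ (s_run (Suc j) b @ [G j])) ((s_run a j @ [SGen j]) @ (G j # s_run (Suc j) b))"
    using assms by (intro word_rel_congL word_rel_up_far) auto
  also have "word_rel n False \<dots> (s_run a j @ [G (Suc j), SGen j] @ s_run (Suc j) b)"
    using word_rel_cong[OF word_rel_sx[of j n j], of "s_run a j"] word_rel_cong[OF word_rel_sc[of j n j], of "s_run a j"] assms by auto
  also have "word_rel n False ((s_run a j @ [G (Suc j)]) @ [SGen j] @ s_run (Suc j) b)
    ((G (Suc j) # s_run a j) @ [SGen j] @ s_run (Suc j) b)"
    using assms by (intro word_rel_congR word_rel_up_far) auto
  then have "word_rel n False (s_run a j @ [G (Suc j), SGen j] @ s_run (Suc j) b)
    (G (Suc j) # s_run a j @ [SGen j] @ s_run (Suc j) b)" by simp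
  finally show ?thesis by (simp add: e)
qed

text \<open>This closes the cycle: beginning with the last letter of the run, each one carries the
  generator one strand down, until it leaves on strand \<open>a\<close>.\<close>

lemma word_rel_up_XC_last:
  assumes "1 \<le> a" "a \<le> b" "b \<le> n" "G = XGen \<or> G = CGen"
  shows "word_rel n False (s_run a b @ [G b]) (G a # s_run a b)"
  using assms(2,3)
proof (induction b rule: dec_induct)
  case base
  then show ?case by (simp add: word_rel_refl)
next
  case (step b)
  have "word_rel n False (s_run a b @ [SGen b, G (Suc b)]) (s_run a b @ [G b, SGen b])"
    using word_rel_sx[of b n "Suc b"] word_rel_sc[of b n "Suc b"] assms step by (intro word_rel_congL) auto
  also have "word_rel n False ((s_run a b @ [G b]) @ [SGen b]) ((G a # s_run a b) @ [SGen b])"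
    using step by (intro word_rel_congR) auto
  then have "word_rel n False (s_run a b @ [G b, SGen b]) (G a # s_run a b @ [SGen b])" by simp
  finally show ?case using step by (simp add: s_run_last)
qed

section \<open>Reduction of words to products of blocks\<close>

lemma word_rel_down_far:
  assumes "1 \<le> a" "b \<le> n" "x \<in> gens n" "strands x \<inter> {a..b} = {} \<or> b \<le> a"
  shows "word_rel n False (rev (s_run a b) @ [x]) (x # rev (s_run a b))"
  using word_rel_sym[OF word_rel_rev[OF word_rel_up_far[OF assms]]] by simp

lemma word_rel_down_S:
  assumes "1 \<le> a" "a \<le> i" "Suc i < b" "b \<le> n"
  shows "word_rel n False (rev (s_run a b) @ [SGen (Suc i)]) (SGen i # rev (s_run a b))"
  using word_rel_sym[OF word_rel_rev[OF word_rel_up_S[OF assms]]] by simp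

lemma word_rel_down_XC:
  assumes "1 \<le> a" "a \<le> j" "j < b" "b \<le> n" "G = XGen \<or> G = CGen"
  shows "word_rel n False (rev (s_run a b) @ [G (Suc j)]) (G j # rev (s_run a b))"
  using word_rel_sym[OF word_rel_rev[OF word_rel_up_XC[OF assms]]] by simp

text \<open>Membership in a submodule does not depend on the sign, so it is hidden here; the
  existential lets derivations with different signs be composed without bookkeeping.\<close>

definition word_rel_pm :: "nat \<Rightarrow> gen list \<Rightarrow> gen list \<Rightarrow> bool" where "word_rel_pm n u v \<longleftrightarrow> (\<exists>b. word_rel n b u v)"

lemma weqsI: "word_rel n b u v \<Longrightarrow> word_rel_pm n u v" by (auto simp: word_rel_pm_def)
lemma word_rel_pm_refl: "word_rel_pm n u u" by (auto simp: word_rel_pm_def intro: word_rel_refl)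
lemma word_rel_pm_sym: "word_rel_pm n u v \<Longrightarrow> word_rel_pm n v u" by (auto simp: word_rel_pm_def intro: word_rel_sym)
lemma word_rel_pm_trans [trans]: "word_rel_pm n u v \<Longrightarrow> word_rel_pm n v w \<Longrightarrow> word_rel_pm n u w" by (auto simp: word_rel_pm_def intro: word_rel_trans)
lemma word_rel_pm_congL: "word_rel_pm n u v \<Longrightarrow> word_rel_pm n (p @ u) (p @ v)" by (auto simp: word_rel_pm_def intro: word_rel_congL)
lemma word_rel_pm_congR: "word_rel_pm n u v \<Longrightarrow> word_rel_pm n (u @ q) (v @ q)" by (auto simp: word_rel_pm_def intro: word_rel_congR)

lemma word_rel_pm_commute:
  assumes "set u \<subseteq> gens n" "set v \<subseteq> gens n"
    and "\<And>x y. x \<in> set u \<Longrightarrow> y \<in> set v \<Longrightarrow> strands x \<inter> strands y = {}"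
  shows "word_rel_pm n (u @ v) (v @ u)"
  using word_rel_commute[OF assms] by (rule weqsI)

section \<open>Coset normal form with respect to the last strand\<close>

definition xc_word :: "nat \<Rightarrow> nat \<Rightarrow> bool \<Rightarrow> gen list" where
  "xc_word l m e = replicate m (XGen l) @ (if e then [CGen l] else [])"

lemma set_xc_word: "set (xc_word l m e) \<subseteq> {XGen l, CGen l}" by (auto simp: xc_word_def)

lemma xc_word_gens: "1 \<le> l \<Longrightarrow> l \<le> n \<Longrightarrow> set (xc_word l m e) \<subseteq> gens n" by (auto simp: xc_word_def)

lemma word_rel_pm_xc_X:
  assumes "1 \<le> l" "l \<le> n"
  shows "word_rel_pm n (xc_word l m e @ [XGen l]) (xc_word l (Suc m) e)"
proof (cases e)
  case True
  have "word_rel_pm n (replicate m (XGen l) @ [CGen l, XGen l]) (replicate m (XGen l) @ [XGen l, CGen l])"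
    using assms word_rel_xc[of l n l] by (intro word_rel_pm_congL word_rel_pm_sym[OF weqsI]) auto
  then show ?thesis using True by (simp add: xc_word_def replicate_app_Cons_same)
qed (simp add: xc_word_def word_rel_pm_refl replicate_app_Cons_same replicate_append_same)

lemma word_rel_pm_xc_C:
  assumes "1 \<le> l" "l \<le> n"
  shows "word_rel_pm n (xc_word l m e @ [CGen l]) (xc_word l m (\<not> e))"
proof (cases e)
  case True
  have "word_rel_pm n (replicate m (XGen l) @ [CGen l, CGen l]) (replicate m (XGen l) @ [])"
    using assms word_rel_cc[of l n] by (intro word_rel_pm_congL weqsI) auto
  then show ?thesis using True by (simp add: xc_word_def)
qed (simp add: xc_word_def word_rel_pm_refl)

lemma word_rel_S_xc:
  assumes "1 \<le> l" "l \<le> n" "1 \<le> i" "i < n"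
  shows "word_rel n False ([SGen i] @ xc_word l m e) (xc_word (sw i l) m e @ [SGen i])"
proof -
  have "word_rel n False ([SGen i] @ xc_word l m e)
    (map (\<lambda>x. if x = XGen l then XGen (sw i l) else CGen (sw i l)) (xc_word l m e) @ [SGen i])"
    using assms set_xc_word[of l m e] word_rel_sx[of i n l] word_rel_sc[of i n l] by (intro word_rel_pass0) auto
  then show ?thesis by (cases e) (simp_all add: xc_word_def)
qed

lemma word_rel_xc_S:
  assumes "1 \<le> l" "l \<le> n" "1 \<le> i" "i < n"
  shows "word_rel n False (xc_word l m e @ [SGen i]) ([SGen i] @ xc_word (sw i l) m e)"
  using word_rel_sym[OF word_rel_S_xc[of "sw i l" n i m e]] assms by (auto simp: transpose_def split: if_splits)

text \<open>Coset decomposition of the symmetric group on \<open>k\<close> strands modulo the one on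
  \<open>k - 1\<close> strands, extended to \<open>x\<close> and \<open>c\<close>. The
  representative \<open>s_(k-1) ... s_l\<close> carries strand \<open>l\<close> to strand
  \<open>k\<close>. Hence precisely \<open>x_l\<close> and \<open>c_l\<close> cannot be moved to its
  left into \<open>gens (k - 1)\<close> and have to stay behind it.\<close>

lemma coset_normal_form:
  assumes "1 \<le> k" "k \<le> n" "set u \<subseteq> gens k"
  shows "\<exists>v l m e. set v \<subseteq> gens (k - 1) \<and> 1 \<le> l \<and> l \<le> k \<and> word_rel_pm n u (v @ rev (s_run l k) @ xc_word l m e)"
  using assms(3)
proof (induction u rule: rev_induct)
  case Nil
  have "word_rel_pm n [] ([] @ rev (s_run k k) @ xc_word k 0 False)" by (simp add: xc_word_def word_rel_pm_refl)
  then show ?case using assms by (metis empty_set empty_subsetI order_refl)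
next
  case (snoc a u)
  then obtain v l m e where v: "set v \<subseteq> gens (k - 1)" "1 \<le> l" "l \<le> k"
    and u: "word_rel_pm n u (v @ rev (s_run l k) @ xc_word l m e)" by auto
  have a: "a \<in> gens k" using snoc by simp
  have an: "a \<in> gens n" using a gens_mono[OF assms(2)] by blast
  have ln: "l \<le> n" using v assms by simp
  \<comment> \<open>Only the right end has to be normalised after appending \<open>a\<close>:
    letters \<open>v'\<close> expelled to the left are absorbed by \<open>v\<close>.\<close>
  have fin: ?case if "word_rel_pm n (rev (s_run l k) @ xc_word l m e @ [a]) (v' @ rev (s_run l' k) @ xc_word l' m' e')"
      "set v' \<subseteq> gens (k - 1)" "1 \<le> l'" "l' \<le> k" for v' l' m' e'
  proof -
    have "word_rel_pm n (u @ [a]) ((v @ rev (s_run l k) @ xc_word l m e) @ [a])" using u by (rule word_rel_pm_congR)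
    also have "word_rel_pm n (v @ (rev (s_run l k) @ xc_word l m e @ [a])) (v @ (v' @ rev (s_run l' k) @ xc_word l' m' e'))"
      using that(1) by (rule word_rel_pm_congL)
    then have "word_rel_pm n ((v @ rev (s_run l k) @ xc_word l m e) @ [a]) ((v @ v') @ rev (s_run l' k) @ xc_word l' m' e')"
      by simp
    finally show ?thesis using that v by (intro exI[of _ "v @ v'"] exI[of _ l'] exI[of _ m'] exI[of _ e']) auto
  qed
  have XC: ?case if a': "a = G i" and G: "G = XGen \<or> G = CGen" for G i
  proof -
    have i: "1 \<le> i" "i \<le> k" using a that by auto
    show ?case
    proof (cases "i = l")
      case True
      have "\<exists>m' e'. word_rel_pm n (xc_word l m e @ [a]) (xc_word l m' e')"
        using G a' True word_rel_pm_xc_X[OF v(2) ln] word_rel_pm_xc_C[OF v(2) ln] by metis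
      then obtain m' e' where "word_rel_pm n (xc_word l m e @ [a]) (xc_word l m' e')" by blast
      then have "word_rel_pm n (rev (s_run l k) @ xc_word l m e @ [a]) ([] @ rev (s_run l k) @ xc_word l m' e')"
        by (simp add: word_rel_pm_congL)
      then show ?thesis using v by (intro fin[of "[]" l m' e']) auto
    next
      case False
      have 1: "word_rel_pm n (xc_word l m e @ [a]) ([a] @ xc_word l m e)"
        using False that set_xc_word[of l m e] xc_word_gens[OF v(2) ln] an by (intro word_rel_pm_commute) fastforce+
      \<comment> \<open>The descending run fixes the strands below \<open>l\<close> and lowers those
        above by one, so the letter leaves it within the first \<open>k - 1\<close> strands.\<close>
      define a2 where "a2 = G (if i < l then i else i - 1)"
      have "word_rel n False (rev (s_run l k) @ [a]) ([a2] @ rev (s_run l k))"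
      proof (cases "i < l")
        case True
        then show ?thesis using a' G an v i assms unfolding a2_def
          by (auto intro!: word_rel_down_far)
      next
        case f: False
        then show ?thesis using word_rel_down_XC[of l "i - 1" k n G] a' G i v assms False by (simp add: a2_def)
      qed
      then have 2: "word_rel_pm n (rev (s_run l k) @ [a]) ([a2] @ rev (s_run l k))" by (rule weqsI)
      have "word_rel_pm n (rev (s_run l k) @ xc_word l m e @ [a]) (rev (s_run l k) @ [a] @ xc_word l m e)"
        using word_rel_pm_congL[OF 1] .
      also have "word_rel_pm n \<dots> ([a2] @ rev (s_run l k) @ xc_word l m e)" using word_rel_pm_congR[OF 2] by simp
      finally show ?thesis using v i G False assms by (intro fin[of "[a2]" l m e]) (auto simp: a2_def)
    qed
  qed
  show ?case
  proof (cases a)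
    case (SGen i)
    have i: "1 \<le> i" "i < k" "i < n" using a SGen assms by auto
    have start: "word_rel_pm n (rev (s_run l k) @ xc_word l m e @ [a]) ((rev (s_run l k) @ [SGen i]) @ xc_word (sw i l) m e)"
      using word_rel_pm_congL[OF weqsI[OF word_rel_xc_S[OF v(2) ln i(1,3)]]] SGen by simp
    \<comment> \<open>Against the representative, \<open>s_i\<close> passes unchanged, lengthens it,
      shortens it by \<open>s_i s_i = 1\<close>, or passes as \<open>s_(i-1)\<close>.\<close>
    consider "i + 1 < l" | "i + 1 = l" | "i = l" | "l < i" by linarith
    then show ?thesis
    proof cases
      case 1
      have "word_rel_pm n (rev (s_run l k) @ [SGen i]) ([SGen i] @ rev (s_run l k))"
        using 1 i v assms by (intro weqsI) (auto intro!: word_rel_down_far)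
      from word_rel_pm_trans[OF start word_rel_pm_congR[OF this]]
      have "word_rel_pm n (rev (s_run l k) @ xc_word l m e @ [a]) ([SGen i] @ rev (s_run l k) @ xc_word (sw i l) m e)"
        by simp
      then show ?thesis using 1 i v by (intro fin[of "[SGen i]" l m e]) (auto simp: transpose_def)
    next
      case 2
      then have "rev (s_run l k) @ [SGen i] = rev (s_run i k)" using v by (simp add: s_run_head)
      with start have "word_rel_pm n (rev (s_run l k) @ xc_word l m e @ [a]) ([] @ rev (s_run i k) @ xc_word i m e)"
        using 2 by simp
      then show ?thesis using 2 i v by (intro fin[of "[]" i m e]) auto
    next
      case 3
      have "word_rel_pm n (rev (s_run (Suc i) k) @ [SGen i, SGen i] @ xc_word (sw i l) m e) (rev (s_run (Suc i) k) @ [] @ xc_word (Suc i) m e)"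
        using 3 i word_rel_cong[OF word_rel_ss[of i n]] by (intro weqsI) auto
      moreover have "(rev (s_run l k) @ [SGen i]) @ xc_word (sw i l) m e = rev (s_run (Suc i) k) @ [SGen i, SGen i] @ xc_word (sw i l) m e"
        using 3 i by (simp add: s_run_head)
      ultimately have "word_rel_pm n (rev (s_run l k) @ xc_word l m e @ [a]) ([] @ rev (s_run (Suc i) k) @ xc_word (Suc i) m e)"
        using word_rel_pm_trans[OF start] by simp
      then show ?thesis using 3 i v by (intro fin[of "[]" "Suc i" m e]) auto
    next
      case 4
      have "word_rel_pm n (rev (s_run l k) @ [SGen i]) ([SGen (i - 1)] @ rev (s_run l k))"
        using 4 i v assms word_rel_down_S[of l "i - 1" k n] by (intro weqsI[of n False]) auto
      from word_rel_pm_trans[OF start word_rel_pm_congR[OF this]]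
      have "word_rel_pm n (rev (s_run l k) @ xc_word l m e @ [a]) ([SGen (i - 1)] @ rev (s_run l k) @ xc_word (sw i l) m e)"
        by simp
      then show ?thesis using 4 i v by (intro fin[of "[SGen (i - 1)]" l m e]) (auto simp: transpose_def)
    qed
  qed (use XC in blast)+
qed

text \<open>
  Only even words \<open>u v\<close> are rotated, whence both factors have the same parity and
  \<open>(-1)\<^bsup>|u||v|\<^esup>\<close> depends on the parity of \<open>u\<close> alone.
\<close>

inductive trace_rel :: "nat \<Rightarrow> bool \<Rightarrow> gen list \<Rightarrow> gen list \<Rightarrow> bool" for n where
  trace_rel_base: "word_rel n b u v \<Longrightarrow> trace_rel n b u v"
| trace_rel_rot: "odd_word u = odd_word v \<Longrightarrow> trace_rel n (odd_word u) (u @ v) (v @ u)"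
| trace_rel_sym: "trace_rel n b u v \<Longrightarrow> trace_rel n b v u"
| trace_rel_trans: "trace_rel n b u v \<Longrightarrow> trace_rel n b' v w \<Longrightarrow> trace_rel n (b \<noteq> b') u w"

lemma trace_rel_par: "trace_rel n b u v \<Longrightarrow> odd_word u = odd_word v"
  by (induction rule: trace_rel.induct) (auto dest: word_rel_par)
lemma trace_rel_deg: "trace_rel n b u v \<Longrightarrow> x_degree u = x_degree v"
  by (induction rule: trace_rel.induct) (auto dest: word_rel_deg)
lemma trace_rel_gens: "trace_rel n b u v \<Longrightarrow> set u \<subseteq> gens n \<longleftrightarrow> set v \<subseteq> gens n"
proof (induction rule: trace_rel.induct)
  case trace_rel_base then show ?case using word_rel_gens by blast
qed auto

lemma trace_rel_trans1: "trace_rel n b u v \<Longrightarrow> trace_rel n b' v w \<Longrightarrow> c = (b \<noteq> b') \<Longrightarrow> trace_rel n c u w"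
  using trace_rel_trans by simp

definition trace_rel_pm :: "nat \<Rightarrow> gen list \<Rightarrow> gen list \<Rightarrow> bool" where "trace_rel_pm n u v \<longleftrightarrow> (\<exists>b. trace_rel n b u v)"

lemma reqsI: "trace_rel n b u v \<Longrightarrow> trace_rel_pm n u v" by (auto simp: trace_rel_pm_def)
lemma trace_rel_pm_weqs: "word_rel_pm n u v \<Longrightarrow> trace_rel_pm n u v" by (auto simp: word_rel_pm_def trace_rel_pm_def intro: trace_rel_base)
lemma trace_rel_pm_refl: "trace_rel_pm n u u" by (intro trace_rel_pm_weqs word_rel_pm_refl)
lemma trace_rel_pm_sym: "trace_rel_pm n u v \<Longrightarrow> trace_rel_pm n v u" by (auto simp: trace_rel_pm_def intro: trace_rel_sym)
lemma trace_rel_pm_trans [trans]: "trace_rel_pm n u v \<Longrightarrow> trace_rel_pm n v w \<Longrightarrow> trace_rel_pm n u w" by (auto simp: trace_rel_pm_def intro: trace_rel_trans)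
lemma trace_rel_pm_rot: "\<not> odd_word (u @ v) \<Longrightarrow> trace_rel_pm n (u @ v) (v @ u)"
  by (auto simp: trace_rel_pm_def intro: trace_rel_rot)

text \<open>A block consists of its number of strands, its color and whether it carries a Clifford generator.\<close>

type_synonym block = "nat \<times> nat \<times> bool"

fun block_word :: "nat \<Rightarrow> block \<Rightarrow> gen list" where
  "block_word r (k, m, e) = replicate m (XGen (Suc r)) @ s_run (Suc r) (r + k) @ (if e then [CGen (r + k)] else [])"

fun blocks_word :: "nat \<Rightarrow> block list \<Rightarrow> gen list" where
  "blocks_word r [] = []"
| "blocks_word r (b # bs) = block_word r b @ blocks_word (r + fst b) bs"

lemma block_word_gens:
  assumes "1 \<le> fst b" "r + fst b \<le> n"
  shows "set (block_word r b) \<subseteq> gens n" "\<And>x. x \<in> set (block_word r b) \<Longrightarrow> strands x \<subseteq> {Suc r..r + fst b}"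
  using assms by (cases b; auto simp: set_up split: if_splits)+

lemma blocks_word_gens:
  assumes "\<forall>b\<in>set bs. 1 \<le> fst b" "r + sum_list (map fst bs) \<le> n"
  shows "set (blocks_word r bs) \<subseteq> gens n \<and> (\<forall>x \<in> set (blocks_word r bs). strands x \<subseteq> {Suc r..r + sum_list (map fst bs)})"
  using assms
proof (induction bs arbitrary: r)
  case (Cons b bs)
  have IH: "set (blocks_word (r + fst b) bs) \<subseteq> gens n \<and> (\<forall>x \<in> set (blocks_word (r + fst b) bs). strands x \<subseteq> {Suc (r + fst b)..r + fst b + sum_list (map fst bs)})"
    using Cons.prems by (intro Cons.IH) auto
  have b: "set (block_word r b) \<subseteq> gens n" using Cons.prems by (intro block_word_gens) auto
  have st: "x \<in> set (block_word r b) \<Longrightarrow> strands x \<subseteq> {Suc r..r + fst b}" for x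
    using Cons.prems by (intro block_word_gens(2)[where n = n]) auto
  have "set (blocks_word r (b # bs)) \<subseteq> gens n" using IH b by simp
  moreover have "strands x \<subseteq> {Suc r..r + sum_list (map fst (b # bs))}"
    if x: "x \<in> set (blocks_word r (b # bs))" for x
  proof -
    consider "x \<in> set (block_word r b)" | "x \<in> set (blocks_word (r + fst b) bs)" using x by auto
    then have "strands x \<subseteq> {Suc r..r + fst b} \<or> strands x \<subseteq> {Suc (r + fst b)..r + fst b + sum_list (map fst bs)}"
      using IH st by cases auto
    moreover have "{Suc r..r + fst b} \<subseteq> {Suc r..r + sum_list (map fst (b # bs))}"
      "{Suc (r + fst b)..r + fst b + sum_list (map fst bs)} \<subseteq> {Suc r..r + sum_list (map fst (b # bs))}"
      by auto
    ultimately show ?thesis by blast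
  qed
  ultimately show ?case by blast
qed simp

lemma blocks_word_append:
  "blocks_word r (as @ bs) = blocks_word r as @ blocks_word (r + sum_list (map fst as)) bs"
  by (induction as arbitrary: r) (auto simp: add_ac)

text \<open>
  Strand \<open>k\<close> either starts the block under construction (coset representative of length 0) or is
  joined to strand \<open>k - 1\<close> after the rest of the representative has been rotated to the front.
\<close>

lemma trace_rel_pm_blocks_aux:
  assumes "1 \<le> k" "k \<le> j" "j \<le> n" "set u \<subseteq> gens k"
    "\<forall>b\<in>set bs. 1 \<le> fst b" "j + sum_list (map fst bs) = n" "\<not> odd_word (u @ s_run k j @ blocks_word j bs)"
  shows "\<exists>bs'. trace_rel_pm n (u @ s_run k j @ blocks_word j bs) (blocks_word 0 bs') \<and>
    (\<forall>b\<in>set bs'. 1 \<le> fst b) \<and> sum_list (map fst bs') = n"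
  using assms
proof (induction k arbitrary: j u bs)
  case 0 then show ?case by simp
next
  case (Suc k)
  define T where "T = blocks_word j bs"
  have T: "set T \<subseteq> gens n" "\<And>x. x \<in> set T \<Longrightarrow> strands x \<subseteq> {Suc j..n}"
    using blocks_word_gens[of bs j n] Suc.prems by (auto simp: T_def)
  obtain v l m e where v: "set v \<subseteq> gens k" and l: "1 \<le> l" "l \<le> Suc k"
    and u: "word_rel_pm n u (v @ rev (s_run l (Suc k)) @ xc_word l m e)"
    using coset_normal_form[of "Suc k" n u] Suc.prems by auto
  have start: "word_rel_pm n (u @ s_run (Suc k) j @ T) ((v @ rev (s_run l (Suc k)) @ xc_word l m e) @ s_run (Suc k) j @ T)"
    using u by (rule word_rel_pm_congR)
  show ?case
  proof (cases "l = Suc k")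
    case True
    have jk: "k + (j - k) = j" using Suc.prems(2) by simp
    \<comment> \<open>Strand \<open>k + 1\<close> heads the finished block, but a block keeps its
      Clifford generator on its last strand \<open>j\<close>; the run transports it there.\<close>
    have "word_rel_pm n ((if e then [CGen (Suc k)] else []) @ s_run (Suc k) j) (s_run (Suc k) j @ (if e then [CGen j] else []))"
      using word_rel_up_XC_last[of "Suc k" j n CGen] Suc.prems by (auto intro: word_rel_pm_refl weqsI word_rel_sym)
    then have "word_rel_pm n ((v @ replicate m (XGen (Suc k))) @ ((if e then [CGen (Suc k)] else []) @ s_run (Suc k) j) @ T)
      ((v @ replicate m (XGen (Suc k))) @ (s_run (Suc k) j @ (if e then [CGen j] else [])) @ T)"
      by (intro word_rel_pm_congL word_rel_pm_congR)
    note mid = this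
    have e1: "(v @ rev (s_run l (Suc k)) @ xc_word l m e) @ s_run (Suc k) j @ T =
      (v @ replicate m (XGen (Suc k))) @ ((if e then [CGen (Suc k)] else []) @ s_run (Suc k) j) @ T"
      using True by (simp add: xc_word_def)
    have e2: "v @ blocks_word k ((j - k, m, e) # bs) =
      (v @ replicate m (XGen (Suc k))) @ (s_run (Suc k) j @ (if e then [CGen j] else [])) @ T"
      by (simp add: T_def jk)
    have 1: "word_rel_pm n (u @ s_run (Suc k) j @ T) (v @ blocks_word k ((j - k, m, e) # bs))"
      unfolding e2 by (rule word_rel_pm_trans[OF start[unfolded e1] mid])
    have sz: "\<forall>b\<in>set ((j - k, m, e) # bs). 1 \<le> fst b" "k + sum_list (map fst ((j - k, m, e) # bs)) = n"
      using Suc.prems by auto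
    have odd_word: "\<not> odd_word (v @ s_run k k @ blocks_word k ((j - k, m, e) # bs))"
      using 1 Suc.prems word_rel_par unfolding word_rel_pm_def T_def by (metis append_Nil s_run_self order_refl)
    show ?thesis
    proof (cases "k = 0")
      case True
      then have "v = []" using v by (auto simp: gens_def)
      then show ?thesis using 1 True sz trace_rel_pm_weqs unfolding T_def by (metis add_0 append_Nil)
    next
      case False
      then have "\<exists>bs'. trace_rel_pm n (v @ s_run k k @ blocks_word k ((j - k, m, e) # bs)) (blocks_word 0 bs') \<and>
          (\<forall>b\<in>set bs'. 1 \<le> fst b) \<and> sum_list (map fst bs') = n"
        using Suc.prems v sz odd_word by (intro Suc.IH) auto
      then show ?thesis using trace_rel_pm_trans[OF trace_rel_pm_weqs[OF 1]] T_def by auto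
    qed
  next
    case False
    then have lk: "l \<le> k" using l by simp
    \<comment> \<open>Only the first letter \<open>s_k\<close> of the representative meets strand
      \<open>k + 1\<close>; it prolongs the run of the current block to the left. The rest
      \<open>y\<close> lives on strands up to \<open>k\<close>, commutes up to sign with all that
      stands behind it, and so can be rotated.\<close>
    define y where "y = rev (s_run l k) @ xc_word l m e"
    have y: "set y \<subseteq> gens k" using lk l s_run_gens[of l k k] xc_word_gens[of l k m e] by (auto simp: y_def)
    have yn: "set y \<subseteq> gens n" using y gens_mono[of k n] Suc.prems by force
    have e: "(v @ rev (s_run l (Suc k)) @ xc_word l m e) @ s_run (Suc k) j @ T = (v @ [SGen k]) @ (y @ (s_run (Suc k) j @ T))"
      using lk by (simp add: y_def s_run_last)
    have "word_rel_pm n (y @ (s_run (Suc k) j @ T)) ((s_run (Suc k) j @ T) @ y)"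
    proof (rule word_rel_pm_commute[OF yn])
      show "set (s_run (Suc k) j @ T) \<subseteq> gens n" using T s_run_gens[of "Suc k" j n] Suc.prems by auto
      fix a b assume "a \<in> set y" "b \<in> set (s_run (Suc k) j @ T)"
      moreover have "strands b \<subseteq> {Suc k..}" if "b \<in> set (s_run (Suc k) j @ T)"
        using that T(2)[of b] Suc.prems by (fastforce simp: set_up)
      moreover have "strands a \<subseteq> {1..k}" if "a \<in> set y" using y strands_gens that by blast
      ultimately show "strands a \<inter> strands b = {}" by fastforce
    qed
    then have "word_rel_pm n ((v @ [SGen k]) @ (y @ (s_run (Suc k) j @ T))) ((v @ [SGen k]) @ ((s_run (Suc k) j @ T) @ y))"
      by (rule word_rel_pm_congL)
    note mid = this
    have e2: "(v @ s_run k j @ T) @ y = (v @ [SGen k]) @ ((s_run (Suc k) j @ T) @ y)"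
      using Suc.prems(2) by (simp add: s_run_head)
    have 1: "word_rel_pm n (u @ s_run (Suc k) j @ T) ((v @ s_run k j @ T) @ y)"
      unfolding e2 by (rule word_rel_pm_trans[OF start[unfolded e] mid])
    then have odd_word: "\<not> odd_word ((v @ s_run k j @ T) @ y)"
      using Suc.prems word_rel_par unfolding word_rel_pm_def T_def by blast
    have 2: "trace_rel_pm n (u @ s_run (Suc k) j @ T) ((y @ v) @ s_run k j @ T)"
      using trace_rel_pm_trans[OF trace_rel_pm_weqs[OF 1] trace_rel_pm_rot[OF odd_word]] by simp
    have "\<exists>bs'. trace_rel_pm n ((y @ v) @ s_run k j @ blocks_word j bs) (blocks_word 0 bs') \<and>
          (\<forall>b\<in>set bs'. 1 \<le> fst b) \<and> sum_list (map fst bs') = n"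
      using Suc.prems v y odd_word lk l by (intro Suc.IH) (auto simp: T_def)
    then show ?thesis using trace_rel_pm_trans[OF 2] T_def by auto
  qed
qed

lemma trace_rel_pm_blocks:
  assumes "1 \<le> n" "set u \<subseteq> gens n" "\<not> odd_word u"
  shows "\<exists>bs. trace_rel_pm n u (blocks_word 0 bs) \<and> (\<forall>b\<in>set bs. 1 \<le> fst b) \<and> sum_list (map fst bs) = n"
  using trace_rel_pm_blocks_aux[of n n n u "[]"] assms by simp

section \<open>Reordering blocks\<close>

text \<open>The permutation exchanging the \<open>p\<close> strands after \<open>r\<close> with the following \<open>q\<close> strands.\<close>

fun shift_word :: "nat \<Rightarrow> nat \<Rightarrow> nat \<Rightarrow> gen list" where
  "shift_word r p 0 = []"
| "shift_word r p (Suc q) = shift_word (Suc r) p q @ s_run (Suc r) (Suc r + p)"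

fun relabel :: "(nat \<Rightarrow> nat) \<Rightarrow> gen \<Rightarrow> gen" where
  "relabel f (SGen i) = SGen (f i)" | "relabel f (XGen i) = XGen (f i)" | "relabel f (CGen i) = CGen (f i)"

lemma set_sig: "x \<in> set (shift_word r p q) \<Longrightarrow> \<exists>i. x = SGen i \<and> r < i \<and> i < r + p + q"
  by (induction r p q rule: shift_word.induct) (force simp: set_up)+

lemma odd_word_sig [simp]: "odd_word (shift_word r p q) = False"
  by (induction r p q rule: shift_word.induct) auto

lemma shift_word_gens: "r + p + q \<le> n \<Longrightarrow> set (shift_word r p q) \<subseteq> SGen ` {1..<n}"
  using set_sig by fastforce

lemma word_rel_sig_far:
  assumes "r + p + q \<le> n" "set u \<subseteq> gens n" "\<And>x. x \<in> set u \<Longrightarrow> strands x \<inter> {Suc r..r + p + q} = {}"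
  shows "word_rel n False (shift_word r p q @ u) (u @ shift_word r p q)"
proof (rule word_rel_commute0)
  show "set (shift_word r p q) \<subseteq> gens n" using shift_word_gens[OF assms(1)] by auto
  fix x y assume "x \<in> set (shift_word r p q)" "y \<in> set u"
  then show "strands x \<inter> strands y = {}" using set_sig[of x r p q] assms(3)[of y] by fastforce
qed (use assms in auto)

text \<open>The two runs carry the strands \<open>c\<close> and \<open>c + 1\<close> together past
  the strands \<open>a, ..., c - 1\<close>, so the crossing \<open>s_c\<close> of the pair slides
  along and becomes \<open>s_a\<close>. Each strand that is passed costs one braid relation.\<close>

lemma word_rel_two_rows:
  assumes "1 \<le> a" "a \<le> c" "c < n"
  shows "word_rel n False (s_run (Suc a) (Suc c) @ s_run a c @ [SGen c]) (SGen a # s_run (Suc a) (Suc c) @ s_run a c)"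
  using assms(2,3)
proof (induction c rule: dec_induct)
  case base
  then show ?case by (simp add: word_rel_refl)
next
  case (step c)
  have comm: "word_rel n False (s_run a c @ [SGen (Suc c)]) (SGen (Suc c) # s_run a c)"
    using step assms by (intro word_rel_up_far) auto
  have "word_rel n False (s_run (Suc a) (Suc c) @ (SGen (Suc c) # s_run a c) @ [SGen c, SGen (Suc c)])
    (s_run (Suc a) (Suc c) @ (s_run a c @ [SGen (Suc c)]) @ [SGen c, SGen (Suc c)])"
    by (rule word_rel_cong[OF word_rel_sym[OF comm]])
  also have "word_rel n False ((s_run (Suc a) (Suc c) @ s_run a c) @ [SGen (Suc c), SGen c, SGen (Suc c)])
    ((s_run (Suc a) (Suc c) @ s_run a c) @ [SGen c, SGen (Suc c), SGen c])"
    using step assms by (intro word_rel_congL word_rel_sym[OF word_rel_braid]) auto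
  then have "word_rel n False (s_run (Suc a) (Suc c) @ (s_run a c @ [SGen (Suc c)]) @ [SGen c, SGen (Suc c)])
    ((s_run (Suc a) (Suc c) @ s_run a c @ [SGen c]) @ [SGen (Suc c), SGen c])" by simp
  also have "word_rel n False \<dots> ((SGen a # s_run (Suc a) (Suc c) @ s_run a c) @ [SGen (Suc c), SGen c])"
    using step by (intro word_rel_congR) auto
  also have "word_rel n False ((SGen a # s_run (Suc a) (Suc c)) @ (s_run a c @ [SGen (Suc c)]) @ [SGen c])
    ((SGen a # s_run (Suc a) (Suc c)) @ (SGen (Suc c) # s_run a c) @ [SGen c])"
    by (rule word_rel_cong[OF comm])
  then have "word_rel n False ((SGen a # s_run (Suc a) (Suc c) @ s_run a c) @ [SGen (Suc c), SGen c])
    ((SGen a # s_run (Suc a) (Suc c)) @ (SGen (Suc c) # s_run a c) @ [SGen c])" by simp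
  finally show ?case using step by (simp add: s_run_last)
qed

lemma word_rel_up_shift:
  assumes "strands x \<subseteq> {Suc r..r + p}" "r + p < n"
  shows "word_rel n False (s_run (Suc r) (Suc r + p) @ [x]) (relabel Suc x # s_run (Suc r) (Suc r + p))"
  using assms by (cases x) (auto intro!: word_rel_up_S word_rel_up_XC)

lemma word_rel_sig_first:
  assumes "strands x \<subseteq> {Suc r..r + p}" "r + p + q \<le> n"
  shows "word_rel n False (shift_word r p q @ [x]) (relabel (\<lambda>i. i + q) x # shift_word r p q)"
  using assms
proof (induction q arbitrary: r x)
  case 0
  then show ?case by (cases x) (auto intro: word_rel_refl)
next
  case (Suc q)
  have h1: "word_rel n False (shift_word (Suc r) p q @ s_run (Suc r) (Suc r + p) @ [x])
      (shift_word (Suc r) p q @ relabel Suc x # s_run (Suc r) (Suc r + p))"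
    using Suc.prems by (intro word_rel_congL word_rel_up_shift) auto
  have h2: "word_rel n False ((shift_word (Suc r) p q @ [relabel Suc x]) @ s_run (Suc r) (Suc r + p))
    ((relabel (\<lambda>i. i + q) (relabel Suc x) # shift_word (Suc r) p q) @ s_run (Suc r) (Suc r + p))"
    using Suc.prems by (intro word_rel_congR Suc.IH) (cases x, auto)+
  have "relabel (\<lambda>i. i + q) (relabel Suc x) = relabel (\<lambda>i. i + Suc q) x" by (cases x) auto
  with h1 h2 show ?case by simp (erule word_rel_trans0)
qed

text \<open>The run that meets the letter first brings the first strand of the second group home in
  one go and leaves the other strands of that group alone. The delicate letter is the
  \<open>s\<close> joining the first two strands of the group, which involves two runs at once;
  \<open>word_rel_two_rows\<close> treats it.\<close>

lemma word_rel_sig_second: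
  assumes "strands x \<subseteq> {Suc (r + p)..r + p + q}" "r + p + q \<le> n"
  shows "word_rel n False (shift_word r p q @ [x]) (relabel (\<lambda>i. i - p) x # shift_word r p q)"
  using assms
proof (induction q arbitrary: r x)
  case 0
  then show ?case by (cases x) auto
next
  case (Suc q)
  let ?D = "s_run (Suc r) (Suc r + p)"
  have xn: "x \<in> gens n" using Suc.prems by (cases x) auto
  consider (far) "strands x \<subseteq> {Suc (Suc r + p)..Suc r + p + q}"
    | (one) G where "x = G (Suc (r + p))" "G = XGen \<or> G = CGen"
    | (s) "x = SGen (Suc (r + p))" 
  proof (cases x)
    case (SGen i)
    then show ?thesis using that(1,3) Suc.prems by (cases "i = Suc (r + p)") auto
  next
    case (XGen i)
    then show ?thesis using that(1) that(2)[of XGen] Suc.prems by (cases "i = Suc (r + p)") auto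
  next
    case (CGen i)
    then show ?thesis using that(1) that(2)[of CGen] Suc.prems by (cases "i = Suc (r + p)") auto
  qed
  then show ?case
  proof cases
    case far
    have h1: "word_rel n False (shift_word (Suc r) p q @ ?D @ [x]) (shift_word (Suc r) p q @ x # ?D)"
      using far Suc.prems xn by (intro word_rel_congL word_rel_up_far) fastforce+
    have h2: "word_rel n False ((shift_word (Suc r) p q @ [x]) @ ?D) ((relabel (\<lambda>i. i - p) x # shift_word (Suc r) p q) @ ?D)"
      using far Suc.prems by (intro word_rel_congR Suc.IH) auto
    show ?thesis using h1 h2 by simp (erule word_rel_trans0)
  next
    case one
    have h1: "word_rel n False (shift_word (Suc r) p q @ ?D @ [G (Suc r + p)]) (shift_word (Suc r) p q @ G (Suc r) # ?D)"
      using one Suc.prems by (intro word_rel_congL word_rel_up_XC_last) auto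
    have h2: "word_rel n False ((shift_word (Suc r) p q @ [G (Suc r)]) @ ?D) (([G (Suc r)] @ shift_word (Suc r) p q) @ ?D)"
      using one Suc.prems by (intro word_rel_congR word_rel_sig_far) auto
    have "relabel (\<lambda>i. i - p) (G (Suc (r + p))) = G (Suc r)" using one(2) by auto
    with h1 h2 one(1) show ?thesis by simp (erule word_rel_trans0)
  next
    case s
    then obtain q' where q: "q = Suc q'" using Suc.prems by (cases q) auto
    have h1: "word_rel n False (shift_word (Suc (Suc r)) p q' @ s_run (Suc (Suc r)) (Suc (Suc r + p)) @ ?D @ [SGen (Suc r + p)])
      (shift_word (Suc (Suc r)) p q' @ SGen (Suc r) # s_run (Suc (Suc r)) (Suc (Suc r + p)) @ ?D)"
      using Suc.prems q by (intro word_rel_congL word_rel_two_rows) auto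
    have h2: "word_rel n False ((shift_word (Suc (Suc r)) p q' @ [SGen (Suc r)]) @ s_run (Suc (Suc r)) (Suc (Suc r + p)) @ ?D)
      (([SGen (Suc r)] @ shift_word (Suc (Suc r)) p q') @ s_run (Suc (Suc r)) (Suc (Suc r + p)) @ ?D)"
      using Suc.prems q by (intro word_rel_congR word_rel_sig_far) auto
    show ?thesis using h1 h2 s q by simp (erule word_rel_trans0)
  qed
qed

section \<open>Conjugation in the supercocenter and exchange of blocks\<close>

lemma word_rel_SS_cancel: "set u \<subseteq> SGen ` {1..<n} \<Longrightarrow> word_rel n False (u @ rev u) []"
proof (induction u rule: rev_induct)
  case Nil
  then show ?case by (simp add: word_rel_refl)
next
  case (snoc x u)
  then have "word_rel n False (u @ [x, x] @ rev u) (u @ [] @ rev u)"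
    by (intro word_rel_cong) (auto intro: word_rel_ss)
  also have "word_rel n False (u @ [] @ rev u) []" using snoc by auto
  finally show ?case by simp
qed

lemma word_rel_SS_cancel': "set u \<subseteq> SGen ` {1..<n} \<Longrightarrow> word_rel n False (rev u @ u) []"
  using word_rel_SS_cancel[of "rev u" n] by simp

lemma word_rel_CC_cancel: "set u \<subseteq> CGen ` {1..n} \<Longrightarrow> word_rel n False (u @ rev u) []"
proof (induction u rule: rev_induct)
  case Nil
  then show ?case by (simp add: word_rel_refl)
next
  case (snoc x u)
  then have "word_rel n False (u @ [x, x] @ rev u) (u @ [] @ rev u)"
    by (intro word_rel_cong) (auto intro: word_rel_cc)
  also have "word_rel n False (u @ [] @ rev u) []" using snoc by auto
  finally show ?case by simp
qed

lemma trace_rel_trans0: "trace_rel n False u v \<Longrightarrow> trace_rel n False v w \<Longrightarrow> trace_rel n False u w"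
  using trace_rel_trans[of n False u v False w] by simp

text \<open>Insert \<open>t^(-1) t\<close> in front of \<open>y\<close>, with \<open>rev t\<close>
  as the inverse because the \<open>s_i\<close> are involutions, and rotate \<open>t^(-1)\<close> to
  the end. No sign arises, since \<open>t\<close> is even.\<close>

lemma trace_rel_conj:
  assumes "set t \<subseteq> SGen ` {1..<n}" "\<not> odd_word y" "word_rel n False (t @ y) (y' @ t)"
  shows "trace_rel n False y y'"
proof -
  have pt: "\<not> odd_word t" using assms(1) by (induction t) auto
  have 1: "trace_rel n False y (rev t @ (t @ y))"
    using word_rel_congR[OF word_rel_sym[OF word_rel_SS_cancel'[OF assms(1)]], of y] by (intro trace_rel_base) simp
  have 2: "trace_rel n False (rev t @ (t @ y)) ((t @ y) @ rev t)"
    using trace_rel_rot[of "rev t" "t @ y" n] assms(2) pt by simp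
  have 3: "trace_rel n False ((t @ y) @ rev t) ((y' @ t) @ rev t)"
    by (intro trace_rel_base word_rel_congR assms)
  have 4: "trace_rel n False ((y' @ t) @ rev t) y'"
    using word_rel_congL[OF word_rel_SS_cancel[OF assms(1)], of y'] by (intro trace_rel_base) simp
  show ?thesis by (rule trace_rel_trans0[OF trace_rel_trans0[OF trace_rel_trans0[OF 1 2] 3] 4])
qed

lemma odd_word_replicate_X [simp]: "odd_word (replicate m (XGen i)) = False" by (induction m) auto

lemma odd_word_block_word [simp]: "odd_word (block_word r b) = snd (snd b)"
  by (cases b) auto

lemma relabel_up: "map (relabel (\<lambda>i. i + q)) (s_run a b) = s_run (a + q) (b + q)"
  unfolding s_run_def by (induction b) auto

lemma block_word_add: "map (relabel (\<lambda>i. i + q)) (block_word r b) = block_word (r + q) b"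
  by (cases b) (auto simp: relabel_up add_ac)

lemma block_word_sub: "map (relabel (\<lambda>i. i - q)) (block_word (r + q) b) = block_word r b"
proof -
  have "relabel (\<lambda>i. i - q) (relabel (\<lambda>i. i + q) x) = x" for x by (cases x) auto
  then show ?thesis by (simp add: block_word_add[symmetric] comp_def)
qed

text \<open>Conjugation by the block permutation moves each block to its new strands but leaves the
  two factors in their old order, without a sign. The sign comes from commuting these factors
  afterwards; as their strands are disjoint, it is -1 exactly if both are odd.\<close>

lemma trace_rel_swap:
  assumes "\<forall>b\<in>set (as @ b # b' # cs). 1 \<le> fst b" "sum_list (map fst (as @ b # b' # cs)) = n"
    and "\<not> odd_word (blocks_word 0 (as @ b # b' # cs))"
  shows "trace_rel n (snd (snd b) \<and> snd (snd b')) (blocks_word 0 (as @ b # b' # cs)) (blocks_word 0 (as @ b' # b # cs))"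
proof -
  define r where "r = sum_list (map fst as)"
  define p where "p = fst b"
  define q where "q = fst b'"
  define A where "A = blocks_word 0 as"
  define Z where "Z = blocks_word (r + p + q) cs"
  have pq: "1 \<le> p" "1 \<le> q" "r + p + q + sum_list (map fst cs) = n"
    using assms by (auto simp: p_def q_def r_def)
  have e1: "blocks_word 0 (as @ b # b' # cs) = A @ (block_word r b @ block_word (r + p) b') @ Z"
    by (simp add: blocks_word_append A_def Z_def r_def p_def q_def add_ac)
  have e2: "blocks_word 0 (as @ b' # b # cs) = A @ (block_word r b' @ block_word (r + q) b) @ Z"
    by (simp add: blocks_word_append A_def Z_def r_def p_def q_def add_ac)
  let ?s = "shift_word r p q"
  have s: "set ?s \<subseteq> SGen ` {1..<n}" using pq by (intro shift_word_gens) simp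
  have A: "set A \<subseteq> gens n" "\<And>x. x \<in> set A \<Longrightarrow> strands x \<subseteq> {1..r}"
    using blocks_word_gens[of as 0 n] assms by (auto simp: A_def r_def)
  have Z: "set Z \<subseteq> gens n" "\<And>x. x \<in> set Z \<Longrightarrow> strands x \<subseteq> {Suc (r + p + q)..n}"
    using blocks_word_gens[of cs "r + p + q" n] assms pq by (auto simp: Z_def)
  have B: "set (block_word r b) \<subseteq> gens n" "\<And>x. x \<in> set (block_word r b) \<Longrightarrow> strands x \<subseteq> {Suc r..r + p}"
    using block_word_gens[of b r n] pq by (auto simp: p_def)
  have B': "set (block_word (r + p) b') \<subseteq> gens n" "\<And>x. x \<in> set (block_word (r + p) b') \<Longrightarrow> strands x \<subseteq> {Suc (r + p)..r + p + q}"
    using block_word_gens[of b' "r + p" n] pq by (auto simp: q_def)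
  have D: "set (block_word (r + q) b) \<subseteq> gens n" "\<And>x. x \<in> set (block_word (r + q) b) \<Longrightarrow> strands x \<subseteq> {Suc (r + q)..r + q + p}"
    using block_word_gens[of b "r + q" n] pq by (auto simp: p_def)
  have D': "set (block_word r b') \<subseteq> gens n" "\<And>x. x \<in> set (block_word r b') \<Longrightarrow> strands x \<subseteq> {Suc r..r + q}"
    using block_word_gens[of b' r n] pq by (auto simp: q_def)
  have 1: "word_rel n False (?s @ A) (A @ ?s)" using pq A by (intro word_rel_sig_far) fastforce+
  have 2: "word_rel n False (?s @ block_word r b) (block_word (r + q) b @ ?s)"
    unfolding block_word_add[of q r b, symmetric] using pq B by (intro word_rel_pass0 word_rel_sig_first) auto
  have 3: "word_rel n False (?s @ block_word (r + p) b') (block_word r b' @ ?s)"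
    unfolding block_word_sub[of p r b', symmetric] using pq B' by (intro word_rel_pass0 word_rel_sig_second) auto
  have 4: "word_rel n False (?s @ Z) (Z @ ?s)" using pq Z by (intro word_rel_sig_far) fastforce+
  have "word_rel n False ((?s @ A) @ (block_word r b @ block_word (r + p) b') @ Z) ((A @ ?s) @ (block_word r b @ block_word (r + p) b') @ Z)"
    by (rule word_rel_congR[OF 1])
  also have "word_rel n False (A @ (?s @ block_word r b) @ (block_word (r + p) b' @ Z)) (A @ (block_word (r + q) b @ ?s) @ (block_word (r + p) b' @ Z))"
    by (rule word_rel_cong[OF 2])
  then have "word_rel n False ((A @ ?s) @ (block_word r b @ block_word (r + p) b') @ Z) (A @ (block_word (r + q) b @ ?s) @ (block_word (r + p) b' @ Z))" by simp
  also have "word_rel n False ((A @ block_word (r + q) b) @ (?s @ block_word (r + p) b') @ Z) ((A @ block_word (r + q) b) @ (block_word r b' @ ?s) @ Z)"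
    by (rule word_rel_cong[OF 3])
  then have "word_rel n False (A @ (block_word (r + q) b @ ?s) @ (block_word (r + p) b' @ Z)) ((A @ block_word (r + q) b) @ (block_word r b' @ ?s) @ Z)" by simp
  also have "word_rel n False ((A @ block_word (r + q) b @ block_word r b') @ (?s @ Z)) ((A @ block_word (r + q) b @ block_word r b') @ (Z @ ?s))"
    by (rule word_rel_congL[OF 4])
  then have "word_rel n False ((A @ block_word (r + q) b) @ (block_word r b' @ ?s) @ Z) ((A @ block_word (r + q) b @ block_word r b') @ (Z @ ?s))" by simp
  finally have w: "word_rel n False (?s @ A @ (block_word r b @ block_word (r + p) b') @ Z) ((A @ (block_word (r + q) b @ block_word r b') @ Z) @ ?s)"
    by simp
  have 5: "trace_rel n False (A @ (block_word r b @ block_word (r + p) b') @ Z) (A @ (block_word (r + q) b @ block_word r b') @ Z)"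
    by (rule trace_rel_conj[OF s _ w]) (use assms(3) e1 in metis)
  have "word_rel n (odd_word (block_word (r + q) b) \<and> odd_word (block_word r b')) (block_word (r + q) b @ block_word r b') (block_word r b' @ block_word (r + q) b)"
  proof (rule word_rel_commute[OF D(1) D'(1)])
    fix x y assume "x \<in> set (block_word (r + q) b)" "y \<in> set (block_word r b')"
    then show "strands x \<inter> strands y = {}" using D(2)[of x] D'(2)[of y] by fastforce
  qed
  then have 6: "trace_rel n (snd (snd b) \<and> snd (snd b')) (A @ (block_word (r + q) b @ block_word r b') @ Z) (A @ (block_word r b' @ block_word (r + q) b) @ Z)"
    by (intro trace_rel_base word_rel_cong) simp
  show ?thesis unfolding e1 e2 using trace_rel_trans1[OF 5 6 HOL.refl] by simp
qed

lemma trace_rel_pm_move: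
  assumes "\<forall>b\<in>set (as @ x # bs @ cs). 1 \<le> fst b" "sum_list (map fst (as @ x # bs @ cs)) = n"
    and "\<not> odd_word (blocks_word 0 (as @ x # bs @ cs))"
  shows "trace_rel_pm n (blocks_word 0 (as @ x # bs @ cs)) (blocks_word 0 (as @ bs @ x # cs))"
  using assms
proof (induction bs arbitrary: as)
  case Nil
  then show ?case by (simp add: trace_rel_pm_refl)
next
  case (Cons b bs)
  have 1: "trace_rel_pm n (blocks_word 0 (as @ x # b # bs @ cs)) (blocks_word 0 (as @ b # x # bs @ cs))"
    using Cons.prems by (intro reqsI[OF trace_rel_swap]) auto
  then have "\<not> odd_word (blocks_word 0 ((as @ [b]) @ x # bs @ cs))"
    using trace_rel_par Cons.prems unfolding trace_rel_pm_def by fastforce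
  then have 2: "trace_rel_pm n (blocks_word 0 ((as @ [b]) @ x # bs @ cs)) (blocks_word 0 ((as @ [b]) @ bs @ x # cs))"
    using Cons.prems by (intro Cons.IH) auto
  show ?case using trace_rel_pm_trans[OF 1] 2 by simp
qed

lemma odd_word_blocks_word: "odd_word (blocks_word r l) = odd (length (filter (\<lambda>b. snd (snd b)) l))"
  by (induction l arbitrary: r) auto

text \<open>\<open>as\<close> is the prefix that is already in its final order; the next target
  block is moved to just behind it.\<close>

lemma trace_rel_pm_perm_aux:
  assumes "mset bs = mset bs'" "\<forall>b\<in>set (as @ bs). 1 \<le> fst b" "sum_list (map fst (as @ bs)) = n"
    and "\<not> odd_word (blocks_word 0 (as @ bs))"
  shows "trace_rel_pm n (blocks_word 0 (as @ bs)) (blocks_word 0 (as @ bs'))"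
  using assms
proof (induction bs' arbitrary: as bs)
  case Nil
  then show ?case by (simp add: trace_rel_pm_refl)
next
  case (Cons x bs')
  then have "x \<in> set bs" by (metis list.set_intros(1) mset_eq_setD)
  then obtain b1 b2 where b: "bs = b1 @ x # b2" by (meson split_list)
  have m: "mset (b1 @ b2) = mset bs'" using Cons.prems(1) b by simp
  have p: "\<not> odd_word (blocks_word 0 (as @ x # b1 @ b2))"
    using Cons.prems(4) b unfolding odd_word_blocks_word by auto
  have 1: "trace_rel_pm n (blocks_word 0 (as @ x # b1 @ b2)) (blocks_word 0 (as @ b1 @ x # b2))"
    using Cons.prems b p by (intro trace_rel_pm_move) auto
  have 2: "trace_rel_pm n (blocks_word 0 ((as @ [x]) @ b1 @ b2)) (blocks_word 0 ((as @ [x]) @ bs'))"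
    using Cons.prems b p by (intro Cons.IH m) auto
  show ?case using trace_rel_pm_trans[OF trace_rel_pm_sym[OF 1]] 2 b by simp
qed

lemma trace_rel_pm_perm:
  assumes "mset bs = mset bs'" "\<forall>b\<in>set bs. 1 \<le> fst b" "sum_list (map fst bs) = n"
    and "\<not> odd_word (blocks_word 0 bs)"
  shows "trace_rel_pm n (blocks_word 0 bs) (blocks_word 0 bs')"
  using trace_rel_pm_perm_aux[of bs bs' "[]"] assms by simp

text \<open>On the way from \<open>u\<close> to \<open>v\<close> and back, the unknown sign between
  them occurs twice and cancels. Vanishing can therefore be tested on any word that is reached up to
  sign.\<close>

lemma trace_rel_True_transfer: "trace_rel_pm n u v \<Longrightarrow> trace_rel n True v v \<Longrightarrow> trace_rel n True u u"
  unfolding trace_rel_pm_def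
proof (elim exE)
  fix b assume "trace_rel n b u v" "trace_rel n True v v"
  from trace_rel_trans1[OF trace_rel_trans1[OF this HOL.refl] trace_rel_sym[OF this(1)], of True] show "trace_rel n True u u" by auto
qed

text \<open>Two equal blocks are brought to the front, at the price of an unknown sign that
  \<open>trace_rel_True_transfer\<close> makes harmless. Exchanging them there reproduces the word,
  and since both are odd the sign is -1.\<close>

lemma trace_rel_twins:
  assumes "\<forall>b\<in>set bs. 1 \<le> fst b" "sum_list (map fst bs) = n" "\<not> odd_word (blocks_word 0 bs)"
    and "i < length bs" "j < length bs" "i \<noteq> j" "bs ! i = bs ! j" "snd (snd (bs ! i))"
  shows "trace_rel n True (blocks_word 0 bs) (blocks_word 0 bs)"
proof -
  have "\<exists>zs. mset bs = mset (bs ! i # bs ! i # zs)"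
  proof -
    have "\<exists>zs. mset bs = mset (bs ! i # bs ! j # zs)" if "i < j" "j < length bs" for i j
    proof -
      have "bs = take i bs @ bs ! i # drop (Suc i) bs" using that by (simp add: id_take_nth_drop)
      moreover have "drop (Suc i) bs = take (j - Suc i) (drop (Suc i) bs) @ bs ! j # drop (Suc j) bs"
        using that id_take_nth_drop[of "j - Suc i" "drop (Suc i) bs"] by simp
      ultimately have "bs = take i bs @ bs ! i # take (j - Suc i) (drop (Suc i) bs) @ bs ! j # drop (Suc j) bs"
        by metis
      then have "mset bs = mset (take i bs @ bs ! i # take (j - Suc i) (drop (Suc i) bs) @ bs ! j # drop (Suc j) bs)"
        by (rule arg_cong)
      then have "mset bs = mset (bs ! i # bs ! j # (take i bs @ take (j - Suc i) (drop (Suc i) bs) @ drop (Suc j) bs))"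
        by simp
      then show ?thesis by blast
    qed
    from this[of i j] this[of j i] show ?thesis using assms(4-7) by (metis linorder_neqE_nat)
  qed
  then obtain zs where m: "mset bs = mset (bs ! i # bs ! i # zs)" by blast
  define b where "b = bs ! i"
  have r: "trace_rel_pm n (blocks_word 0 bs) (blocks_word 0 (b # b # zs))"
    using trace_rel_pm_perm[OF m assms(1-3)] by (simp add: b_def)
  have "\<not> odd_word (blocks_word 0 (b # b # zs))" using r assms(3) trace_rel_par unfolding trace_rel_pm_def by blast
  moreover have "set bs = set (b # b # zs)" "sum_list (map fst (b # b # zs)) = n"
    using m assms(2) mset_eq_setD[OF m] by (auto simp: b_def) (metis m mset_map list.simps(9) sum_list.Cons sum_mset_sum_list)
  ultimately have "trace_rel n True (blocks_word 0 (b # b # zs)) (blocks_word 0 (b # b # zs))"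
    using trace_rel_swap[of "[]" b b zs n] assms by (auto simp: b_def)
  then show ?thesis using r trace_rel_True_transfer by blast
qed

section \<open>Vanishing blocks and semi-bipartitions\<close>

lemma upt_split: "i \<le> j \<Longrightarrow> j \<le> k \<Longrightarrow> [i..<k] = [i..<j] @ [j..<k]"
  by (metis upt_add_eq_append le_Suc_ex)

lemma odd_word_C [simp]: "odd_word (map CGen l) = odd (length l)" by (induction l) auto

text \<open>Among the factors \<open>c_a, ..., c_(b-1)\<close>, the generator \<open>x_j\<close>
  anticommutes with \<open>c_j\<close> alone, while \<open>c_j\<close> anticommutes with all factors
  but itself. The latter gives \<open>b - a - 1\<close> signs, an odd number exactly if
  \<open>b - a\<close> is even.\<close>

lemma word_rel_C_interval_XC:
  assumes "a \<le> j" "j < b" "1 \<le> a" "b \<le> Suc n"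
  shows "word_rel n True (map CGen [a..<b] @ [XGen j]) (XGen j # map CGen [a..<b])"
    and "word_rel n (even (b - a)) (map CGen [a..<b] @ [CGen j]) (CGen j # map CGen [a..<b])"
proof -
  have e: "map CGen [a..<b] = map CGen [a..<j] @ [CGen j] @ map CGen [Suc j..<b]"
    using assms upt_split[of a j b] upt_conv_Cons[of j b] by simp
  have 1: "word_rel n (odd_word (map CGen [a..<j]) \<and> odd_word [x]) (map CGen [a..<j] @ [x]) ([x] @ map CGen [a..<j])"
    and 2: "word_rel n (odd_word (map CGen [Suc j..<b]) \<and> odd_word [x]) (map CGen [Suc j..<b] @ [x]) ([x] @ map CGen [Suc j..<b])"
    if "x = XGen j \<or> x = CGen j" for x
    using assms that by (intro word_rel_commute; fastforce)+
  have main: "word_rel n ((odd_word (map CGen [a..<j]) \<and> is_C x) \<noteq> (b' \<noteq> (odd_word (map CGen [Suc j..<b]) \<and> is_C x)))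
      (map CGen [a..<b] @ [x]) (x # map CGen [a..<b])"
    if x: "x = XGen j \<or> x = CGen j" and m: "word_rel n b' [CGen j, x] [x, CGen j]" for x b'
  proof -
    have "word_rel n (odd_word (map CGen [Suc j..<b]) \<and> is_C x) ((map CGen [a..<j] @ [CGen j]) @ (map CGen [Suc j..<b] @ [x]))
       ((map CGen [a..<j] @ [CGen j]) @ ([x] @ map CGen [Suc j..<b]))"
      using 2[OF x] by (intro word_rel_congL) simp
    moreover have "word_rel n b' (map CGen [a..<j] @ [CGen j, x] @ map CGen [Suc j..<b]) (map CGen [a..<j] @ [x, CGen j] @ map CGen [Suc j..<b])"
      by (rule word_rel_cong[OF m])
    moreover have "word_rel n (odd_word (map CGen [a..<j]) \<and> is_C x) ((map CGen [a..<j] @ [x]) @ ([CGen j] @ map CGen [Suc j..<b]))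
      (([x] @ map CGen [a..<j]) @ ([CGen j] @ map CGen [Suc j..<b]))"
      using 1[OF x] by (intro word_rel_congR) simp
    ultimately show ?thesis unfolding e
      apply simp
      apply (rule word_rel_trans1)
       apply assumption
       apply (rule word_rel_trans1)
        apply assumption
       apply assumption
       apply (rule HOL.refl)
      apply auto
      done
  qed
  show "word_rel n True (map CGen [a..<b] @ [XGen j]) (XGen j # map CGen [a..<b])"
    using main[of "XGen j" True] word_rel_sym[OF word_rel_xc[of j n j]] assms by simp
  show "word_rel n (even (b - a)) (map CGen [a..<b] @ [CGen j]) (CGen j # map CGen [a..<b])"
  proof -
    have "((odd (j - a)) \<noteq> (False \<noteq> (odd (b - Suc j)))) = even (b - a)" using assms by presburger
    then show ?thesis using main[of "CGen j" False] word_rel_refl by simp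
  qed
qed

text \<open>Moving \<open>s_i\<close> through exchanges the adjacent factors \<open>c_i\<close> and
  \<open>c_(i+1)\<close>; restoring their order costs the one sign.\<close>

lemma word_rel_C_interval_S:
  assumes "a \<le> i" "Suc i < b" "1 \<le> a" "b \<le> Suc n"
  shows "word_rel n True (map CGen [a..<b] @ [SGen i]) (SGen i # map CGen [a..<b])"
proof -
  have e: "map CGen [a..<b] = map CGen [a..<i] @ [CGen i, CGen (Suc i)] @ map CGen [Suc (Suc i)..<b]"
  proof -
    have "[a..<b] = [a..<i] @ i # Suc i # [Suc (Suc i)..<b]"
      using assms upt_split[of a i b] upt_conv_Cons[of i b] upt_conv_Cons[of "Suc i" b] by simp
    then show ?thesis by simp
  qed
  have c1: "word_rel n False (map CGen [a..<i] @ [SGen i]) ([SGen i] @ map CGen [a..<i])"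
    using assms by (intro word_rel_commute0) auto
  have c2: "word_rel n False (map CGen [Suc (Suc i)..<b] @ [SGen i]) ([SGen i] @ map CGen [Suc (Suc i)..<b])"
    using assms by (intro word_rel_commute0) auto
  have 1: "word_rel n False ((map CGen [a..<i] @ [CGen i, CGen (Suc i)]) @ (map CGen [Suc (Suc i)..<b] @ [SGen i]))
     ((map CGen [a..<i] @ [CGen i, CGen (Suc i)]) @ ([SGen i] @ map CGen [Suc (Suc i)..<b]))"
    by (rule word_rel_congL[OF c2])
  have m: "word_rel n True [CGen i, CGen (Suc i), SGen i] [SGen i, CGen i, CGen (Suc i)]"
  proof -
    have "word_rel n False [CGen i, CGen (Suc i), SGen i] [CGen i, SGen i, CGen i]"
      using word_rel_congL[OF word_rel_sc'[of i n "Suc i"], of "[CGen i]"] assms by simp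
    also have "word_rel n False [CGen i, SGen i, CGen i] [SGen i, CGen (Suc i), CGen i]"
      using word_rel_congR[OF word_rel_sc'[of i n i], of "[CGen i]"] assms by simp
    finally have f: "word_rel n False [CGen i, CGen (Suc i), SGen i] [SGen i, CGen (Suc i), CGen i]" .
    have "word_rel n True ([SGen i] @ [CGen (Suc i), CGen i]) ([SGen i] @ [CGen i, CGen (Suc i)])"
      using assms by (intro word_rel_congL word_rel_cc_swap) auto
    with f show ?thesis using word_rel_trans1[of n False _ _ True _ True] by fastforce
  qed
  have 2: "word_rel n True (map CGen [a..<i] @ [CGen i, CGen (Suc i), SGen i] @ map CGen [Suc (Suc i)..<b])
    (map CGen [a..<i] @ [SGen i, CGen i, CGen (Suc i)] @ map CGen [Suc (Suc i)..<b])"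
    by (rule word_rel_cong[OF m])
  have 3: "word_rel n False ((map CGen [a..<i] @ [SGen i]) @ [CGen i, CGen (Suc i)] @ map CGen [Suc (Suc i)..<b])
    (([SGen i] @ map CGen [a..<i]) @ [CGen i, CGen (Suc i)] @ map CGen [Suc (Suc i)..<b])"
    by (rule word_rel_congR[OF c1])
  show ?thesis using word_rel_trans1[OF word_rel_trans1[OF 1[simplified] 2[simplified] HOL.refl] 3[simplified], of True] unfolding e by simp
qed

text \<open>Each of the \<open>m\<close> letters \<open>x\<close> and of the \<open>k - 1\<close>
  letters \<open>s\<close> contributes one sign; the letter \<open>c\<close>, if present,
  contributes \<open>k - 1\<close> of them.\<close>

lemma word_rel_C_interval_block:
  assumes "1 \<le> k" "r + k \<le> n"
  shows "word_rel n ((odd m \<noteq> even k) \<noteq> (e \<and> even k))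
    (map CGen [Suc r..<Suc (r + k)] @ block_word r (k, m, e)) (block_word r (k, m, e) @ map CGen [Suc r..<Suc (r + k)])"
proof -
  let ?C = "map CGen [Suc r..<Suc (r + k)]"
  define P where "P = (\<lambda>x. case x of SGen i \<Rightarrow> True | XGen i \<Rightarrow> True | CGen i \<Rightarrow> even k)"
  have "word_rel n (P x) (?C @ [x]) (x # ?C)" if "x \<in> set (block_word r (k, m, e))" for x
  proof (cases x)
    case (SGen i)
    then have "Suc r \<le> i" "i < r + k" using that by (auto simp: set_up split: if_splits)
    then show ?thesis using word_rel_C_interval_S[of "Suc r" i "Suc (r + k)" n] assms SGen by (simp add: P_def)
  next
    case (XGen i)
    then have "i = Suc r" using that by (auto simp: set_up split: if_splits)
    then show ?thesis using word_rel_C_interval_XC(1)[of "Suc r" i "Suc (r + k)" n] assms XGen by (simp add: P_def)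
  next
    case (CGen i)
    then have "i = r + k" using that by (auto simp: set_up split: if_splits)
    then show ?thesis using word_rel_C_interval_XC(2)[of "Suc r" i "Suc (r + k)" n] assms CGen by (simp add: P_def)
  qed
  then have w: "word_rel n (odd (length (filter P (block_word r (k, m, e))))) (?C @ block_word r (k, m, e)) (map (\<lambda>x. x) (block_word r (k, m, e)) @ ?C)"
    by (rule word_rel_pass)
  have "length (filter P (replicate m (XGen j))) = m" for j by (induction m) (auto simp: P_def)
  moreover have "length (filter P (s_run c c')) = c' - c" for c c'
    unfolding s_run_def by (simp add: P_def filter_map comp_def)
  ultimately have "odd (length (filter P (block_word r (k, m, e)))) = ((odd m \<noteq> even k) \<noteq> (e \<and> even k))"
    using assms by (auto simp: P_def)
  with w show ?thesis by simp
qed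

text \<open>With \<open>C\<close> the product of the \<open>c_i\<close> on the strands of one block,
  \<open>C C^(-1)\<close> is created in front of the word, \<open>C\<close> is rotated to the far
  end and then commuted back through \<open>Z\<close>, \<open>B\<close> and \<open>A\<close> until
  it meets \<open>C^(-1)\<close>. The word is unchanged except for the sign collected on this round
  trip.\<close>

lemma trace_rel_True_parity:
  assumes "\<forall>b\<in>set bs. 1 \<le> fst b" "sum_list (map fst bs) = n" "\<not> odd_word (blocks_word 0 bs)"
    and "(k, m, e) \<in> set bs" "odd m = e"
  shows "trace_rel n True (blocks_word 0 bs) (blocks_word 0 bs)"
proof -
  obtain as cs where bs: "bs = as @ (k, m, e) # cs" using assms(4) by (meson split_list)
  define r where "r = sum_list (map fst as)"
  define A where "A = blocks_word 0 as"
  define B where "B = block_word r (k, m, e)"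
  define Z where "Z = blocks_word (r + k) cs"
  define C where "C = map CGen [Suc r..<Suc (r + k)]"
  have k: "1 \<le> k" "r + k + sum_list (map fst cs) = n" using assms bs by (auto simp: r_def)
  have y: "blocks_word 0 bs = A @ B @ Z" by (simp add: bs blocks_word_append A_def B_def Z_def r_def)
  have A: "set A \<subseteq> gens n" "\<And>x. x \<in> set A \<Longrightarrow> strands x \<subseteq> {1..r}"
    using blocks_word_gens[of as 0 n] assms bs by (auto simp: A_def r_def)
  have Z: "set Z \<subseteq> gens n" "\<And>x. x \<in> set Z \<Longrightarrow> strands x \<subseteq> {Suc (r + k)..n}"
    using blocks_word_gens[of cs "r + k" n] assms bs k by (auto simp: Z_def)
  have C: "set C \<subseteq> CGen ` {1..n}" using k by (auto simp: C_def)
  have Cg: "set C \<subseteq> gens n" "\<And>x. x \<in> set C \<Longrightarrow> strands x \<subseteq> {Suc r..r + k}" using k by (auto simp: C_def)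
  have pC: "odd_word C = odd k" by (simp add: C_def del: upt_Suc)
  have pB: "odd_word B = e" by (simp add: B_def)
  have pe: "e = (odd_word A \<noteq> odd_word Z)" using assms(3) unfolding y by (auto simp: pB)
  have 1: "word_rel n False (A @ B @ Z) (C @ (rev C @ A @ B @ Z))"
    using word_rel_congR[OF word_rel_sym[OF word_rel_CC_cancel[OF C]], of "A @ B @ Z"] by simp
  have 2: "trace_rel n (odd k) (C @ (rev C @ A @ B @ Z)) ((rev C @ A @ B @ Z) @ C)"
    using trace_rel_rot[of C "rev C @ A @ B @ Z" n] assms(3) unfolding y by (simp add: pC)
  have zc: "word_rel n (odd_word Z \<and> odd_word C) (Z @ C) (C @ Z)"
  proof (rule word_rel_commute[OF Z(1) Cg(1)])
    fix x y assume "x \<in> set Z" "y \<in> set C"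
    then show "strands x \<inter> strands y = {}" using Z(2)[of x] Cg(2)[of y] by fastforce
  qed
  have 3: "word_rel n (odd_word Z \<and> odd k) ((rev C @ A @ B) @ (Z @ C)) ((rev C @ A @ B) @ (C @ Z))"
    using word_rel_congL[OF zc, of "rev C @ A @ B"] by (simp add: pC)
  have 4: "word_rel n ((odd m \<noteq> even k) \<noteq> (e \<and> even k)) ((rev C @ A) @ (B @ C) @ Z) ((rev C @ A) @ (C @ B) @ Z)"
    unfolding B_def C_def using k by (intro word_rel_cong word_rel_sym[OF word_rel_C_interval_block]) auto
  have ac: "word_rel n (odd_word A \<and> odd_word C) (A @ C) (C @ A)"
  proof (rule word_rel_commute[OF A(1) Cg(1)])
    fix x y assume "x \<in> set A" "y \<in> set C"
    then show "strands x \<inter> strands y = {}" using A(2)[of x] Cg(2)[of y] by fastforce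
  qed
  have 5: "word_rel n (odd_word A \<and> odd k) (rev C @ (A @ C) @ (B @ Z)) (rev C @ (C @ A) @ (B @ Z))"
    using word_rel_cong[OF ac, of "rev C" "B @ Z"] by (simp add: pC)
  have "set (rev C) \<subseteq> CGen ` {1..n}" using C by simp
  then have 6: "word_rel n False ((rev C @ C) @ (A @ B @ Z)) (A @ B @ Z)"
    using word_rel_congR[OF word_rel_CC_cancel[of "rev C" n], of "A @ B @ Z"] by simp
  have "trace_rel n (odd k \<noteq> ((odd_word Z \<and> odd k) \<noteq> (((odd m \<noteq> even k) \<noteq> (e \<and> even k)) \<noteq> (odd_word A \<and> odd k))))
    (A @ B @ Z) (A @ B @ Z)"
    by (rule trace_rel_trans1[OF trace_rel_base[OF 1] trace_rel_trans1[OF 2[unfolded append_assoc] trace_rel_trans1[OF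
      trace_rel_base[OF 3, unfolded append_assoc] trace_rel_trans1[OF trace_rel_base[OF 4, unfolded append_assoc] trace_rel_trans1[OF
      trace_rel_base[OF 5, unfolded append_assoc] trace_rel_base[OF 6, unfolded append_assoc] HOL.refl] HOL.refl] HOL.refl] HOL.refl]]) simp
  \<comment> \<open>Modulo 2 the exponents add up to
    \<open>k + k|Z| + (m + (k - 1) + e(k - 1)) + k|A|\<close>. As the whole word is even,
    \<open>|A| + |Z| = e\<close>, and the sum is \<open>m + e + 1\<close>: the size \<open>k\<close>
    drops out, and the parity hypothesis makes the result odd.\<close>
  moreover have "(odd k \<noteq> ((odd_word Z \<and> odd k) \<noteq> (((odd m \<noteq> even k) \<noteq> (e \<and> even k)) \<noteq> (odd_word A \<and> odd k)))) = True"
    using pe assms(5) by auto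
  ultimately show ?thesis unfolding y by simp
qed

text \<open>The cycle \<open>s_1 ... s_r\<close> carries strand \<open>r + 1\<close> to strand 1, so
  \<open>x_(r+1)\<close> has the leading term \<open>s_r ... s_1 x_1 s_1 ... s_r\<close>. This is
  why the elements \<open>s'_(r,l)\<close> take the place of the powers
  \<open>x_(r+1)^l\<close>.\<close>

lemma word_rel_X_shift:
  assumes "r < n"
  shows "word_rel n False (replicate l (XGen (Suc r))) (rev (s_run 1 (Suc r)) @ replicate l (XGen 1) @ s_run 1 (Suc r))"
proof -
  have u: "set (s_run 1 (Suc r)) \<subseteq> SGen ` {1..<n}" using assms by (auto simp: set_up)
  have "word_rel n False (s_run 1 (Suc r) @ replicate l (XGen (Suc r))) (map (\<lambda>_. XGen 1) (replicate l (XGen (Suc r))) @ s_run 1 (Suc r))"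
    using assms word_rel_up_XC_last[of 1 "Suc r" n XGen] by (intro word_rel_pass0) auto
  from word_rel_congL[OF this, of "rev (s_run 1 (Suc r))"]
  have 1: "word_rel n False (rev (s_run 1 (Suc r)) @ s_run 1 (Suc r) @ replicate l (XGen (Suc r)))
      (rev (s_run 1 (Suc r)) @ replicate l (XGen 1) @ s_run 1 (Suc r))" by simp
  have 2: "word_rel n False (replicate l (XGen (Suc r))) (rev (s_run 1 (Suc r)) @ s_run 1 (Suc r) @ replicate l (XGen (Suc r)))"
    using word_rel_congR[OF word_rel_sym[OF word_rel_SS_cancel'[OF u]], of "replicate l (XGen (Suc r))"] by simp
  show ?thesis using 2 1 by (rule word_rel_trans0)
qed

text \<open>The cyclotomic relation speaks of \<open>x_1\<close> only. Whatever strand a block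
  begins on, its power of \<open>x\<close> is conjugate to a power of \<open>x_1\<close>, to which
  the relation applies.\<close>

lemma trace_rel_high_power:
  assumes "\<forall>b\<in>set bs. 1 \<le> fst b" "sum_list (map fst bs) = n" "(k, m, e) \<in> set bs" "d \<le> m"
  shows "\<exists>p q. trace_rel n False (blocks_word 0 bs) (p @ replicate d (XGen 1) @ q)"
proof -
  obtain as cs where bs: "bs = as @ (k, m, e) # cs" using assms(3) by (meson split_list)
  define r where "r = sum_list (map fst as)"
  have "replicate m (XGen (Suc r)) = replicate d (XGen (Suc r)) @ replicate (m - d) (XGen (Suc r))"
    using assms(4) by (simp flip: replicate_add)
  then have "blocks_word 0 bs = blocks_word 0 as @ replicate d (XGen (Suc r)) @
    (replicate (m - d) (XGen (Suc r)) @ s_run (Suc r) (r + k) @ (if e then [CGen (r + k)] else []) @ blocks_word (r + k) cs)"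
    by (simp add: bs blocks_word_append r_def)
  then have "\<exists>p q. blocks_word 0 bs = p @ replicate d (XGen (Suc r)) @ q" by blast
  then obtain p q where e: "blocks_word 0 bs = p @ replicate d (XGen (Suc r)) @ q" by blast
  have "r < n" using assms(1,2) by (auto simp: bs r_def)
  from word_rel_cong[OF word_rel_X_shift[OF this], of p d q]
  have "word_rel n False (blocks_word 0 bs) ((p @ rev (s_run 1 (Suc r))) @ replicate d (XGen 1) @ (s_run 1 (Suc r) @ q))"
    by (simp add: e)
  then show ?thesis using trace_rel_base by blast
qed

text \<open>Blocks interleave their Clifford generators, whereas \<open>w_cl\<close> collects all of
  them at the end. \<open>leading_word\<close> is the intermediate stage: Clifford generators taken
  out, powers of \<open>x\<close> not yet replaced by conjugated powers of \<open>x_1\<close>. The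
  next two functions are the two products of \<open>w_cl\<close> in recursive form; they read off
  colors instead of flags, as by then the color determines the flag.\<close>

fun leading_word :: "nat \<Rightarrow> block list \<Rightarrow> gen list" where
  "leading_word r [] = []"
| "leading_word r ((k, m, e) # bs) = replicate m (XGen (Suc r)) @ s_run (Suc r) (r + k) @ leading_word (r + k) bs"

fun wreath_word :: "nat \<Rightarrow> block list \<Rightarrow> gen list" where
  "wreath_word r [] = []"
| "wreath_word r ((k, m, e) # bs) = (if m \<noteq> 0 then sprime_word r m else []) @ map s0_gen [r + 1..<r + k] @ wreath_word (r + k) bs"

fun clifford_part :: "nat \<Rightarrow> block list \<Rightarrow> gen list" where
  "clifford_part r [] = []"
| "clifford_part r ((k, m, e) # bs) = (if even m then [CGen (r + k)] else []) @ clifford_part (r + k) bs"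

lemma leading_word_props:
  assumes "\<forall>b\<in>set bs. 1 \<le> fst b" "r + sum_list (map fst bs) \<le> n"
  shows "\<not> odd_word (leading_word r bs) \<and> set (leading_word r bs) \<subseteq> gens n \<and> (\<forall>x\<in>set (leading_word r bs). \<forall>i\<in>strands x. r < i)"
  using assms
proof (induction r bs rule: leading_word.induct)
  case (2 r k m e bs)
  then have "\<not> odd_word (leading_word (r + k) bs) \<and> set (leading_word (r + k) bs) \<subseteq> gens n \<and> (\<forall>x\<in>set (leading_word (r + k) bs). \<forall>i\<in>strands x. r + k < i)"
    by auto
  with 2 show ?case by (auto simp: set_up) force
qed simp

text \<open>On its way to the end, \<open>c_(r+k)\<close> crosses only even letters on strands
  beyond \<open>r + k\<close>, so no sign appears. The Clifford generators keep their relative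
  order.\<close>

lemma word_rel_blocks_xs:
  assumes "\<forall>b\<in>set bs. 1 \<le> fst b" "r + sum_list (map fst bs) \<le> n" "\<forall>b\<in>set bs. snd (snd b) = even (fst (snd b))"
  shows "word_rel n False (blocks_word r bs) (leading_word r bs @ clifford_part r bs)"
  using assms
proof (induction r bs rule: leading_word.induct)
  case (2 r k m e bs)
  let ?c = "if even m then [CGen (r + k)] else []"
  have IH: "word_rel n False (blocks_word (r + k) bs) (leading_word (r + k) bs @ clifford_part (r + k) bs)"
    using 2 by auto
  have p: "\<not> odd_word (leading_word (r + k) bs) \<and> set (leading_word (r + k) bs) \<subseteq> gens n \<and> (\<forall>x\<in>set (leading_word (r + k) bs). \<forall>i\<in>strands x. r + k < i)"
    using 2 by (intro leading_word_props) auto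
  have c: "word_rel n False (?c @ leading_word (r + k) bs) (leading_word (r + k) bs @ ?c)"
    using p 2 by (intro word_rel_commute0) (auto split: if_splits)
  let ?P = "replicate m (XGen (Suc r)) @ s_run (Suc r) (r + k)"
  have 1: "word_rel n False ((?P @ ?c) @ blocks_word (r + k) bs) ((?P @ ?c) @ (leading_word (r + k) bs @ clifford_part (r + k) bs))"
    by (rule word_rel_congL[OF IH])
  have 2: "word_rel n False (?P @ (?c @ leading_word (r + k) bs) @ clifford_part (r + k) bs) (?P @ (leading_word (r + k) bs @ ?c) @ clifford_part (r + k) bs)"
    by (rule word_rel_cong[OF c])
  have e: "e = even m" using "2.prems" by simp
  have "word_rel n False ((?P @ ?c) @ blocks_word (r + k) bs) (?P @ (leading_word (r + k) bs @ ?c) @ clifford_part (r + k) bs)"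
    using 1 2 by (simp only: append_assoc) (rule word_rel_trans0)
  then show ?case by (simp only: append_assoc e blocks_word.simps block_word.simps fst_conv leading_word.simps clifford_part.simps)
qed (simp add: word_rel_refl)

lemma map_s0_gen: "1 \<le> a \<Longrightarrow> map s0_gen [a..<b] = s_run a b"
  by (simp add: s_run_def s0_gen_def)

lemma sprime_word_eq: "sprime_word r m = rev (s_run 1 (Suc r)) @ replicate m (XGen 1) @ s_run 1 (Suc r)"
proof -
  have "map s0_gen [1..<r + 1] = s_run 1 (Suc r)" using map_s0_gen[of 1 "r + 1"] by simp
  then show ?thesis unfolding sprime_word_def rev_map[symmetric] by (simp add: s0_gen_def)
qed

lemma word_rel_xs_ws:
  assumes "\<forall>b\<in>set bs. 1 \<le> fst b" "r + sum_list (map fst bs) \<le> n"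
  shows "word_rel n False (leading_word r bs) (wreath_word r bs)"
  using assms
proof (induction r bs rule: leading_word.induct)
  case (2 r k m e bs)
  have IH: "word_rel n False (leading_word (r + k) bs) (wreath_word (r + k) bs)" using 2 by auto
  have s: "word_rel n False (replicate m (XGen (Suc r))) (if m \<noteq> 0 then sprime_word r m else [])"
  proof (cases "m = 0")
    case False
    then show ?thesis using word_rel_X_shift[of r n m] 2 by (simp add: sprime_word_eq)
  qed (simp add: word_rel_refl)
  have u: "map s0_gen [r + 1..<r + k] = s_run (Suc r) (r + k)" using map_s0_gen[of "r + 1"] by simp
  show ?case unfolding leading_word.simps wreath_word.simps u
    by (rule word_rel_append[OF s word_rel_congL[OF IH]]) simp
qed (simp add: word_rel_refl)

definition bip_word :: "semibip \<Rightarrow> gen list" where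
  "bip_word \<beta> = concat (map (w_word \<beta>) [0..<length (parts \<beta>)]) @ concat (map (clifford_word \<beta>) [0..<length (parts \<beta>)])"

lemma w_cl_bip_word: "w_cl n g \<beta> = gen_prod n g (bip_word \<beta>)"
  by (simp add: w_cl_def bip_word_def)

lemma bip_word_blocks:
  assumes "parts \<beta> = map fst bs" "colors \<beta> = map (fst \<circ> snd) bs"
  shows "bip_word \<beta> = wreath_word 0 bs @ clifford_part 0 bs"
proof -
  define W where "W = (\<lambda>r (b::block). (if fst (snd b) \<noteq> 0 then sprime_word r (fst (snd b)) else []) @ map s0_gen [r + 1..<r + fst b])"
  define C where "C = (\<lambda>r (b::block). if even (fst (snd b)) then [CGen (r + fst b)] else [])"
  \<comment> \<open>Generalised over the starting offset: the recursive forms advance it block by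
    block, whereas \<open>w_word\<close> and \<open>clifford_word\<close> add up all preceding
    parts.\<close>
  have gen: "wreath_word r cs = concat (map (\<lambda>i. W (r + sum_list (map fst (take i cs))) (cs ! i)) [0..<length cs]) \<and>
    clifford_part r cs = concat (map (\<lambda>i. C (r + sum_list (map fst (take i cs))) (cs ! i)) [0..<length cs])" for r cs
  proof (induction r cs rule: wreath_word.induct)
    case (2 r k m e bs)
    have u: "[0..<length ((k, m, e) # bs)] = 0 # map Suc [0..<length bs]"
      by (simp add: upt_conv_Cons map_Suc_upt del: upt_Suc)
    have W: "wreath_word r ((k, m, e) # bs) = W r (k, m, e) @ wreath_word (r + k) bs"
      and C: "clifford_part r ((k, m, e) # bs) = C r (k, m, e) @ clifford_part (r + k) bs"
      by (simp_all add: W_def C_def)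
    show ?case unfolding u W C using 2 by (simp add: comp_def add.assoc)
  qed simp
  have len: "length (parts \<beta>) = length bs" using assms by simp
  have o: "offset \<beta> i = sum_list (map fst (take i bs))" for i
    by (simp add: offset_def assms take_map)
  have o2: "offset \<beta> (Suc i) = sum_list (map fst (take i bs)) + fst (bs ! i)" if "i < length bs" for i
    using that by (simp add: o take_Suc_conv_app_nth)
  have w: "w_word \<beta> i = W (0 + sum_list (map fst (take i bs))) (bs ! i)" if "i < length bs" for i
    using that o2[OF that] by (simp add: W_def w_word_def o assms)
  have c: "clifford_word \<beta> i = C (0 + sum_list (map fst (take i bs))) (bs ! i)" if "i < length bs" for i
    using that o2[OF that] by (simp add: C_def clifford_word_def o assms)
  have w': "map (w_word \<beta>) [0..<length bs] = map (\<lambda>i. W (0 + sum_list (map fst (take i bs))) (bs ! i)) [0..<length bs]"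
    using w by (intro map_cong) auto
  have c': "map (clifford_word \<beta>) [0..<length bs] = map (\<lambda>i. C (0 + sum_list (map fst (take i bs))) (bs ! i)) [0..<length bs]"
    using c by (intro map_cong) auto
  show ?thesis unfolding bip_word_def len w' c' using gen[of 0 bs] by simp
qed

section \<open>From lists of blocks to semi-bipartitions\<close>

lemma set_bs_eq_mset: "mset bs = mset bs' \<Longrightarrow> sum_list (map f bs) = (sum_list (map f bs') :: nat)"
  by (metis mset_map sum_mset_sum_list)

text \<open>Blocks may be permuted up to sign, so they can be put into the order that a
  semi-bipartition prescribes: those of nonzero color form \<open>\<lambda>\<close> with its color
  datum, those of color 0 form \<open>\<mu>\<close>. The hypotheses on flags and twins are the
  conditions left over by the two vanishing arguments.\<close>

lemma trace_rel_pm_hat: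
  assumes "\<forall>b\<in>set bs. 1 \<le> fst b" "sum_list (map fst bs) = n" "\<not> odd_word (blocks_word 0 bs)"
    and "\<forall>b\<in>set bs. snd (snd b) = even (fst (snd b)) \<and> fst (snd b) < d"
    and tw: "\<And>i j. i < length bs \<Longrightarrow> j < length bs \<Longrightarrow> i \<noteq> j \<Longrightarrow> snd (snd (bs ! i)) \<Longrightarrow> bs ! i \<noteq> bs ! j"
  shows "\<exists>\<beta>\<in>semibips_hat n d. trace_rel_pm n (blocks_word 0 bs) (bip_word \<beta>)"
proof -
  \<comment> \<open>orders by size and, within equal sizes, by decreasing color\<close>
  define key where "key = (\<lambda>b::block. fst b * Suc d + (d - fst (snd b)))"
  define L where "L = sort_key key (filter (\<lambda>b. fst (snd b) \<noteq> 0) bs)"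
  define M where "M = rev (sort_key fst (filter (\<lambda>b. fst (snd b) = 0) bs))"
  define cs where "cs = L @ M"
  have m: "mset bs = mset cs"
    by (simp add: cs_def L_def M_def)
  have st: "set cs = set bs" using mset_eq_setD[OF m] by simp
  have r1: "trace_rel_pm n (blocks_word 0 bs) (blocks_word 0 cs)" by (rule trace_rel_pm_perm[OF m assms(1-3)])
  have pcs: "\<not> odd_word (blocks_word 0 cs)" using r1 assms(3) trace_rel_par unfolding trace_rel_pm_def by blast
  have scs: "sum_list (map fst cs) = n" using set_bs_eq_mset[OF m] assms(2) by simp
  define \<beta> where "\<beta> = ((map fst L, map (fst \<circ> snd) L), map fst M)"
  have M0: "map (fst \<circ> snd) M = replicate (length M) 0"
    by (intro replicate_eqI) (auto simp: M_def)
  have p: "parts \<beta> = map fst cs" by (simp add: parts_def \<beta>_def cs_def)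
  have c: "colors \<beta> = map (fst \<circ> snd) cs" using M0 by (simp add: colors_def \<beta>_def cs_def)
  have "word_rel n False (blocks_word 0 cs) (leading_word 0 cs @ clifford_part 0 cs)"
    using assms st scs by (intro word_rel_blocks_xs) auto
  also have "word_rel n False (leading_word 0 cs @ clifford_part 0 cs) (wreath_word 0 cs @ clifford_part 0 cs)"
    using assms st scs by (intro word_rel_congR word_rel_xs_ws) auto
  finally have "word_rel n False (blocks_word 0 cs) (bip_word \<beta>)" by (simp add: bip_word_blocks[OF p c])
  then have r2: "trace_rel_pm n (blocks_word 0 bs) (bip_word \<beta>)" using r1 trace_rel_pm_trans trace_rel_pm_weqs weqsI by blast
  \<comment> \<open>\<open>d - m\<close> is less than \<open>Suc d\<close>, so keys compare sizes
    first; for colors below \<open>d\<close> the subtraction is faithful and reverses the order of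
    the colors.\<close>
  have key: "fst b \<le> fst b' \<and> (fst b = fst b' \<longrightarrow> fst (snd b') \<le> fst (snd b))"
    if "key b \<le> key b'" "fst (snd b) < d" "fst (snd b') < d" for b b'
  proof -
    have "fst b \<le> fst b'"
    proof (rule ccontr)
      assume "\<not> ?thesis"
      then have "Suc (fst b') * Suc d \<le> fst b * Suc d" by (intro mult_le_mono1) simp
      with that show False by (simp add: key_def)
    qed
    then show ?thesis using that by (auto simp: key_def)
  qed
  have sL: "sorted (map key L)" by (simp add: L_def)
  have Ld: "\<forall>b\<in>set L. fst (snd b) < d \<and> fst (snd b) \<noteq> 0" using assms(4) by (auto simp: L_def)
  have L1: "sorted (map fst L)"
    unfolding sorted_iff_nth_mono
  proof (intro allI impI)
    fix i j assume ij: "i \<le> j" "j < length (map fst L)"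
    then have "key (L ! i) \<le> key (L ! j)" using sorted_nth_mono[OF sL, of i j] by simp
    then show "map fst L ! i \<le> map fst L ! j" using key[of "L ! i" "L ! j"] Ld ij by auto
  qed
  have L2: "map (fst \<circ> snd) L ! i \<ge> map (fst \<circ> snd) L ! (i + 1)" 
    if "i + 1 < length L" "map fst L ! i = map fst L ! (i + 1)" for i
  proof -
    have "key (L ! i) \<le> key (L ! (i + 1))" using sorted_nth_mono[OF sL, of i "i + 1"] that by simp
    then show ?thesis using key[of "L ! i" "L ! (i + 1)"] Ld that by auto
  qed
  have pos: "0 \<notin> fst ` set cs" using assms(1) st by force
  have sum: "sum_list (map fst L) + sum_list (map fst M) = n" using scs by (simp add: cs_def)
  have "sorted_wrt (\<ge>) (map fst M)"
    by (simp add: M_def rev_map[symmetric] sorted_wrt_rev)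
  then have "\<beta> \<in> semibips n d"
    using L1 L2 Ld pos sum unfolding semibips_def \<beta>_def opposite_partition_def color_datum_def partition_of_def
    by (auto simp: cs_def intro!: exI[of _ "sum_list (map fst L)"])
  moreover have "parts \<beta> ! i \<noteq> parts \<beta> ! j"
    if ij: "i < length (parts \<beta>)" "j < length (parts \<beta>)" "i \<noteq> j" "colors \<beta> ! i = colors \<beta> ! j" "even (colors \<beta> ! i)" for i j
  proof
    assume e: "parts \<beta> ! i = parts \<beta> ! j"
    have fl: "snd (snd (cs ! k)) = even (fst (snd (cs ! k)))" if "k < length cs" for k
      using assms(4) st that nth_mem by blast
    have eq: "cs ! i = cs ! j" using ij e fl[of i] fl[of j] by (auto simp: p c prod_eq_iff)
    \<comment> \<open>Distinctness of the even blocks is known for positions in \<open>bs\<close>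
      and would fail for positions in \<open>cs\<close>. Sorting does not preserve positions, but it
      preserves multiplicities.\<close>
    have "\<not> distinct (filter (\<lambda>b. snd (snd b)) cs)"
    proof -
      have "count (mset cs) (cs ! i) \<ge> 2"
      proof -
        have "card {i, j} \<le> card {k. k < length cs \<and> cs ! i = cs ! k}"
          using ij eq p by (intro card_mono) auto
        moreover have "card {i, j} = 2" using ij by simp
        ultimately show ?thesis
          unfolding count_mset count_list_eq_length_filter length_filter_conv_card by simp
      qed
      then have "count (mset (filter (\<lambda>b. snd (snd b)) cs)) (cs ! i) \<ge> 2"
        using fl[of i] ij by (simp add: p c)
      then show ?thesis using distinct_count_atmost_1 by (metis Suc_1 count_mset_0_iff not_less_eq_eq le_zero_eq nat.distinct(1) order_refl zero_neq_numeral One_nat_def not_numeral_le_zero)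
    qed
    moreover have "distinct (filter (\<lambda>b. snd (snd b)) bs)"
      using tw
    proof (induction bs)
      case (Cons b bs)
      have "distinct (filter (\<lambda>b. snd (snd b)) bs)"
      proof (rule Cons.IH)
        fix i j assume "i < length bs" "j < length bs" "i \<noteq> j" "snd (snd (bs ! i))"
        then show "bs ! i \<noteq> bs ! j" using Cons.prems[of "Suc i" "Suc j"] by simp
      qed
      moreover have "b \<notin> set bs" if "snd (snd b)"
        using Cons.prems[of 0 "Suc i" for i] that by (auto simp: in_set_conv_nth)
      ultimately show ?case by simp
    qed simp
    moreover have "mset (filter (\<lambda>b. snd (snd b)) bs) = mset (filter (\<lambda>b. snd (snd b)) cs)" using m by simp
    ultimately show False using mset_eq_imp_distinct_iff by blast
  qed
  \<comment> \<open>Each even color contributes exactly one Clifford generator, so the parity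
    condition of \<open>semibips_hat\<close> is the evenness of the word.\<close>
  moreover have "even (card {i. i < length (parts \<beta>) \<and> even (colors \<beta> ! i)})"
  proof -
    have "{i. i < length (parts \<beta>) \<and> even (colors \<beta> ! i)} = {i. i < length cs \<and> snd (snd (cs ! i))}"
      using assms(4) st nth_mem[of _ cs] by (auto simp: p c)
    then show ?thesis using pcs by (simp add: odd_word_blocks_word length_filter_conv_card)
  qed
  ultimately have "\<beta> \<in> semibips_hat n d" by (auto simp: semibips_hat_def)
  then show ?thesis using r2 by blast
qed

text \<open>The three outcomes are what the induction on the degree can handle: a word equal to its
  negative vanishes after division by 2, a factor \<open>x_1^d\<close> is lowered by the cyclotomic
  relation, and the remaining words are the asserted generators.\<close>

theorem even_word_cases:
  assumes "1 \<le> n" "set u \<subseteq> gens n" "\<not> odd_word u"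
  shows "trace_rel n True u u \<or> (\<exists>b p q. trace_rel n b u (p @ replicate d (XGen 1) @ q)) \<or>
    (\<exists>b. \<exists>\<beta>\<in>semibips_hat n d. trace_rel n b u (bip_word \<beta>))"
proof -
  obtain bs where bs: "trace_rel_pm n u (blocks_word 0 bs)" "\<forall>b\<in>set bs. 1 \<le> fst b" "sum_list (map fst bs) = n"
    using trace_rel_pm_blocks[OF assms] by blast
  have odd_word: "\<not> odd_word (blocks_word 0 bs)" using bs(1) assms(3) trace_rel_par unfolding trace_rel_pm_def by blast
  show ?thesis
  proof (cases "trace_rel n True (blocks_word 0 bs) (blocks_word 0 bs)")
    case True
    then show ?thesis using trace_rel_True_transfer[OF bs(1)] by blast
  next
    case F: False
    show ?thesis
    proof (cases "\<exists>b\<in>set bs. d \<le> fst (snd b)")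
      case True
      then obtain k m e where "(k, m, e) \<in> set bs" "d \<le> m" by auto
      then obtain p q where "trace_rel n False (blocks_word 0 bs) (p @ replicate d (XGen 1) @ q)"
        using trace_rel_high_power[OF bs(2,3)] by blast
      then show ?thesis using bs(1) trace_rel_trans unfolding trace_rel_pm_def by blast
    next
      case False
      have "\<forall>b\<in>set bs. snd (snd b) = even (fst (snd b)) \<and> fst (snd b) < d"
      proof
        fix b assume b: "b \<in> set bs"
        obtain k m e where kme: "b = (k, m, e)" by (cases b)
        have "odd m \<noteq> e" using F trace_rel_True_parity[OF bs(2,3) odd_word, of k m e] b kme by blast
        then show "snd (snd b) = even (fst (snd b)) \<and> fst (snd b) < d" using False b kme by auto
      qed
      moreover have "bs ! i \<noteq> bs ! j" if "i < length bs" "j < length bs" "i \<noteq> j" "snd (snd (bs ! i))" for i j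
        using trace_rel_twins[OF bs(2,3) odd_word] that F by blast
      ultimately obtain \<beta> where "\<beta> \<in> semibips_hat n d" "trace_rel_pm n (blocks_word 0 bs) (bip_word \<beta>)"
        using trace_rel_pm_hat[OF bs(2,3) odd_word, of d] by blast
      then show ?thesis using bs(1) trace_rel_pm_trans unfolding trace_rel_pm_def by meson
    qed
  qed
qed

section \<open>Quotients of modules and algebras\<close>

lemma quotient_coset_facts:
  assumes "module R M" "submodule N R M"
  shows "x \<in> carrier M \<Longrightarrow> y \<in> carrier M \<Longrightarrow> (N +>\<^bsub>M\<^esub> x) <+>\<^bsub>M\<^esub> (N +>\<^bsub>M\<^esub> y) = N +>\<^bsub>M\<^esub> (x \<oplus>\<^bsub>M\<^esub> y)"
    and "r \<in> carrier R \<Longrightarrow> x \<in> carrier M \<Longrightarrow> coset_smult M N r (N +>\<^bsub>M\<^esub> x) = N +>\<^bsub>M\<^esub> (r \<odot>\<^bsub>M\<^esub> x)"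
    and "x \<in> carrier M \<Longrightarrow> N +>\<^bsub>M\<^esub> x = N \<longleftrightarrow> x \<in> N"
    and "x \<in> carrier M \<Longrightarrow> N +>\<^bsub>M\<^esub> x \<in> a_rcosets\<^bsub>M\<^esub> N"
    and "N +>\<^bsub>M\<^esub> \<zero>\<^bsub>M\<^esub> = N"
    and "abelian_subgroup N M"
proof -
  interpret M: module R M by fact
  interpret N: submodule N R M by fact
  have as: "additive_subgroup N M" by (simp add: additive_subgroup_def N.subgroup_axioms)
  then show ab: "abelian_subgroup N M" using abelian_subgroupI3 M.abelian_group_axioms by blast
  interpret A: abelian_subgroup N M by fact
  show "x \<in> carrier M \<Longrightarrow> y \<in> carrier M \<Longrightarrow> (N +>\<^bsub>M\<^esub> x) <+>\<^bsub>M\<^esub> (N +>\<^bsub>M\<^esub> y) = N +>\<^bsub>M\<^esub> (x \<oplus>\<^bsub>M\<^esub> y)"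
    by (rule A.a_rcos_sum)
  show mem: "x \<in> carrier M \<Longrightarrow> N +>\<^bsub>M\<^esub> x = N \<longleftrightarrow> x \<in> N" for x
    using M.a_coset_join1 M.a_coset_join2 A.a_subgroup by blast
  show "x \<in> carrier M \<Longrightarrow> N +>\<^bsub>M\<^esub> x \<in> a_rcosets\<^bsub>M\<^esub> N"
    using M.a_rcosetsI A.a_subset by blast
  show "N +>\<^bsub>M\<^esub> \<zero>\<^bsub>M\<^esub> = N" using A.a_subset by simp
  show "coset_smult M N r (N +>\<^bsub>M\<^esub> x) = N +>\<^bsub>M\<^esub> (r \<odot>\<^bsub>M\<^esub> x)" if r: "r \<in> carrier R" and x: "x \<in> carrier M"
  proof -
    \<comment> \<open>\<open>coset_smult\<close> is a union over all representatives of a coset. It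
      is a single coset because the members of the union coincide.\<close>
    have eq: "N +>\<^bsub>M\<^esub> (r \<odot>\<^bsub>M\<^esub> b) = N +>\<^bsub>M\<^esub> (r \<odot>\<^bsub>M\<^esub> x)" if b: "b \<in> N +>\<^bsub>M\<^esub> x" for b
    proof -
      obtain h where h: "h \<in> N" "b = h \<oplus>\<^bsub>M\<^esub> x" using b by (auto simp: a_r_coset_def')
      have hM: "h \<in> carrier M" using h by (rule_tac A.a_Hcarr)
      have "r \<odot>\<^bsub>M\<^esub> b = (r \<odot>\<^bsub>M\<^esub> h) \<oplus>\<^bsub>M\<^esub> (r \<odot>\<^bsub>M\<^esub> x)" using h hM r x M.smult_r_distr by simp
      moreover have "r \<odot>\<^bsub>M\<^esub> h \<in> N" using N.smult_closed r h by simp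
      ultimately have "r \<odot>\<^bsub>M\<^esub> b \<in> N +>\<^bsub>M\<^esub> (r \<odot>\<^bsub>M\<^esub> x)" by (auto simp: a_r_coset_def')
      then show ?thesis using M.a_repr_independence[OF _ _ A.a_subgroup] r x by simp
    qed
    have "coset_smult M N r (N +>\<^bsub>M\<^esub> x) = (\<Union>b\<in>N +>\<^bsub>M\<^esub> x. N +>\<^bsub>M\<^esub> (r \<odot>\<^bsub>M\<^esub> x))"
      unfolding coset_smult_def by (rule SUP_cong) (rule HOL.refl, rule eq)
    also have "\<dots> = N +>\<^bsub>M\<^esub> (r \<odot>\<^bsub>M\<^esub> x)" 
      using A.a_rcos_self[OF x] unfolding UN_constant by (metis empty_iff)
    finally show ?thesis .
  qed
qed

text \<open>\<open>Q\<close> is any record with these fields, so that the lemma serves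
  \<open>superalgebra_quot\<close> as well as \<open>module_quot\<close>.\<close>

lemma quotient_module:
  assumes M: "module R M" and N: "submodule N R M"
    and Q: "carrier Q = a_rcosets\<^bsub>M\<^esub> N" "add Q = set_add M" "zero Q = N" "module.smult Q = coset_smult M N"
  shows "module R Q"
proof -
  interpret M: module R M by fact
  note q = quotient_coset_facts[OF M N]
  interpret A: abelian_subgroup N M by (rule q(6))
  have car: "carrier Q = (\<lambda>x. N +>\<^bsub>M\<^esub> x) ` carrier M" unfolding Q(1) A_RCOSETS_def' by auto
  have add: "(N +>\<^bsub>M\<^esub> x) \<oplus>\<^bsub>Q\<^esub> (N +>\<^bsub>M\<^esub> y) = N +>\<^bsub>M\<^esub> (x \<oplus>\<^bsub>M\<^esub> y)" if "x \<in> carrier M" "y \<in> carrier M" for x y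
    using q(1) that by (simp add: Q)
  have fsmult: "r \<odot>\<^bsub>Q\<^esub> (N +>\<^bsub>M\<^esub> x) = N +>\<^bsub>M\<^esub> (r \<odot>\<^bsub>M\<^esub> x)" if "r \<in> carrier R" "x \<in> carrier M" for r x
    using q(2) that by (simp add: Q)
  show ?thesis
  proof (rule moduleI)
    show "cring R" by (rule M.R.is_cring)
    show "abelian_group Q"
    proof (rule abelian_groupI)
      show "\<zero>\<^bsub>Q\<^esub> \<in> carrier Q" using q(5) unfolding car Q(3) by (intro image_eqI[of _ _ "\<zero>\<^bsub>M\<^esub>"]) auto
      fix x assume "x \<in> carrier Q"
      then obtain x' where x: "x' \<in> carrier M" "x = N +>\<^bsub>M\<^esub> x'" unfolding car by auto
      show "\<zero>\<^bsub>Q\<^esub> \<oplus>\<^bsub>Q\<^esub> x = x" using add[of "\<zero>\<^bsub>M\<^esub>" x'] q(5) x by (simp add: Q(3))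
      have "(N +>\<^bsub>M\<^esub> \<ominus>\<^bsub>M\<^esub> x') \<oplus>\<^bsub>Q\<^esub> x = \<zero>\<^bsub>Q\<^esub>"
        using add[of "\<ominus>\<^bsub>M\<^esub> x'" x'] x q(5) by (simp add: Q(3) M.l_neg)
      then show "\<exists>y\<in>carrier Q. y \<oplus>\<^bsub>Q\<^esub> x = \<zero>\<^bsub>Q\<^esub>" using x car by blast
    qed (auto simp: car add M.a_ac)
  qed (auto simp: car add fsmult M.smult_l_distr M.smult_r_distr M.smult_assoc1)
qed

lemma submodule_Inter:
  assumes "module R M" "\<And>T. T \<in> \<T> \<Longrightarrow> submodule T R M" "\<T> \<noteq> {}"
  shows "submodule (\<Inter>\<T>) R M"
proof -
  interpret M: module R M by fact
  have E: "T \<subseteq> carrier M" "\<zero>\<^bsub>M\<^esub> \<in> T" "a \<in> T \<Longrightarrow> \<ominus>\<^bsub>M\<^esub> a \<in> T"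
      "a \<in> T \<Longrightarrow> b \<in> T \<Longrightarrow> a \<oplus>\<^bsub>M\<^esub> b \<in> T" "r \<in> carrier R \<Longrightarrow> a \<in> T \<Longrightarrow> r \<odot>\<^bsub>M\<^esub> a \<in> T"
    if "T \<in> \<T>" for T a b r
    using M.submoduleE[OF assms(2)[OF that]] subgroup.one_closed[OF submodule.axioms(1)[OF assms(2)[OF that]]]
    by auto
  show ?thesis
  proof (rule M.submoduleI)
    show "\<Inter>\<T> \<subseteq> carrier M" using E(1) assms(3) by (meson Inf_less_eq)
  qed (auto intro: E)
qed

lemma submodule_rspan:
  fixes A :: "('r::comm_ring_1, 'a, 'm) module_scheme"
  assumes "module (ring_of_type_algebra :: 'r ring) A" "S \<subseteq> carrier A"
  shows "submodule (rspan A S) (ring_of_type_algebra :: 'r ring) A"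
  unfolding rspan_def hull_def
  using module.carrier_is_submodule[OF assms(1)] assms by (intro submodule_Inter) auto

definition ralgebra :: "('r::comm_ring_1, 'a, 'm) module_scheme \<Rightarrow> bool" where
  "ralgebra A \<longleftrightarrow> ring A \<and> module (ring_of_type_algebra :: 'r ring) A \<and>
    (\<forall>r. \<forall>x\<in>carrier A. \<forall>y\<in>carrier A. (r \<odot>\<^bsub>A\<^esub> x) \<otimes>\<^bsub>A\<^esub> y = r \<odot>\<^bsub>A\<^esub> (x \<otimes>\<^bsub>A\<^esub> y))"

lemma carrier_type_ring [simp]: "carrier ring_of_type_algebra = UNIV"
  by (simp add: ring_of_type_algebra_def)

text \<open>Since \<open>r x = (r 1) x\<close>, closure under left multiplication includes closure
  under scalars.\<close>

lemma ralgebra_ideal_submodule: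
  fixes A :: "('r::comm_ring_1, 'a, 'm) module_scheme"
  assumes "ralgebra A" "ideal I A"
  shows "submodule I (ring_of_type_algebra :: 'r ring) A"
proof -
  interpret ring A using assms(1) by (simp add: ralgebra_def)
  interpret M: module "ring_of_type_algebra :: 'r ring" A using assms(1) by (simp add: ralgebra_def)
  interpret I: ideal I A by fact
  show ?thesis
  proof (rule M.submoduleI)
    fix r :: 'r and x assume x: "x \<in> I"
    then have "r \<odot>\<^bsub>A\<^esub> x = (r \<odot>\<^bsub>A\<^esub> \<one>\<^bsub>A\<^esub>) \<otimes>\<^bsub>A\<^esub> x"
      using assms(1) I.a_Hcarr by (simp add: ralgebra_def)
    then show "r \<odot>\<^bsub>A\<^esub> x \<in> I" using I.I_l_closed x by simp
  qed (use I.a_subset in auto)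
qed

lemma superalgebra_quot_simps:
  "carrier (superalgebra_quot A I) = a_rcosets\<^bsub>A\<^esub> I"
  "monoid.mult (superalgebra_quot A I) = rcoset_mult A I"
  "\<one>\<^bsub>superalgebra_quot A I\<^esub> = I +>\<^bsub>A\<^esub> \<one>\<^bsub>A\<^esub>"
  "\<zero>\<^bsub>superalgebra_quot A I\<^esub> = I" "add (superalgebra_quot A I) = set_add A"
  "module.smult (superalgebra_quot A I) = coset_smult A I"
  "hpart (superalgebra_quot A I) p = (\<lambda>x. I +>\<^bsub>A\<^esub> x) ` hpart A p"
  by (simp_all add: superalgebra_quot_def FactRing_def)

text \<open>Applied twice, because the cyclotomic algebra is a quotient of a quotient. The ring laws
  are inherited from \<open>A Quot I\<close>, whose ring operations \<open>Q\<close> shares; the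
  scalars come from the quotient module.\<close>

lemma ralgebra_quot:
  fixes A :: "('r::comm_ring_1, 'a) superalgebra"
  assumes A: "ralgebra A" and I: "ideal I A"
  defines "Q \<equiv> superalgebra_quot A I"
  shows "ralgebra Q"
    and "(\<lambda>x. I +>\<^bsub>A\<^esub> x) \<in> ring_hom A Q"
    and "x \<in> carrier A \<Longrightarrow> r \<odot>\<^bsub>Q\<^esub> (I +>\<^bsub>A\<^esub> x) = I +>\<^bsub>A\<^esub> (r \<odot>\<^bsub>A\<^esub> x)"
    and "carrier Q = (\<lambda>x. I +>\<^bsub>A\<^esub> x) ` carrier A"
    and "x \<in> carrier A \<Longrightarrow> I +>\<^bsub>A\<^esub> x = \<zero>\<^bsub>Q\<^esub> \<longleftrightarrow> x \<in> I"
proof -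
  interpret ring A using A by (simp add: ralgebra_def)
  interpret I: ideal I A by fact
  have M: "module (ring_of_type_algebra :: 'r ring) A" using A by (simp add: ralgebra_def)
  note S = ralgebra_ideal_submodule[OF A I]
  note q = quotient_coset_facts[OF M S]
  have mod: "module (ring_of_type_algebra :: 'r ring) Q"
    by (rule quotient_module[OF M S]) (simp_all add: Q_def superalgebra_quot_simps)
  interpret Q0: ring "A Quot I" by (rule I.quotient_is_ring)
  have e: "carrier Q = carrier (A Quot I)" "monoid.mult Q = monoid.mult (A Quot I)"
    "\<one>\<^bsub>Q\<^esub> = \<one>\<^bsub>A Quot I\<^esub>" "add Q = add (A Quot I)"
    by (simp_all add: Q_def superalgebra_quot_def)
  have ring: "ring Q"
  proof (rule ringI)
    show "abelian_group Q" using mod by (simp add: module_def)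
    show "Group.monoid Q" by (rule monoidI) (simp_all add: e Q0.m_assoc)
  qed (simp_all add: e Q0.l_distr Q0.r_distr)
  show car: "carrier Q = (\<lambda>x. I +>\<^bsub>A\<^esub> x) ` carrier A"
    unfolding Q_def superalgebra_quot_simps A_RCOSETS_def' by auto
  show fsmult: "x \<in> carrier A \<Longrightarrow> r \<odot>\<^bsub>Q\<^esub> (I +>\<^bsub>A\<^esub> x) = I +>\<^bsub>A\<^esub> (r \<odot>\<^bsub>A\<^esub> x)" for x r
    using q(2)[of r x] by (simp add: Q_def superalgebra_quot_simps)
  show "x \<in> carrier A \<Longrightarrow> I +>\<^bsub>A\<^esub> x = \<zero>\<^bsub>Q\<^esub> \<longleftrightarrow> x \<in> I"
    using q(3) by (simp add: Q_def superalgebra_quot_simps)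
  show "(\<lambda>x. I +>\<^bsub>A\<^esub> x) \<in> ring_hom A Q"
    using I.rcos_ring_hom by (simp add: Q_def superalgebra_quot_def ring_hom_def)
  have mult: "(I +>\<^bsub>A\<^esub> x) \<otimes>\<^bsub>Q\<^esub> (I +>\<^bsub>A\<^esub> y) = I +>\<^bsub>A\<^esub> (x \<otimes>\<^bsub>A\<^esub> y)" if "x \<in> carrier A" "y \<in> carrier A" for x y
    using I.rcoset_mult_add that by (simp add: Q_def superalgebra_quot_simps)
  have smc: "r \<odot>\<^bsub>A\<^esub> x \<in> carrier A" if "x \<in> carrier A" for r x
    using module.smult_closed[OF M] that by simp
  show "ralgebra Q" using ring mod A unfolding ralgebra_def car by (auto simp: mult fsmult smc)
qed

section \<open>The presentation\<close>

definition word_mon :: "gen list \<Rightarrow> 'r::comm_ring_1 free" where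
  "word_mon u = Poly_Mapping.single (FWord u) 1"

definition fsmult :: "'r::comm_ring_1 \<Rightarrow> 'r free \<Rightarrow> 'r free" where
  "fsmult r f = Poly_Mapping.map ((*) r) f"

lemma word_mon_append: "word_mon (u @ v) = word_mon u * word_mon v"
  by (simp add: word_mon_def mult_single plus_fword_def)

lemma word_mon_Nil [simp]: "word_mon [] = 1"
  by (simp add: word_mon_def flip: single_one zero_fword_def)

lemma word_mon_single: "word_mon [a] = gen_elem a" by (simp add: word_mon_def gen_elem_def)

lemma word_mon_Cons: "word_mon (a # u) = gen_elem a * word_mon u"
  using word_mon_append[of "[a]" u] by (simp add: word_mon_single)

lemma lookup_sm: "Poly_Mapping.lookup (fsmult r f) k = r * Poly_Mapping.lookup f k"
  by (simp add: fsmult_def map.rep_eq when_def)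

lemma keys_sm: "Poly_Mapping.keys (fsmult r f) \<subseteq> Poly_Mapping.keys f"
  by (auto simp: in_keys_iff lookup_sm)

lemma fsmult_simps [simp]: "fsmult r (f + g) = fsmult r f + fsmult r g" "fsmult (r + s) f = fsmult r f + fsmult s f"
  "fsmult (r * s) f = fsmult r (fsmult s f)" "fsmult 1 f = f" "fsmult 0 f = 0" "fsmult r 0 = 0" "fsmult r (f - g) = fsmult r f - fsmult r g"
  by (rule poly_mapping_eqI; simp add: lookup_sm lookup_add lookup_minus algebra_simps)+

lemma fsmult_single: "fsmult r (Poly_Mapping.single k s) = Poly_Mapping.single k (r * s)"
  by (rule poly_mapping_eqI) (simp add: lookup_sm lookup_single when_def)

lemma poly_mapping_sum_single:
  fixes f :: "'a \<Rightarrow>\<^sub>0 'b::comm_monoid_add"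
  shows "f = (\<Sum>k\<in>Poly_Mapping.keys f. Poly_Mapping.single k (Poly_Mapping.lookup f k))"
proof (rule poly_mapping_eqI)
  fix k
  have "Poly_Mapping.lookup (\<Sum>k\<in>S. Poly_Mapping.single k (Poly_Mapping.lookup f k)) k = (if k \<in> S then Poly_Mapping.lookup f k else 0)"
    if "finite S" for S
    using that by induction (auto simp: lookup_add lookup_single when_def)
  from this[of "Poly_Mapping.keys f"]
  show "Poly_Mapping.lookup f k = Poly_Mapping.lookup (\<Sum>k\<in>Poly_Mapping.keys f. Poly_Mapping.single k (Poly_Mapping.lookup f k)) k"
    by (simp add: in_keys_iff)
qed

lemma free_sum_words:
  "f = (\<Sum>k\<in>Poly_Mapping.keys f. fsmult (Poly_Mapping.lookup f k) (word_mon (letters k)))"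
  using poly_mapping_sum_single[of f] by (simp add: word_mon_def fsmult_single)

lemma fsmult_sum: "fsmult r (\<Sum>i\<in>S. h i) = (\<Sum>i\<in>S. fsmult r (h i))"
  by (induction S rule: infinite_finite_induct) auto

lemma fsmult_mult_left: "fsmult r f * h = fsmult r (f * h)"
proof -
  \<comment> \<open>A scalar acts as left multiplication by a multiple of the empty word, which is
    the zero of the additively written monoid of words.\<close>
  have c: "fsmult r f = Poly_Mapping.single 0 r * f" for f :: "'a free"
  proof -
    have "Poly_Mapping.single 0 r * f = (\<Sum>k\<in>Poly_Mapping.keys f. Poly_Mapping.single 0 r * Poly_Mapping.single k (Poly_Mapping.lookup f k))"
      by (subst (1) poly_mapping_sum_single) (simp add: sum_distrib_left)
    also have "\<dots> = fsmult r (\<Sum>k\<in>Poly_Mapping.keys f. Poly_Mapping.single k (Poly_Mapping.lookup f k))"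
      by (simp add: mult_single fsmult_sum fsmult_single)
    finally show ?thesis using poly_mapping_sum_single[of f] by simp
  qed
  show ?thesis by (simp add: c mult.assoc)
qed

text \<open>Taking the scalar out past \<open>f\<close> rests on the commutativity of the
  coefficients; this is checked for a single word on the left and extended by linearity.\<close>

lemma fsmult_mult_right: "f * fsmult r h = fsmult r (f * h)"
proof -
  have s: "Poly_Mapping.single k s * fsmult r h = fsmult r (Poly_Mapping.single k s * h)" for k s
  proof -
    have "Poly_Mapping.single k s * fsmult r h = (\<Sum>j\<in>Poly_Mapping.keys h. Poly_Mapping.single k s * fsmult r (Poly_Mapping.single j (Poly_Mapping.lookup h j)))"
      by (subst (1) poly_mapping_sum_single[of h]) (simp add: sum_distrib_left fsmult_sum)
    also have "\<dots> = fsmult r (\<Sum>j\<in>Poly_Mapping.keys h. Poly_Mapping.single k s * Poly_Mapping.single j (Poly_Mapping.lookup h j))"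
      by (simp add: mult_single fsmult_sum fsmult_single mult.left_commute)
    also have "\<dots> = fsmult r (Poly_Mapping.single k s * h)"
      by (subst (3) poly_mapping_sum_single[of h]) (simp add: sum_distrib_left)
    finally show ?thesis .
  qed
  have "f * fsmult r h = (\<Sum>k\<in>Poly_Mapping.keys f. Poly_Mapping.single k (Poly_Mapping.lookup f k) * fsmult r h)"
    by (subst (1) poly_mapping_sum_single[of f]) (simp add: sum_distrib_right)
  also have "\<dots> = fsmult r (\<Sum>k\<in>Poly_Mapping.keys f. Poly_Mapping.single k (Poly_Mapping.lookup f k) * h)"
    by (simp add: s fsmult_sum)
  also have "\<dots> = fsmult r (f * h)"
    by (subst (3) poly_mapping_sum_single[of f]) (simp add: sum_distrib_right)
  finally show ?thesis .
qed

lemma free_carrier_closed: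
  "0 \<in> free_carrier n" "1 \<in> free_carrier n"
  "f \<in> free_carrier n \<Longrightarrow> h \<in> free_carrier n \<Longrightarrow> f + h \<in> free_carrier n"
  "f \<in> free_carrier n \<Longrightarrow> h \<in> free_carrier n \<Longrightarrow> f - h \<in> free_carrier n"
  "f \<in> free_carrier n \<Longrightarrow> - f \<in> free_carrier n"
  "f \<in> free_carrier n \<Longrightarrow> h \<in> free_carrier n \<Longrightarrow> f * h \<in> free_carrier n"
  "f \<in> free_carrier n \<Longrightarrow> fsmult r f \<in> free_carrier n"
  "set u \<subseteq> gens n \<Longrightarrow> word_mon u \<in> free_carrier n"
  "a \<in> gens n \<Longrightarrow> gen_elem a \<in> free_carrier n"
  using keys_add[of f h] keys_diff[of f h] keys_mult[of f h] keys_sm[of r f]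
  by (auto simp: free_carrier_def word_mon_def gen_elem_def zero_fword_def plus_fword_def keys_single split: if_splits) (fastforce simp: plus_fword_def)+

lemma free_superalgebra_simps [simp]:
  "carrier (free_superalgebra n) = free_carrier n"
  "monoid.mult (free_superalgebra n) = (*)" "\<one>\<^bsub>free_superalgebra n\<^esub> = 1"
  "\<zero>\<^bsub>free_superalgebra n\<^esub> = 0" "add (free_superalgebra n) = (+)"
  "module.smult (free_superalgebra n) = fsmult"
  by (simp_all add: free_superalgebra_def fsmult_def fun_eq_iff)

lemma ring_free: "ring (free_superalgebra n)"
proof (rule ringI)
  show "abelian_group (free_superalgebra n)"
  proof (rule abelian_groupI)
    fix x assume "x \<in> carrier (free_superalgebra n)"
    then show "\<exists>y\<in>carrier (free_superalgebra n). y \<oplus>\<^bsub>free_superalgebra n\<^esub> x = \<zero>\<^bsub>free_superalgebra n\<^esub>"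
      by (intro bexI[of _ "- x"]) (auto intro: free_carrier_closed)
  qed (auto simp: free_carrier_closed add.assoc add.commute)
  show "Group.monoid (free_superalgebra n)"
    by (rule monoidI) (auto simp: free_carrier_closed mult.assoc)
qed (auto simp: algebra_simps)

lemma ralgebra_free: "ralgebra (free_superalgebra n :: ('r::comm_ring_1, 'r free) superalgebra)"
proof -
  interpret ring "free_superalgebra n :: ('r, 'r free) superalgebra" by (rule ring_free)
  have "module (ring_of_type_algebra :: 'r ring) (free_superalgebra n)"
    by (rule moduleI) (auto simp: ring_of_type_algebra_def free_carrier_closed is_abelian_group
        cring_from_type_algebra[unfolded ring_of_type_algebra_def])
  then show ?thesis using ring_free by (auto simp: ralgebra_def fsmult_mult_left)
qed

lemma hpart_free: "hpart (free_superalgebra n) p = {f \<in> free_carrier n. \<forall>w\<in>Poly_Mapping.keys f. word_parity w = p}"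
  by (simp add: free_superalgebra_def)

lemma word_parity_par: "word_parity w = of_bool (odd_word (letters w))"
proof -
  have "sum_list (map gen_parity u) = (of_bool (odd_word u) :: bit)" for u
  proof (induction u)
    case (Cons a u)
    then show ?case by (cases a) auto
  qed simp
  then show ?thesis by (simp add: word_parity_def)
qed

section \<open>The two quotients and their composite projection\<close>

lemma sergeev_rels_carrier: "sergeev_rels n \<subseteq> free_carrier n"
proof
  fix f :: "'a free" assume "f \<in> sergeev_rels n"
  then show "f \<in> free_carrier n"
    by cases (auto intro!: free_carrier_closed)
qed

lemma ideal_sergeev: "ideal (sergeev_ideal n) (free_superalgebra n)"
  unfolding sergeev_ideal_def using sergeev_rels_carrier
  by (intro ring.genideal_ideal ring_free) auto

lemma ralgebra_affine: "ralgebra (affine_sergeev n :: ('r::comm_ring_1, 'r free set) superalgebra)"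
  unfolding affine_sergeev_def by (intro ralgebra_quot ralgebra_free ideal_sergeev)

definition aff_proj :: "nat \<Rightarrow> 'r::comm_ring_1 free \<Rightarrow> 'r free set" where
  "aff_proj n f = sergeev_ideal n +>\<^bsub>free_superalgebra n\<^esub> f"

text \<open>A lift of \<open>poly_at_x1\<close> to the free algebra, where words and their degrees
  are available.\<close>

definition g_at_x :: "'r::comm_ring_1 poly \<Rightarrow> 'r free" where
  "g_at_x g = (\<Sum>k\<le>Polynomial.degree g. fsmult (Polynomial.coeff g k) (word_mon (replicate k (XGen 1))))"

lemma aff_proj_props:
  fixes f :: "'r::comm_ring_1 free" and n :: nat
  defines "A \<equiv> affine_sergeev n :: ('r, 'r free set) superalgebra"
  shows "aff_proj n \<in> ring_hom (free_superalgebra n) A"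
    and "f \<in> free_carrier n \<Longrightarrow> aff_proj n (fsmult r f) = r \<odot>\<^bsub>A\<^esub> aff_proj n f"
    and "carrier A = aff_proj n ` free_carrier n"
    and "f \<in> free_carrier n \<Longrightarrow> aff_proj n f = \<zero>\<^bsub>A\<^esub> \<longleftrightarrow> f \<in> sergeev_ideal n"
    and "hpart A p = aff_proj n ` hpart (free_superalgebra n) p"
  unfolding A_def affine_sergeev_def aff_proj_def[abs_def]
  by (simp_all add: ralgebra_quot(2-5)[OF ralgebra_free ideal_sergeev[of n], simplified] superalgebra_quot_simps(7))

lemma poly_at_x1_eq:
  fixes g :: "'r::comm_ring_1 poly"
  assumes "1 \<le> n"
  shows "poly_at_x1 n g = aff_proj n (g_at_x g)"
proof -
  define A where "A = (affine_sergeev n :: ('r, 'r free set) superalgebra)"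
  have rA: "ralgebra A" unfolding A_def by (rule ralgebra_affine)
  interpret A: ring A using rA by (simp add: ralgebra_def)
  have hom: "aff_proj n \<in> ring_hom (free_superalgebra n) A" using aff_proj_props(1) by (simp add: A_def)
  note h = ring_hom_add[OF hom] ring_hom_mult[OF hom] ring_hom_one[OF hom]
  have X: "word_mon (replicate k (XGen 1)) \<in> free_carrier n" for k using assms by (intro free_carrier_closed) auto
  have cl: "aff_proj n f \<in> carrier A" if "f \<in> free_carrier n" for f using ring_hom_closed[OF hom] that by simp
  have pow: "affine_gen n (XGen 1) [^]\<^bsub>A\<^esub> k = aff_proj n (word_mon (replicate k (XGen 1)))" for k
  proof (induction k)
    case 0
    then show ?case using h(3) by simp
  next
    case (Suc k)
    have "aff_proj n (word_mon (replicate k (XGen 1) @ [XGen 1])) = aff_proj n (word_mon (replicate k (XGen 1))) \<otimes>\<^bsub>A\<^esub> aff_proj n (word_mon [XGen 1])"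
      unfolding word_mon_append using assms X[of k] by (subst h(2)[symmetric]) (auto intro!: free_carrier_closed)
    then show ?case using Suc by (simp add: replicate_append_same affine_gen_def aff_proj_def word_mon_single)
  qed
  have "(\<Oplus>\<^bsub>A\<^esub>k\<in>{..N}. Polynomial.coeff g k \<odot>\<^bsub>A\<^esub> (affine_gen n (XGen 1) [^]\<^bsub>A\<^esub> k)) =
      aff_proj n (\<Sum>k\<le>N. fsmult (Polynomial.coeff g k) (word_mon (replicate k (XGen 1))))" for N
  proof (induction N)
    case 0
    have e: "Polynomial.coeff g 0 \<odot>\<^bsub>A\<^esub> aff_proj n (word_mon (replicate 0 (XGen 1))) = aff_proj n (fsmult (Polynomial.coeff g 0) (word_mon (replicate 0 (XGen 1))))"
      using aff_proj_props(2)[OF X[of 0], of "Polynomial.coeff g 0"] by (simp add: A_def)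
    moreover have "aff_proj n (fsmult (Polynomial.coeff g 0) (word_mon (replicate 0 (XGen 1)))) \<in> carrier A"
      by (intro cl free_carrier_closed X)
    ultimately show ?case unfolding pow by (subst A.finsum_0) (auto simp del: word_mon_Nil replicate.simps)
  next
    case (Suc N)
    have S: "(\<Sum>k\<le>N. fsmult (Polynomial.coeff g k) (word_mon (replicate k (XGen 1)))) \<in> free_carrier n" for N
      using assms by (induction N) (auto intro!: free_carrier_closed simp del: word_mon_Nil)
    have "aff_proj n (\<Sum>k\<le>Suc N. fsmult (Polynomial.coeff g k) (word_mon (replicate k (XGen 1)))) =
      aff_proj n (fsmult (Polynomial.coeff g (Suc N)) (word_mon (replicate (Suc N) (XGen 1)))) \<oplus>\<^bsub>A\<^esub> aff_proj n (\<Sum>k\<le>N. fsmult (Polynomial.coeff g k) (word_mon (replicate k (XGen 1))))"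
      using h(1)[of "fsmult (Polynomial.coeff g (Suc N)) (word_mon (replicate (Suc N) (XGen 1)))" "\<Sum>k\<le>N. fsmult (Polynomial.coeff g k) (word_mon (replicate k (XGen 1)))"]
        S[of N] free_carrier_closed(7)[OF X[of "Suc N"], of "Polynomial.coeff g (Suc N)"]
      by (simp add: add.commute del: replicate.simps)
    also have "\<dots> = (Polynomial.coeff g (Suc N) \<odot>\<^bsub>A\<^esub> (affine_gen n (XGen 1) [^]\<^bsub>A\<^esub> (Suc N))) \<oplus>\<^bsub>A\<^esub>
        (\<Oplus>\<^bsub>A\<^esub>k\<in>{..N}. Polynomial.coeff g k \<odot>\<^bsub>A\<^esub> (affine_gen n (XGen 1) [^]\<^bsub>A\<^esub> k))"
      using Suc aff_proj_props(2)[OF X[of "Suc N"], of "Polynomial.coeff g (Suc N)"] unfolding pow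
      by (simp add: A_def[symmetric] del: replicate.simps)
    also have "\<dots> = (\<Oplus>\<^bsub>A\<^esub>k\<in>{..Suc N}. Polynomial.coeff g k \<odot>\<^bsub>A\<^esub> (affine_gen n (XGen 1) [^]\<^bsub>A\<^esub> k))"
    proof (rule A.finsum_Suc[symmetric], rule Pi_I)
      fix k
      show "Polynomial.coeff g k \<odot>\<^bsub>A\<^esub> (affine_gen n (XGen 1) [^]\<^bsub>A\<^esub> k) \<in> carrier A"
        using cl[OF free_carrier_closed(7)[OF X[of k], of "Polynomial.coeff g k"]] aff_proj_props(2)[OF X[of k], of "Polynomial.coeff g k"]
        unfolding pow by (simp add: A_def)
    qed
    finally show ?case by simp
  qed
  then show ?thesis by (simp add: poly_at_x1_def g_at_x_def A_def)
qed

lemma g_at_x_free: "1 \<le> n \<Longrightarrow> g_at_x g \<in> free_carrier n"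
proof -
  assume n: "1 \<le> n"
  have "(\<Sum>k\<le>N. fsmult (Polynomial.coeff g k) (word_mon (replicate k (XGen 1)))) \<in> free_carrier n" for N
    using n by (induction N) (auto intro!: free_carrier_closed simp del: word_mon_Nil)
  then show ?thesis by (simp add: g_at_x_def)
qed

lemma ideal_cyclotomic:
  assumes "1 \<le> n"
  shows "ideal (cyclotomic_ideal n g) (affine_sergeev n)" "poly_at_x1 n g \<in> cyclotomic_ideal n g"
proof -
  have r: "ring (affine_sergeev n :: ('a, 'a free set) superalgebra)" using ralgebra_affine[of n, where ?'r = 'a] by (simp add: ralgebra_def)
  have c: "poly_at_x1 n g \<in> carrier (affine_sergeev n)"
    using assms by (simp add: poly_at_x1_eq aff_proj_props(3) g_at_x_free)
  show "ideal (cyclotomic_ideal n g) (affine_sergeev n)"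
    unfolding cyclotomic_ideal_def using c by (intro ring.genideal_ideal r) simp
  show "poly_at_x1 n g \<in> cyclotomic_ideal n g"
    unfolding cyclotomic_ideal_def by (rule ring.genideal_self'[OF r c])
qed

text \<open>Elements of the cyclotomic algebra are cosets of cosets. This composite of the two
  projections lets the computations take place in the free algebra.\<close>

definition cyc_proj :: "nat \<Rightarrow> 'r::comm_ring_1 poly \<Rightarrow> 'r free \<Rightarrow> 'r free set set" where
  "cyc_proj n g f = cyclotomic_ideal n g +>\<^bsub>affine_sergeev n\<^esub> aff_proj n f"

lemma ralgebra_cyclotomic: "1 \<le> n \<Longrightarrow> ralgebra (cyclotomic_sergeev n g)"
  unfolding cyclotomic_sergeev_def by (intro ralgebra_quot ralgebra_affine ideal_cyclotomic)

lemma cyc_proj_props: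
  assumes n: "1 \<le> n"
  shows "cyc_proj n g \<in> ring_hom (free_superalgebra n) (cyclotomic_sergeev n g)"
    and "f \<in> free_carrier n \<Longrightarrow> cyc_proj n g (fsmult r f) = r \<odot>\<^bsub>cyclotomic_sergeev n g\<^esub> cyc_proj n g f"
    and "carrier (cyclotomic_sergeev n g) = cyc_proj n g ` free_carrier n"
    and "hpart (cyclotomic_sergeev n g) p = cyc_proj n g ` hpart (free_superalgebra n) p"
    and "f \<in> sergeev_ideal n \<Longrightarrow> cyc_proj n g f = \<zero>\<^bsub>cyclotomic_sergeev n g\<^esub>"
    and "cyc_proj n g (g_at_x g) = \<zero>\<^bsub>cyclotomic_sergeev n g\<^esub>"
proof -
  note q = ralgebra_quot(2-5)[OF ralgebra_affine ideal_cyclotomic(1)[OF n, of g], folded cyclotomic_sergeev_def]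
  have ac: "aff_proj n f \<in> carrier (affine_sergeev n)" if "f \<in> free_carrier n" for f :: "'a free"
    using that by (simp add: aff_proj_props(3))
  have e: "cyc_proj n g = (\<lambda>x. cyclotomic_ideal n g +>\<^bsub>affine_sergeev n\<^esub> x) \<circ> aff_proj n" by (simp add: cyc_proj_def fun_eq_iff)
  show "cyc_proj n g \<in> ring_hom (free_superalgebra n) (cyclotomic_sergeev n g)"
    unfolding e by (rule ring_hom_trans[OF aff_proj_props(1) q(1)])
  show "f \<in> free_carrier n \<Longrightarrow> cyc_proj n g (fsmult r f) = r \<odot>\<^bsub>cyclotomic_sergeev n g\<^esub> cyc_proj n g f"
    by (simp add: cyc_proj_def q(2) ac aff_proj_props(2))
  show "carrier (cyclotomic_sergeev n g) = cyc_proj n g ` free_carrier n"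
    by (simp add: q(3) aff_proj_props(3) e image_comp)
  show "hpart (cyclotomic_sergeev n g) p = cyc_proj n g ` hpart (free_superalgebra n) p"
    unfolding cyclotomic_sergeev_def superalgebra_quot_simps(7) aff_proj_props(5) e image_comp by simp
  show "cyc_proj n g f = \<zero>\<^bsub>cyclotomic_sergeev n g\<^esub>" if f: "f \<in> sergeev_ideal n"
  proof -
    have fc: "f \<in> free_carrier n" using f additive_subgroup.a_subset[OF ideal.axioms(1)[OF ideal_sergeev[of n]]] by auto
    have "aff_proj n f = \<zero>\<^bsub>affine_sergeev n\<^esub>" using aff_proj_props(4)[OF fc] f by simp
    moreover have "\<zero>\<^bsub>affine_sergeev n\<^esub> \<in> cyclotomic_ideal n g"
      using additive_subgroup.zero_closed[OF ideal.axioms(1)[OF ideal_cyclotomic(1)[OF n, of g]]] .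
    ultimately show ?thesis using q(4)[OF ac[OF fc]] by (simp add: cyc_proj_def)
  qed
  show "cyc_proj n g (g_at_x g) = \<zero>\<^bsub>cyclotomic_sergeev n g\<^esub>"
    using q(4)[OF ac[OF g_at_x_free[OF n, of g]]] ideal_cyclotomic(2)[OF n, of g] by (simp add: cyc_proj_def poly_at_x1_eq[OF n])
qed

lemma gen_prod_cyc:
  assumes n: "1 \<le> n" and u: "set u \<subseteq> gens n"
  shows "gen_prod n g u = cyc_proj n g (word_mon u)"
  using u
proof (induction u)
  case Nil
  show ?case using ring_hom_one[OF cyc_proj_props(1)[OF n, of g]] by (simp add: gen_prod_def)
next
  case (Cons a u)
  have "cyclotomic_gen n g a = cyc_proj n g (gen_elem a)"
    by (simp add: cyclotomic_gen_def affine_gen_def cyc_proj_def aff_proj_def)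
  then show ?case using Cons ring_hom_mult[OF cyc_proj_props(1)[OF n, of g], of "gen_elem a" "word_mon u"]
    by (simp add: gen_prod_def word_mon_Cons free_carrier_closed)
qed

section \<open>Induction on the degree\<close>

abbreviation even_free :: "nat \<Rightarrow> 'r::comm_ring_1 free set" where
  "even_free n \<equiv> hpart (free_superalgebra n) 0"

lemma hpart_free_closed:
  "0 \<in> hpart (free_superalgebra n) p"
  "f \<in> hpart (free_superalgebra n) p \<Longrightarrow> h \<in> hpart (free_superalgebra n) p \<Longrightarrow> f + h \<in> hpart (free_superalgebra n) p"
  "f \<in> hpart (free_superalgebra n) p \<Longrightarrow> h \<in> hpart (free_superalgebra n) p \<Longrightarrow> f - h \<in> hpart (free_superalgebra n) p"
  "f \<in> hpart (free_superalgebra n) p \<Longrightarrow> - f \<in> hpart (free_superalgebra n) p"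
  "f \<in> hpart (free_superalgebra n) p \<Longrightarrow> fsmult r f \<in> hpart (free_superalgebra n) p"
  "set u \<subseteq> gens n \<Longrightarrow> word_mon u \<in> hpart (free_superalgebra n) (of_bool (odd_word u))"
  using keys_add[of f h] keys_diff[of f h] keys_sm[of r f]
  by (auto simp: hpart_free free_carrier_closed) (auto simp: word_mon_def word_parity_par split: if_splits)

definition signed :: "bool \<Rightarrow> 'r::comm_ring_1 free \<Rightarrow> 'r free" where "signed b f = (if b then - f else f)"

lemma signed_simps [simp]: "signed False f = f" "signed True f = - f" by (simp_all add: signed_def)

text \<open>Separates the induction from the nested quotients. In the application \<open>J\<close>
  is the kernel of \<open>cyc_proj\<close> and \<open>U\<close> the set of even elements whose class
  lies in a given submodule containing the generators. An element of \<open>J\<close> is passed on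
  to \<open>U\<close> only when it is even, so each use has to verify that the correction terms are
  even as well.\<close>

locale even_span =
  fixes n d :: nat and g :: "'r::comm_ring_1 poly" and J U :: "'r free set"
  assumes n: "1 \<le> n" and d: "1 \<le> d" and two: "(2::'r) dvd 1"
    and degree_g: "Polynomial.degree g = d" and monic_g: "Polynomial.coeff g d = 1"
    and U_zero: "0 \<in> U" and U_add: "f \<in> U \<Longrightarrow> h \<in> U \<Longrightarrow> f + h \<in> U" and U_sm: "f \<in> U \<Longrightarrow> fsmult r f \<in> U"
    and J_add: "f \<in> J \<Longrightarrow> h \<in> J \<Longrightarrow> f + h \<in> J" and J_minus: "f \<in> J \<Longrightarrow> - f \<in> J"
    and J_U: "f \<in> J \<Longrightarrow> f \<in> even_free n \<Longrightarrow> f \<in> U"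
    and J_rel: "f \<in> sergeev_rels n \<Longrightarrow> set p \<subseteq> gens n \<Longrightarrow> set q \<subseteq> gens n \<Longrightarrow> word_mon p * f * word_mon q \<in> J"
    and J_gpol: "set p \<subseteq> gens n \<Longrightarrow> set q \<subseteq> gens n \<Longrightarrow> word_mon p * g_at_x g * word_mon q \<in> J"
    and U_trace: "set u \<subseteq> gens n \<Longrightarrow> set v \<subseteq> gens n \<Longrightarrow> odd_word u = odd_word v \<Longrightarrow> word_mon (u @ v) - signed (odd_word u) (word_mon (v @ u)) \<in> U"
    and U_word: "\<beta> \<in> semibips_hat n d \<Longrightarrow> word_mon (bip_word \<beta>) \<in> U"
begin

lemma U_minus: "f \<in> U \<Longrightarrow> - f \<in> U"
proof -
  have "- f = fsmult (-1) f" by (rule poly_mapping_eqI) (simp add: lookup_sm)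
  then show "f \<in> U \<Longrightarrow> - f \<in> U" using U_sm by metis
qed

lemma U_diff: "f \<in> U \<Longrightarrow> h \<in> U \<Longrightarrow> f - h \<in> U"
  using U_add[OF _ U_minus, of f h] by simp

lemma U_sgf: "f \<in> U \<Longrightarrow> signed b f \<in> U"
  using U_minus by (cases b) auto

lemma U_sum: "(\<And>i. i \<in> S \<Longrightarrow> h i \<in> U) \<Longrightarrow> (\<Sum>i\<in>S. h i) \<in> U"
  by (induction S rule: infinite_finite_induct) (auto intro: U_zero U_add)

lemma J_diff: "f \<in> J \<Longrightarrow> h \<in> J \<Longrightarrow> f - h \<in> J"
  using J_add[OF _ J_minus, of f h] by simp

lemma word_mon_even: "set u \<subseteq> gens n \<Longrightarrow> \<not> odd_word u \<Longrightarrow> word_mon u \<in> even_free n"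
  using hpart_free_closed(6)[of u n] by simp

lemma even_free_diff: "f \<in> even_free n \<Longrightarrow> h \<in> even_free n \<Longrightarrow> f - signed b h \<in> even_free n"
  by (cases b) (auto intro: hpart_free_closed)

text \<open>\<open>e\<close> is the part by which the true relation exceeds its leading terms. It
  consists of words of smaller degree and so lies in \<open>U\<close> by induction, which allows it
  to be subtracted.\<close>

lemma word_rel_step:
  assumes "word_rel n b u v" "set u \<subseteq> gens n" "set p \<subseteq> gens n" "set q \<subseteq> gens n" "\<not> odd_word (p @ u @ q)"
    and "word_mon p * (word_mon u - signed b (word_mon v)) * word_mon q + e \<in> J" "e \<in> U" "e \<in> even_free n"
  shows "word_mon (p @ u @ q) - signed b (word_mon (p @ v @ q)) \<in> U"
proof -
  have v: "set v \<subseteq> gens n" "odd_word u = odd_word v" using word_rel_gens word_rel_par assms by blast+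
  have e: "word_mon p * (word_mon u - signed b (word_mon v)) * word_mon q = word_mon (p @ u @ q) - signed b (word_mon (p @ v @ q))"
    by (cases b) (simp_all add: word_mon_append algebra_simps)
  have "word_mon (p @ u @ q) - signed b (word_mon (p @ v @ q)) \<in> even_free n"
    using assms v by (intro even_free_diff word_mon_even) auto
  then have "word_mon p * (word_mon u - signed b (word_mon v)) * word_mon q + e \<in> even_free n"
    unfolding e using assms hpart_free_closed(2) by blast
  then have "word_mon p * (word_mon u - signed b (word_mon v)) * word_mon q + e \<in> U" using assms J_U by blast
  then have "word_mon p * (word_mon u - signed b (word_mon v)) * word_mon q + e - e \<in> U" using U_diff assms by blast
  then show ?thesis by (simp add: e)
qed

lemma word_rel_step0:
  assumes "word_rel n b u v" "set u \<subseteq> gens n" "set p \<subseteq> gens n" "set q \<subseteq> gens n" "\<not> odd_word (p @ u @ q)"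
    and "word_mon u - signed b (word_mon v) \<in> (sergeev_rels n :: 'r free set)"
  shows "word_mon (p @ u @ q) - signed b (word_mon (p @ v @ q)) \<in> U"
  using word_rel_step[OF assms(1-5), of 0] J_rel[OF assms(6,3,4)] U_zero by (simp add: hpart_free_closed)

context
  fixes m :: nat
  assumes IH: "\<And>u. set u \<subseteq> gens n \<Longrightarrow> \<not> odd_word u \<Longrightarrow> x_degree u < m \<Longrightarrow> word_mon u \<in> U"
begin

text \<open>Stated for every context \<open>p\<close>, \<open>q\<close> of total degree
  \<open>m\<close>: the congruence rule then only enlarges the context, and the induction hypothesis
  of the degree applies to the context with the dropped terms put in.\<close>

lemma word_rel_sound:
  assumes "word_rel n b u v" "set u \<subseteq> gens n" "set p \<subseteq> gens n" "set q \<subseteq> gens n" "\<not> odd_word (p @ u @ q)" "x_degree (p @ u @ q) = m"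
  shows "word_mon (p @ u @ q) - signed b (word_mon (p @ v @ q)) \<in> U"
  using assms
proof (induction arbitrary: p q rule: word_rel.induct)
  case (word_rel_refl u)
  then show ?case by (simp add: U_zero)
next
  case (word_rel_sym b u v)
  have "set u \<subseteq> gens n" "odd_word u = odd_word v" "x_degree u = x_degree v"
    using word_rel_sym.prems word_rel_gens[OF word_rel_sym.hyps] word_rel_par[OF word_rel_sym.hyps] word_rel_deg[OF word_rel_sym.hyps] by auto
  then have "word_mon (p @ u @ q) - signed b (word_mon (p @ v @ q)) \<in> U" using word_rel_sym by (intro word_rel_sym.IH) auto
  from U_sgf[OF U_minus[OF this], of b] show ?case by (cases b) (auto simp: algebra_simps)
next
  case (word_rel_trans b u v b' w)
  have "set v \<subseteq> gens n" "odd_word u = odd_word v" "x_degree u = x_degree v"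
    using word_rel_trans.prems word_rel_gens[OF word_rel_trans.hyps(1)] word_rel_par[OF word_rel_trans.hyps(1)] word_rel_deg[OF word_rel_trans.hyps(1)] by auto
  then have 1: "word_mon (p @ u @ q) - signed b (word_mon (p @ v @ q)) \<in> U" and 2: "word_mon (p @ v @ q) - signed b' (word_mon (p @ w @ q)) \<in> U"
    using word_rel_trans by (intro word_rel_trans.IH; auto)+
  from U_add[OF 1 U_sgf[OF 2, of b]] show ?case by (cases b; cases b') auto
next
  case (word_rel_cong b u v p' q')
  then show ?case using word_rel_cong.IH[of "p @ p'" "q' @ q"] by auto
next
  case (word_rel_ss i)
  then show ?case by (intro word_rel_step0 word_rel.word_rel_ss) (auto simp: word_mon_Cons intro: sergeev_rels.intros)
next
  case (word_rel_far i j)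
  then show ?case by (intro word_rel_step0 word_rel.word_rel_far) (auto simp: word_mon_Cons intro!: sergeev_rels.intros)
next
  case (word_rel_braid i)
  then show ?case using sergeev_rels.braid[of i n]
    by (intro word_rel_step0 word_rel.word_rel_braid) (auto simp: word_mon_Cons mult.assoc)
next
  case (word_rel_sx i j)
  have i: "1 \<le> i" "i < n" using word_rel_sx by auto
  let ?r = "fr_s i * fr_x i - (fr_x (i + 1) * fr_s i - (1 + fr_c i * fr_c (i + 1))) :: 'r free"
  have r: "?r \<in> sergeev_rels n" using i by (intro sergeev_rels.sx) auto
  have ss: "fr_s i * fr_s i - 1 \<in> (sergeev_rels n :: 'r free set)" using i by (intro sergeev_rels.ss) auto
  consider "j = i" | "j = Suc i" | "j \<noteq> i" "j \<noteq> Suc i" by blast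
  then show ?case
  proof cases
    case 1
    \<comment> \<open>The relation reads \<open>s_i x_i - x_(i+1) s_i + 1 + c_i c_(i+1)\<close>;
      \<open>e\<close> is its lower part \<open>1 + c_i c_(i+1)\<close> in the context.\<close>
    define e :: "'r free" where "e = word_mon (p @ q) + word_mon (p @ [CGen i, CGen (Suc i)] @ q)"
    have "word_mon (p @ q) \<in> U" "word_mon (p @ [CGen i, CGen (Suc i)] @ q) \<in> U"
      using word_rel_sx 1 i by (intro IH; simp)+
    then have eU: "e \<in> U" unfolding e_def by (rule U_add)
    have ee: "e \<in> even_free n" unfolding e_def using word_rel_sx 1 i
      by (intro hpart_free_closed word_mon_even) auto
    show ?thesis
    proof (rule word_rel_step[OF word_rel.word_rel_sx[OF word_rel_sx.hyps] word_rel_sx.prems(1-4) _ eU ee])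
      have "word_mon p * (word_mon [SGen i, XGen j] - signed False (word_mon [XGen (sw i j), SGen i])) * word_mon q + e = word_mon p * ?r * word_mon q"
        using 1 by (simp add: e_def word_mon_append word_mon_Cons algebra_simps)
      then show "word_mon p * (word_mon [SGen i, XGen j] - signed False (word_mon [XGen (sw i j), SGen i])) * word_mon q + e \<in> J"
        using J_rel[OF r word_rel_sx.prems(2,3)] by simp
    qed
  next
    case 2 \<comment> \<open>multiply the relation for \<open>x\<^sub>i\<close> by \<open>s\<^sub>i\<close> on both sides\<close>
    define e :: "'r free" where "e = - word_mon (p @ [SGen i, SGen i] @ q) - word_mon (p @ [SGen i, CGen i, CGen (Suc i), SGen i] @ q)"
    have "word_mon (p @ [SGen i, SGen i] @ q) \<in> U" "word_mon (p @ [SGen i, CGen i, CGen (Suc i), SGen i] @ q) \<in> U"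
      using word_rel_sx 2 i by (intro IH; simp)+
    then have eU: "e \<in> U" unfolding e_def by (intro U_diff U_minus)
    have ee: "e \<in> even_free n" unfolding e_def using word_rel_sx 2 i
      by (intro hpart_free_closed word_mon_even) auto
    show ?thesis
    proof (rule word_rel_step[OF word_rel.word_rel_sx[OF word_rel_sx.hyps] word_rel_sx.prems(1-4) _ eU ee])
      \<comment> \<open>\<open>b\<close> and \<open>c\<close> remove the squares of
        \<open>s_i\<close> that the multiplication creates in degree \<open>m\<close>. In
        \<open>e\<close> they can stay, as its words are of smaller degree anyway.\<close>
      have a: "word_mon (p @ [SGen i]) * ?r * word_mon ([SGen i] @ q) \<in> J"
        and b: "word_mon p * (fr_s i * fr_s i - 1) * word_mon ([XGen i, SGen i] @ q) \<in> J"
        and c: "word_mon (p @ [SGen i, XGen (Suc i)]) * (fr_s i * fr_s i - 1) * word_mon q \<in> J"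
        using word_rel_sx i 2 by (intro J_rel r ss; simp)+
      have "word_mon p * (word_mon [SGen i, XGen j] - signed False (word_mon [XGen (sw i j), SGen i])) * word_mon q + e =
        word_mon p * (fr_s i * fr_s i - 1) * word_mon ([XGen i, SGen i] @ q)
        - (word_mon (p @ [SGen i, XGen (Suc i)]) * (fr_s i * fr_s i - 1) * word_mon q)
        - word_mon (p @ [SGen i]) * ?r * word_mon ([SGen i] @ q)"
        using 2 by (simp add: e_def word_mon_append word_mon_Cons algebra_simps)
      then show "word_mon p * (word_mon [SGen i, XGen j] - signed False (word_mon [XGen (sw i j), SGen i])) * word_mon q + e \<in> J"
        using J_diff[OF J_diff[OF b c] a] by simp
    qed
  next
    case 3
    have "fr_s i * fr_x j - fr_x j * fr_s i \<in> (sergeev_rels n :: 'r free set)"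
      using word_rel_sx 3 by (intro sergeev_rels.sx_comm) auto
    then show ?thesis using word_rel_sx 3
      by (intro word_rel_step0 word_rel.word_rel_sx) (auto simp: word_mon_Cons transpose_def)
  qed
next
  case (word_rel_sc i j)
  consider "j = i" | "j = Suc i" | "j \<noteq> i" "j \<noteq> Suc i" by blast
  then have "fr_s i * fr_c j - fr_c (sw i j) * fr_s i \<in> (sergeev_rels n :: 'r free set)"
  proof cases
    case 1 then show ?thesis using word_rel_sc sergeev_rels.sc[of i n] by simp
  next
    case 2 then show ?thesis using word_rel_sc sergeev_rels.sc_Suc[of i n] by simp
  next
    case 3 then show ?thesis using word_rel_sc sergeev_rels.sc_comm[of i n j] by (simp add: transpose_def)
  qed
  then show ?case using word_rel_sc by (intro word_rel_step0 word_rel.word_rel_sc) (auto simp: word_mon_Cons)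
next
  case (word_rel_xx i j)
  then show ?case by (intro word_rel_step0 word_rel.word_rel_xx) (auto simp: word_mon_Cons intro!: sergeev_rels.xx)
next
  case (word_rel_cc i)
  then show ?case by (intro word_rel_step0 word_rel.word_rel_cc) (auto simp: word_mon_Cons intro!: sergeev_rels.cc)
next
  case (word_rel_cc_swap i j)
  then show ?case using sergeev_rels.cc_anticomm[of i n j] by (intro word_rel_step0 word_rel.word_rel_cc_swap) (auto simp: word_mon_Cons)
next
  case (word_rel_xc i j)
  then show ?case using sergeev_rels.xc_anticomm[of i n] sergeev_rels.xc_comm[of i n j]
    by (intro word_rel_step0 word_rel.word_rel_xc) (auto simp: word_mon_Cons signed_def)
qed

lemma trace_rel_sound:
  assumes "trace_rel n b u v" "set u \<subseteq> gens n" "\<not> odd_word u" "x_degree u = m"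
  shows "word_mon u - signed b (word_mon v) \<in> U"
  using assms
proof (induction rule: trace_rel.induct)
  case (trace_rel_base b u v)
  then show ?case using word_rel_sound[of b u v "[]" "[]"] by simp
next
  case (trace_rel_rot u v)
  then show ?case by (intro U_trace) auto
next
  case (trace_rel_sym b u v)
  then have "word_mon u - signed b (word_mon v) \<in> U"
    using trace_rel_gens[OF trace_rel_sym.hyps] trace_rel_par[OF trace_rel_sym.hyps] trace_rel_deg[OF trace_rel_sym.hyps] by simp
  from U_sgf[OF U_minus[OF this], of b] show ?case by (cases b) (auto simp: algebra_simps)
next
  case (trace_rel_trans b u v b' w)
  then have 1: "word_mon u - signed b (word_mon v) \<in> U" and 2: "word_mon v - signed b' (word_mon w) \<in> U"
    using trace_rel_gens[OF trace_rel_trans.hyps(1)] trace_rel_par[OF trace_rel_trans.hyps(1)] trace_rel_deg[OF trace_rel_trans.hyps(1)] by simp_all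
  from U_add[OF 1 U_sgf[OF 2, of b]] show ?case by (cases b; cases b') auto
qed

lemma word_mon_U_step:
  assumes "set u \<subseteq> gens n" "\<not> odd_word u" "x_degree u = m"
  shows "word_mon u \<in> U"
proof -
  consider (half) "trace_rel n True u u" | (pow) b p q where "trace_rel n b u (p @ replicate d (XGen 1) @ q)"
    | (hat) b \<beta> where "\<beta> \<in> semibips_hat n d" "trace_rel n b u (bip_word \<beta>)"
    using even_word_cases[OF n assms(1,2), of d] by blast
  then show ?thesis
  proof cases
    case half
    obtain t :: 'r where t: "1 = 2 * t" using two by (auto elim: dvdE)
    have "word_mon u + word_mon u \<in> U" using trace_rel_sound[OF half assms] by simp
    then have "fsmult t (word_mon u + word_mon u) \<in> U" by (rule U_sm)
    moreover have "fsmult t (word_mon u + word_mon u) = fsmult (2 * t) (word_mon u :: 'r free)"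
      by (rule poly_mapping_eqI) (simp add: lookup_sm lookup_add algebra_simps)
    ultimately show ?thesis using t by (metis fsmult_simps(4))
  next
    case pow
    let ?x = "\<lambda>k. p @ replicate k (XGen 1) @ q"
    have pq: "set p \<subseteq> gens n" "set q \<subseteq> gens n" "\<not> odd_word (p @ q)" "x_degree p + d + x_degree q = m"
      using trace_rel_gens[OF pow] trace_rel_par[OF pow] trace_rel_deg[OF pow] assms by (auto simp: x_degree_def)
    have lower: "word_mon (?x k) \<in> U" if "k < d" for k
      using pq that n by (intro IH) (auto simp: x_degree_def)
    have even: "word_mon (?x k) \<in> even_free n" for k
      using pq n by (intro word_mon_even) auto
    \<comment> \<open>As \<open>g\<close> is monic of degree \<open>d\<close>, the term with
      \<open>x_1^d\<close> is the only one of degree \<open>m\<close>. The others have the same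
      parity and smaller degree, so they are in \<open>U\<close> already.\<close>
    have "word_mon p * g_at_x g * word_mon q = (\<Sum>k\<le>d. fsmult (Polynomial.coeff g k) (word_mon (?x k)))"
      by (simp add: g_at_x_def degree_g sum_distrib_left sum_distrib_right fsmult_mult_left fsmult_mult_right word_mon_append mult.assoc)
    also have "\<dots> = (\<Sum>k<d. fsmult (Polynomial.coeff g k) (word_mon (?x k))) + word_mon (?x d)"
      by (simp add: monic_g flip: lessThan_Suc_atMost)
    finally have e: "word_mon p * g_at_x g * word_mon q = (\<Sum>k<d. fsmult (Polynomial.coeff g k) (word_mon (?x k))) + word_mon (?x d)" .
    have "(\<Sum>k<N. fsmult (Polynomial.coeff g k) (word_mon (?x k))) \<in> even_free n" for N
      by (induction N) (auto intro!: hpart_free_closed even[simplified])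
    then have "word_mon p * g_at_x g * word_mon q \<in> even_free n" unfolding e using even hpart_free_closed(2) by blast
    then have "word_mon p * g_at_x g * word_mon q \<in> U" using J_U J_gpol pq by blast
    moreover have "(\<Sum>k<d. fsmult (Polynomial.coeff g k) (word_mon (?x k))) \<in> U"
      using lower by (intro U_sum U_sm) auto
    ultimately have "word_mon p * g_at_x g * word_mon q - (\<Sum>k<d. fsmult (Polynomial.coeff g k) (word_mon (?x k))) \<in> U"
      by (rule U_diff)
    then have "word_mon (?x d) \<in> U" unfolding e by simp
    from U_add[OF trace_rel_sound[OF pow assms] U_sgf[OF this, of b]] show ?thesis by simp
  next
    case hat
    from U_add[OF trace_rel_sound[OF hat(2) assms] U_sgf[OF U_word[OF hat(1)], of b]] show ?thesis by simp
  qed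
qed

end

theorem even_free_subset: "even_free n \<subseteq> U"
proof
  have w: "set u \<subseteq> gens n \<Longrightarrow> \<not> odd_word u \<Longrightarrow> word_mon u \<in> U" for u
  proof (induction "x_degree u" arbitrary: u rule: less_induct)
    case less
    show ?case
    proof (rule word_mon_U_step[of "x_degree u"])
      show "word_mon v \<in> U" if "set v \<subseteq> gens n" "\<not> odd_word v" "x_degree v < x_degree u" for v
        using less.hyps that by blast
    qed (use less.prems in simp_all)
  qed
  fix f :: "'r free" assume f: "f \<in> even_free n"
  have "(\<Sum>k\<in>Poly_Mapping.keys f. fsmult (Poly_Mapping.lookup f k) (word_mon (letters k))) \<in> U"
    using f by (intro U_sum U_sm w) (auto simp: hpart_free free_carrier_def word_parity_par)
  then show "f \<in> U" using free_sum_words[of f] by simp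
qed

end

section \<open>The spanning theorem\<close>

text \<open>Letters and parity are read off from the block word, where each even color visibly gives
  one Clifford generator, and are carried over by the invariance of \<open>word_rel\<close>.\<close>

lemma bip_word_even:
  assumes "\<beta> \<in> semibips_hat n d"
  shows "set (bip_word \<beta>) \<subseteq> gens n \<and> \<not> odd_word (bip_word \<beta>)"
proof -
  obtain lam col mu k where \<beta>: "\<beta> = ((lam, col), mu)" "k \<le> n" "opposite_partition k lam"
      "color_datum d lam col" "partition_of (n - k) mu"
    and ev: "even (card {i. i < length (parts \<beta>) \<and> even (colors \<beta> ! i)})"
    using assms by (auto simp: semibips_hat_def semibips_def)
  define bs where "bs = map (\<lambda>i. (parts \<beta> ! i, colors \<beta> ! i, even (colors \<beta> ! i))) [0..<length (parts \<beta>)]"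
  have len: "length (colors \<beta>) = length (parts \<beta>)"
    using \<beta> by (simp add: colors_def parts_def color_datum_def)
  have p: "parts \<beta> = map fst bs" by (simp add: bs_def comp_def map_nth)
  have c: "colors \<beta> = map (fst \<circ> snd) bs" by (simp add: bs_def comp_def map_nth flip: len)
  have "0 \<notin> set (parts \<beta>)" "sum_list (parts \<beta>) = n"
    using \<beta> by (auto simp: parts_def opposite_partition_def partition_of_def)
  then have pos: "\<forall>b\<in>set bs. 1 \<le> fst b" and sum: "sum_list (map fst bs) = n"
    unfolding p by (force simp: Suc_le_eq)+
  have fl: "\<forall>b\<in>set bs. snd (snd b) = even (fst (snd b))" by (auto simp: bs_def)
  have g: "set (blocks_word 0 bs) \<subseteq> gens n" using blocks_word_gens[of bs 0 n] pos sum by simp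
  have "{i. i < length (parts \<beta>) \<and> even (colors \<beta> ! i)} = {i. i < length bs \<and> snd (snd (bs ! i))}"
    by (auto simp: bs_def)
  then have "\<not> odd_word (blocks_word 0 bs)" using ev by (simp add: odd_word_blocks_word length_filter_conv_card)
  moreover have "word_rel n False (blocks_word 0 bs) (bip_word \<beta>)"
    unfolding bip_word_blocks[OF p c]
    by (rule word_rel_trans0[OF word_rel_blocks_xs word_rel_congR[OF word_rel_xs_ws]]) (use pos sum fl in auto)
  ultimately show ?thesis using g word_rel_gens word_rel_par by blast
qed

theorem lemma5p2:
  fixes n d :: nat
    and a :: "nat \<Rightarrow> 'r::comm_ring_1"
    and g :: "'r poly"
  assumes two_invertible: "(2::'r) dvd 1"
    and "n \<ge> 1" and "d \<ge> 1"
    and g_def: "g = (\<Sum>t\<le>d div 2. Polynomial.monom (a (d - 2 * t)) (d - 2 * t))"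
    and "a d = 1"
  shows "carrier (SupTr_even (cyclotomic_sergeev n g)) =
    rspan (SupTr_even (cyclotomic_sergeev n g))
      {supercomm_span_even (cyclotomic_sergeev n g) +>\<^bsub>cyclotomic_sergeev n g\<^esub> w_cl n g \<beta> | \<beta>.
        \<beta> \<in> semibips_hat n d}"
proof -
  let ?R = "ring_of_type_algebra :: 'r ring"
  define A where "A = cyclotomic_sergeev n g"
  define F where "F = (free_superalgebra n :: ('r, 'r free) superalgebra)"
  define H where "H = cyc_proj n g"
  have n: "1 \<le> n" by fact
  have ra: "ralgebra A" unfolding A_def by (rule ralgebra_cyclotomic[OF n])
  have mod: "module ?R A" using ra by (simp add: ralgebra_def)
  interpret A: ring A using ra by (simp add: ralgebra_def)
  interpret M: module ?R A by (rule mod)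
  interpret F: ring F unfolding F_def by (rule ring_free)
  have hom: "H \<in> ring_hom F A" unfolding H_def F_def A_def by (rule cyc_proj_props(1)[OF n])
  interpret H: ring_hom_ring F A H by (rule ring_hom_ringI2[OF F.ring_axioms A.ring_axioms hom])
  have Fs: "carrier F = free_carrier n" "monoid.mult F = (*)" "\<one>\<^bsub>F\<^esub> = 1" "\<zero>\<^bsub>F\<^esub> = 0" "add F = (+)"
    by (simp_all add: F_def)
  have Fneg: "\<ominus>\<^bsub>F\<^esub> f = - f" if "f \<in> free_carrier n" for f
    by (rule F.minus_equality) (use that in \<open>auto simp: Fs free_carrier_closed\<close>)
  have H_add: "H (f + h) = H f \<oplus>\<^bsub>A\<^esub> H h" if "f \<in> free_carrier n" "h \<in> free_carrier n" for f h
    using H.hom_add[of f h] that by (simp add: Fs)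
  have H_mult: "H (f * h) = H f \<otimes>\<^bsub>A\<^esub> H h" if "f \<in> free_carrier n" "h \<in> free_carrier n" for f h
    using H.hom_mult[of f h] that by (simp add: Fs)
  have H_neg: "H (- f) = \<ominus>\<^bsub>A\<^esub> H f" if "f \<in> free_carrier n" for f
    using H.hom_a_inv[of f] that by (simp add: Fs Fneg)
  have H_zero: "H 0 = \<zero>\<^bsub>A\<^esub>" using H.hom_zero by (simp_all add: Fs)
  have H_sm: "H (fsmult r f) = r \<odot>\<^bsub>A\<^esub> H f" if "f \<in> free_carrier n" for r f
    using cyc_proj_props(2)[OF n that] by (simp add: H_def A_def)
  have H_car: "H f \<in> carrier A" if "f \<in> free_carrier n" for f using H.hom_closed[of f] that by (simp add: Fs)
  have hp: "hpart A p = H ` hpart (free_superalgebra n) p" for p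
    unfolding A_def H_def by (rule cyc_proj_props(4)[OF n])
  have hpF: "f \<in> free_carrier n" if "f \<in> hpart (free_superalgebra n) p" for f :: "'r free" and p
    using that by (simp add: hpart_free)
  have hpA: "hpart A p \<subseteq> carrier A" for p unfolding hp using H_car hpF by blast
  define E where "E = hpart A 0"
  define N where "N = supercomm_span_even A"
  define M where "M = A\<lparr>carrier := E\<rparr>"
  define T where "T = SupTr_even A"
  have subE: "submodule E ?R A"
  proof (rule M.submoduleI)
    show "E \<subseteq> carrier A" unfolding E_def by (rule hpA)
    show "\<zero>\<^bsub>A\<^esub> \<in> E" unfolding E_def hp H_zero[symmetric] by (intro imageI hpart_free_closed)
    show "\<ominus>\<^bsub>A\<^esub> x \<in> E" if "x \<in> E" for x
      using that unfolding E_def hp by (auto simp: H_neg[symmetric] hpF intro!: imageI hpart_free_closed)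
    show "x \<oplus>\<^bsub>A\<^esub> y \<in> E" if "x \<in> E" "y \<in> E" for x y
      using that unfolding E_def hp by (auto simp: H_add[symmetric] hpF intro!: imageI hpart_free_closed)
    show "r \<odot>\<^bsub>A\<^esub> x \<in> E" if "x \<in> E" for r x
      using that unfolding E_def hp by (auto simp: H_sm[symmetric] hpF intro!: imageI hpart_free_closed)
  qed
  have "supercommutators A \<subseteq> carrier A"
    unfolding supercommutators_def using hpA by (auto simp: subset_iff split: if_splits intro!: A.minus_closed A.m_closed)
  then have subS: "submodule (supercomm_span A) ?R A"
    unfolding supercomm_span_def by (rule submodule_rspan[OF mod])
  have SN: "supercommutators A \<inter> E \<subseteq> N"
    unfolding N_def supercomm_span_even_def supercomm_span_def rspan_def E_def
    using hull_subset[of "supercommutators A" "\<lambda>N. submodule N ?R A"] by blast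
  have "submodule (\<Inter>{supercomm_span A, E}) ?R A"
    using subE subS by (intro submodule_Inter[OF mod]) auto
  then have subN: "submodule N ?R A" by (simp add: N_def supercomm_span_even_def E_def)
  have NE: "N \<subseteq> E" by (simp add: N_def supercomm_span_even_def E_def)
  have modM: "module ?R M" unfolding M_def by (rule submodule.submodule_is_module[OF subE mod])
  have Ms: "carrier M = E" "add M = add A" "module.smult M = module.smult A" "\<zero>\<^bsub>M\<^esub> = \<zero>\<^bsub>A\<^esub>" by (simp_all add: M_def)
  interpret MM: module ?R M by (rule modM)
  have subNM: "submodule N ?R M"
  proof (rule module.module_incl_imp_submodule[OF modM])
    show "N \<subseteq> carrier M" using NE by (simp add: Ms)
    have "M\<lparr>carrier := N\<rparr> = A\<lparr>carrier := N\<rparr>" by (simp add: M_def)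
    then show "module ?R (M\<lparr>carrier := N\<rparr>)" using submodule.submodule_is_module[OF subN mod] by simp
  qed
  \<comment> \<open>The claim forms cosets in \<open>A\<close>, \<open>SupTr_even\<close> forms them
    in the even part \<open>M\<close>. A coset depends on the addition only, so they agree.\<close>
  have cos: "N +>\<^bsub>M\<^esub> x = N +>\<^bsub>A\<^esub> x" for x by (simp add: a_r_coset_def' Ms)
  have Tq: "T = module_quot M N" by (simp add: T_def SupTr_even_def M_def N_def E_def)
  have Ts: "carrier T = a_rcosets\<^bsub>M\<^esub> N" "add T = set_add M" "\<zero>\<^bsub>T\<^esub> = N" "module.smult T = coset_smult M N"
    by (simp_all add: Tq module_quot_def)
  have modT: "module ?R T" by (rule quotient_module[OF modM subNM Ts])
  note q = quotient_coset_facts[OF modM subNM, folded Ts(2,4), unfolded cos Ms]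
  have carT: "carrier T = (\<lambda>x. N +>\<^bsub>A\<^esub> x) ` E" unfolding Ts(1) A_RCOSETS_def' by (auto simp: cos Ms)
  define G where "G = {N +>\<^bsub>A\<^esub> w_cl n g \<beta> | \<beta>. \<beta> \<in> semibips_hat n d}"
  have w: "w_cl n g \<beta> = H (word_mon (bip_word \<beta>))" "word_mon (bip_word \<beta>) \<in> even_free n" if "\<beta> \<in> semibips_hat n d" for \<beta>
    using bip_word_even[OF that] gen_prod_cyc[OF n, of "bip_word \<beta>" g] hpart_free_closed(6)[of "bip_word \<beta>" n]
    by (simp_all add: w_cl_bip_word H_def)
  have "G \<subseteq> carrier T"
    using w unfolding G_def carT E_def hp by blast
  then have le: "rspan T G \<subseteq> carrier T"
    unfolding rspan_def using module.carrier_is_submodule[OF modT] by (intro hull_minimal) auto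
  have cg: "Polynomial.coeff g j = (\<Sum>t\<le>d div 2. if d - 2 * t = j then a (d - 2 * t) else 0)" for j
    by (simp add: g_def coeff_sum)
  have cd: "Polynomial.coeff g d = 1"
  proof -
    \<comment> \<open>For \<open>t \<le> d div 2\<close> the subtraction never truncates, so the
      exponent \<open>d\<close> occurs for \<open>t = 0\<close> only.\<close>
    have "Polynomial.coeff g d = (\<Sum>t\<le>d div 2. if t = 0 then a d else 0)"
      unfolding cg using \<open>d \<ge> 1\<close> by (intro sum.cong) auto
    then show ?thesis using \<open>a d = 1\<close> by simp
  qed
  have "Polynomial.degree g \<le> d" by (rule degree_le) (auto simp: cg intro!: sum.neutral)
  then have dg: "Polynomial.degree g = d" using cd by (intro antisym le_degree) auto
  \<comment> \<open>The span is an intersection of submodules. Testing against an arbitrary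
    submodule \<open>NN\<close> that contains the generators spares writing down linear
    combinations.\<close>
  have ge: "carrier T \<subseteq> NN" if NN: "submodule NN ?R T" "G \<subseteq> NN" for NN
  proof -
    note sE = module.submoduleE[OF modT NN(1)]
    have NNzero: "N \<in> NN" using subgroup.one_closed[OF submodule.axioms(1)[OF NN(1)]] by (simp add: Ts)
    define U where "U = {f \<in> even_free n. N +>\<^bsub>A\<^esub> H f \<in> NN}"
    define J where "J = {f \<in> free_carrier n. H f = \<zero>\<^bsub>A\<^esub>}"
    have HE: "H f \<in> E" if "f \<in> even_free n" for f using that by (simp add: E_def hp)
    \<comment> \<open>An element mapped into \<open>N\<close> has the zero class, which lies in
      every submodule. Both the kernel \<open>J\<close> and the supercommutators enter
      \<open>U\<close> in this way.\<close>
    have UN: "f \<in> U" if "f \<in> even_free n" "H f \<in> N" for f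
      using q(3)[of "H f"] HE[OF that(1)] that NNzero by (simp add: U_def)
    have N0: "\<zero>\<^bsub>A\<^esub> \<in> N" using subgroup.one_closed[OF submodule.axioms(1)[OF subN]] by simp
    have wmc: "word_mon p \<in> free_carrier n" if "set p \<subseteq> gens n" for p :: "gen list" using that by (rule free_carrier_closed)
    have Jctx: "word_mon p * f * word_mon q' \<in> J" if "f \<in> J" "set p \<subseteq> gens n" "set q' \<subseteq> gens n" for f p q'
      using that wmc[OF that(2)] wmc[OF that(3)] by (simp add: J_def H_mult free_carrier_closed H_car)
    have "even_span n d g J U"
    proof
      show "0 \<in> U" by (rule UN) (auto simp: hpart_free_closed H_zero N0)
      show "f + h \<in> U" if "f \<in> U" "h \<in> U" for f h
      proof -
        have f: "f \<in> even_free n" "h \<in> even_free n" "N +>\<^bsub>A\<^esub> H f \<in> NN" "N +>\<^bsub>A\<^esub> H h \<in> NN"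
          using that by (auto simp: U_def)
        have "(N +>\<^bsub>A\<^esub> H f) \<oplus>\<^bsub>T\<^esub> (N +>\<^bsub>A\<^esub> H h) = N +>\<^bsub>A\<^esub> H (f + h)"
          using q(1)[of "H f" "H h"] HE f hpF by (simp add: H_add)
        then have "N +>\<^bsub>A\<^esub> H (f + h) \<in> NN" using sE(5)[OF f(3,4)] by simp
        then show ?thesis using f hpart_free_closed(2)[of f n 0 h] by (simp add: U_def)
      qed
      show "fsmult r f \<in> U" if "f \<in> U" for f r
      proof -
        have f: "f \<in> even_free n" "N +>\<^bsub>A\<^esub> H f \<in> NN" using that by (auto simp: U_def)
        have "r \<odot>\<^bsub>T\<^esub> (N +>\<^bsub>A\<^esub> H f) = N +>\<^bsub>A\<^esub> H (fsmult r f)"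
          using q(2)[of r "H f"] HE f hpF by (simp add: H_sm)
        then have "N +>\<^bsub>A\<^esub> H (fsmult r f) \<in> NN" using sE(4)[OF _ f(2), of r] by simp
        then show ?thesis using f hpart_free_closed(5)[of f n 0 r] by (simp add: U_def)
      qed
      show "f + h \<in> J" if "f \<in> J" "h \<in> J" for f h
        using that by (simp add: J_def H_add free_carrier_closed)
      show "- f \<in> J" if "f \<in> J" for f
        using that by (simp add: J_def H_neg free_carrier_closed)
      show "f \<in> U" if "f \<in> J" "f \<in> even_free n" for f
        using that N0 by (intro UN) (auto simp: J_def)
      show "word_mon p * f * word_mon q' \<in> J" if "f \<in> sergeev_rels n" "set p \<subseteq> gens n" "set q' \<subseteq> gens n" for f p q'
      proof (rule Jctx[OF _ that(2,3)])
        have "sergeev_rels n \<subseteq> (sergeev_ideal n :: 'r free set)"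
          unfolding sergeev_ideal_def using sergeev_rels_carrier by (intro ring.genideal_self[OF ring_free]) auto
        moreover have "f \<in> free_carrier n" using that(1) sergeev_rels_carrier by blast
        ultimately show "f \<in> J" using that cyc_proj_props(5)[OF n, of f g] by (auto simp: J_def H_def A_def)
      qed
      show "word_mon p * g_at_x g * word_mon q' \<in> J" if "set p \<subseteq> gens n" "set q' \<subseteq> gens n" for p q'
        by (rule Jctx[OF _ that]) (simp add: J_def H_def A_def g_at_x_free[OF n] cyc_proj_props(6)[OF n])
      show "word_mon (u @ v) - signed (odd_word u) (word_mon (v @ u)) \<in> U"
        if u: "set u \<subseteq> gens n" and v: "set v \<subseteq> gens n" and p: "odd_word u = odd_word v" for u v
      proof (rule UN)
        have "word_mon (u @ v) \<in> even_free n" "word_mon (v @ u) \<in> even_free n"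
          using hpart_free_closed(6)[of "u @ v" n] hpart_free_closed(6)[of "v @ u" n] u v p by auto
        then show ev: "word_mon (u @ v) - signed (odd_word u) (word_mon (v @ u)) \<in> even_free n"
          by (cases "odd_word u") (auto intro: hpart_free_closed)
        have c: "word_mon u \<in> free_carrier n" "word_mon v \<in> free_carrier n" using u v by (auto intro: wmc)
        have c2: "word_mon u * word_mon v \<in> free_carrier n" "word_mon v * word_mon u \<in> free_carrier n"
          using c by (auto intro: free_carrier_closed)
        have "H (word_mon (u @ v) - signed (odd_word u) (word_mon (v @ u))) =
          H (word_mon u) \<otimes>\<^bsub>A\<^esub> H (word_mon v) \<ominus>\<^bsub>A\<^esub> (if odd_word u then \<ominus>\<^bsub>A\<^esub> \<one>\<^bsub>A\<^esub> else \<one>\<^bsub>A\<^esub>) \<otimes>\<^bsub>A\<^esub> (H (word_mon v) \<otimes>\<^bsub>A\<^esub> H (word_mon u))"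
        proof (cases "odd_word u")
          case True
          then show ?thesis using c H_car[OF c(1)] H_car[OF c(2)]
            by (simp add: word_mon_append H_add[OF c2] H_mult[OF c] H_mult[OF c(2,1)] A.minus_eq A.l_minus)
        next
          case False
          have "word_mon u * word_mon v - word_mon v * word_mon u = word_mon u * word_mon v + - (word_mon v * word_mon u)" by simp
          then have "H (word_mon u * word_mon v - word_mon v * word_mon u) = H (word_mon u * word_mon v) \<oplus>\<^bsub>A\<^esub> \<ominus>\<^bsub>A\<^esub> H (word_mon v * word_mon u)"
            using H_add[OF c2(1) free_carrier_closed(5)[OF c2(2)]] H_neg[OF c2(2)] by simp
          then show ?thesis using c H_car[OF c(1)] H_car[OF c(2)] False
            by (simp add: word_mon_append H_mult[OF c] H_mult[OF c(2,1)] A.minus_eq)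
        qed
        also have "\<dots> \<in> supercommutators A"
        proof -
          have "H (word_mon u) \<in> hpart A (of_bool (odd_word u))" "H (word_mon v) \<in> hpart A (of_bool (odd_word v))"
            unfolding hp using hpart_free_closed(6) u v by blast+
          then show ?thesis unfolding supercommutators_def using p
            by (intro CollectI exI[of _ "H (word_mon u)"] exI[of _ "H (word_mon v)"] exI[of _ "of_bool (odd_word u)"] exI[of _ "of_bool (odd_word v)"]) auto
        qed
        finally show "H (word_mon (u @ v) - signed (odd_word u) (word_mon (v @ u))) \<in> N"
          using SN HE[OF ev] by blast
      qed
      show "word_mon (bip_word \<beta>) \<in> U" if "\<beta> \<in> semibips_hat n d" for \<beta>
      proof -
        have "N +>\<^bsub>A\<^esub> w_cl n g \<beta> \<in> NN" using NN(2) that unfolding G_def by blast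
        then show ?thesis using w[OF that] by (simp add: U_def)
      qed
    qed (use n \<open>d \<ge> 1\<close> two_invertible dg cd in auto)
    then have "even_free n \<subseteq> U" by (rule even_span.even_free_subset)
    then show ?thesis unfolding carT E_def hp U_def by auto
  qed
  have "carrier T \<subseteq> rspan T G"
    unfolding rspan_def hull_def using ge by blast
  then have "carrier T = rspan T G" using le by blast
  then show ?thesis by (simp add: T_def A_def G_def N_def)
qed

end
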